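(* Let $\mathscr{X}$ be a shellable, strongly regular CW sphere or CW ball of dimension $d \geq 1$. Then for all integers $k$ with $\lfloor \frac{d-1}{2} \rfloor \leq k \leq d$, \[ f_k(\mathscr{X}) \geq \frac{1}{2} \left[\binom{\lceil \frac{d+1}{2} \rceil}{d-k} + \binom{\lfloor \frac{d+1}{2} \rfloor}{d-k}\right]f_d(\mathscr{X}) + \frac{1}{2}f_k(\partial \mathscr{X}), \] with equality precisely when $k=d$, or when $k=d-1$ and $\mathscr{X}$ is simplicial.
   Context: A (finite) CW complex is built inductively by attaching closed balls (cells) along their boundaries; it is regular if each attaching map is a homeomorphism onto its image, and strongly regular if it is regular and for any two faces (closed cells) $G_1,G_2$ the intersection $|G_1|\cap|G_2|$ is the realization of a (possibly empty) face. The faces of $\mathscr{X}$ are its closed cells together with the empty face; $f_k(S)$ denotes the number of $k$-dimensional faces in a set $S$ of faces. A CW $d$-sphere (resp. $d$-ball) is a strongly regular CW $d$-complex whose underlying space is homeomorphic to $\mathbb{S}^d$ (resp. $\mathbb{B}^d$). A strongly regular $d$-complex is pure if every face lies in a $d$-face, and a pseudomanifold if moreover every $(d-1)$-face lies in at most two $d$-faces. For a set $S$ of faces, the closure $\langle S\rangle$ is the complex of all faces contained in some member of $S$; for a face $F$, $\partial F$ denotes $\partial\langle F\rangle$. For a pseudomanifold $\mathscr{X}$, the boundary complex $\partial\mathscr{X}$ is the closure of the set of $(d-1)$-faces lying in exactly one $d$-face (so it is empty for a sphere), and $\operatorname{int}\mathscr{X}$ is the set of faces not in $\partial\mathscr{X}$.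 Shellings are defined recursively: for a pure regular CW $d$-complex, an ordering $(F_1,\ldots,F_n)$ of its $d$-faces is a shelling if $d=0$, or $d>0$ and (i) each $\partial F_j$ has a shelling, and (ii) for each $1<j\le n$, $\partial F_j\cap\bigcup_{i<j}\partial F_i$ is a pure $(d-1)$-complex and some shelling of $\partial F_j$ begins with the $(d-1)$-faces of this intersection. A complex is shellable if it admits a shelling. $\mathscr{X}$ is simplicial if every face of $\mathscr{X}$ is a simplex (combinatorially). *)

theory Defs
  imports "HOL-Analysis.Analysis"
begin

section \<open>Finite CW complexes\<close>

definition unit_ball :: "nat \<Rightarrow> (nat \<Rightarrow> real) topology" where
  "unit_ball n = subtopology (Euclidean_space n) {x. (\<Sum>i<n. x i ^ 2) \<le> 1}"

definition open_unit_ball :: "nat \<Rightarrow> (nat \<Rightarrow> real) topology" where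
  "open_unit_ball n = subtopology (Euclidean_space n) {x. (\<Sum>i<n. x i ^ 2) < 1}"

text \<open>The boundary of the \<open>n\<close>-ball is \<open>nsphere (n - 1)\<close> for \<open>n > 0\<close>, but it is empty for
  \<open>n = 0\<close>, which \<open>nsphere\<close> cannot express.\<close>

definition ball_boundary :: "nat \<Rightarrow> (nat \<Rightarrow> real) topology" where
  "ball_boundary n = subtopology (Euclidean_space n) {x. (\<Sum>i<n. x i ^ 2) = 1}"

text \<open>A cell \<open>i\<close> of dimension \<open>cw_dim X i\<close> is given by its characteristic map \<open>cw_map X i\<close>, defined
  on the closed unit ball; the restriction to the boundary of the ball is the attaching map.\<close>

record ('i, 'a) cw =
  cw_space :: "'a topology"
  cw_cells :: "'i set"
  cw_dim :: "'i \<Rightarrow> nat"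
  cw_map :: "'i \<Rightarrow> (nat \<Rightarrow> real) \<Rightarrow> 'a"

definition closed_cell :: "('i, 'a) cw \<Rightarrow> 'i \<Rightarrow> 'a set" where
  "closed_cell X i = cw_map X i ` topspace (unit_ball (cw_dim X i))"

definition open_cell :: "('i, 'a) cw \<Rightarrow> 'i \<Rightarrow> 'a set" where
  "open_cell X i = cw_map X i ` topspace (open_unit_ball (cw_dim X i))"

text \<open>The skeleton of cells of dimension strictly below \<open>n\<close>.\<close>

definition skeleton_below :: "('i, 'a) cw \<Rightarrow> nat \<Rightarrow> 'a set" where
  "skeleton_below X n = (\<Union>i \<in> {i \<in> cw_cells X. cw_dim X i < n}. open_cell X i)"

text \<open>Whitehead's intrinsic description of a space built by successively attaching balls of
  increasing dimension along their boundaries. With finitely many cells the space is compact, so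
  the Hausdorff condition already forces it to carry the quotient topology of the successive
  attachments.\<close>

definition cw_complex :: "('i, 'a) cw \<Rightarrow> bool" where
  "cw_complex X \<longleftrightarrow>
     Hausdorff_space (cw_space X) \<and>
     finite (cw_cells X) \<and>
     (\<forall>i\<in>cw_cells X.
        continuous_map (unit_ball (cw_dim X i)) (cw_space X) (cw_map X i) \<and>
        embedding_map (open_unit_ball (cw_dim X i)) (cw_space X) (cw_map X i) \<and>
        cw_map X i ` topspace (ball_boundary (cw_dim X i)) \<subseteq> skeleton_below X (cw_dim X i)) \<and>
     (\<forall>i\<in>cw_cells X. \<forall>j\<in>cw_cells X. i \<noteq> j \<longrightarrow> disjnt (open_cell X i) (open_cell X j)) \<and>
     (\<Union>i\<in>cw_cells X. open_cell X i) = topspace (cw_space X)"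

definition regular_cw :: "('i, 'a) cw \<Rightarrow> bool" where
  "regular_cw X \<longleftrightarrow> cw_complex X \<and>
     (\<forall>i\<in>cw_cells X. embedding_map (ball_boundary (cw_dim X i)) (cw_space X) (cw_map X i))"

text \<open>Faces are represented by their realizations, i.e. as sets of points; in a regular complex
  distinct cells have distinct closed cells, so nothing is lost.\<close>

definition faces :: "('i, 'a) cw \<Rightarrow> 'a set set" where
  "faces X = insert {} (closed_cell X ` cw_cells X)"

definition strongly_regular_cw :: "('i, 'a) cw \<Rightarrow> bool" where
  "strongly_regular_cw X \<longleftrightarrow> regular_cw X \<and> (\<forall>G\<in>faces X. \<forall>H\<in>faces X. G \<inter> H \<in> faces X)"


section \<open>Sets of faces\<close>

text \<open>The empty face has dimension \<open>-1\<close>. The description is well defined on the faces of a regular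
  complex.\<close>

definition face_dim :: "('i, 'a) cw \<Rightarrow> 'a set \<Rightarrow> int" where
  "face_dim X F =
     (if F = {} then -1 else int (cw_dim X (THE i. i \<in> cw_cells X \<and> closed_cell X i = F)))"

text \<open>In what follows \<open>K\<close> and \<open>S\<close> are sets of faces of \<open>X\<close>.\<close>

definition faces_of_dim :: "('i, 'a) cw \<Rightarrow> 'a set set \<Rightarrow> int \<Rightarrow> 'a set set" where
  "faces_of_dim X S k = {F \<in> S. face_dim X F = k}"

definition f_num :: "('i, 'a) cw \<Rightarrow> int \<Rightarrow> 'a set set \<Rightarrow> nat" where
  "f_num X k S = card (faces_of_dim X S k)"

definition face_closure :: "('i, 'a) cw \<Rightarrow> 'a set set \<Rightarrow> 'a set set" where
  "face_closure X S = {G \<in> faces X. \<exists>F\<in>S. G \<subseteq> F}"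

definition subcomplex :: "('i, 'a) cw \<Rightarrow> 'a set set \<Rightarrow> bool" where
  "subcomplex X K \<longleftrightarrow> K \<subseteq> faces X \<and> face_closure X K = K"

definition complex_dim :: "('i, 'a) cw \<Rightarrow> 'a set set \<Rightarrow> int" where
  "complex_dim X K = Max (face_dim X ` K)"

text \<open>In particular a pure \<open>d\<close>-complex has at least one \<open>d\<close>-face.\<close>

definition pure_complex :: "('i, 'a) cw \<Rightarrow> int \<Rightarrow> 'a set set \<Rightarrow> bool" where
  "pure_complex X d K \<longleftrightarrow>
     subcomplex X K \<and> K \<noteq> {} \<and> complex_dim X K = d \<and>
     (\<forall>F\<in>K. \<exists>G\<in>faces_of_dim X K d. F \<subseteq> G)"

definition boundary_complex :: "('i, 'a) cw \<Rightarrow> 'a set set \<Rightarrow> 'a set set" where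
  "boundary_complex X K =
     face_closure X {G \<in> faces_of_dim X K (complex_dim X K - 1).
       card {F \<in> faces_of_dim X K (complex_dim X K). G \<subseteq> F} = 1}"

definition face_boundary :: "('i, 'a) cw \<Rightarrow> 'a set \<Rightarrow> 'a set set" where
  "face_boundary X F = boundary_complex X (face_closure X {F})"

text \<open>A face is combinatorially a simplex if its face poset is that of a simplex, i.e. the lattice
  of all subsets of its vertex set.\<close>

definition is_simplex :: "('i, 'a) cw \<Rightarrow> 'a set \<Rightarrow> bool" where
  "is_simplex X F \<longleftrightarrow>
     (\<exists>(V :: nat set) \<phi>. finite V \<and> int (card V) = face_dim X F + 1 \<and>
        bij_betw \<phi> (face_closure X {F}) (Pow V) \<and>
        (\<forall>G\<in>face_closure X {F}. \<forall>H\<in>face_closure X {F}. G \<subseteq> H \<longleftrightarrow> \<phi> G \<subseteq> \<phi> H))"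

definition simplicial :: "('i, 'a) cw \<Rightarrow> bool" where
  "simplicial X \<longleftrightarrow> (\<forall>F\<in>faces X. is_simplex X F)"


section \<open>Shellings\<close>

text \<open>\<open>shelling d X K Fs\<close>: the list \<open>Fs\<close> is a shelling of the pure \<open>d\<close>-complex \<open>K\<close>. Lists are indexed
  from 0, so the condition on the intersection concerns the positions \<open>j > 0\<close>.\<close>

primrec shelling :: "nat \<Rightarrow> ('i, 'a) cw \<Rightarrow> 'a set set \<Rightarrow> 'a set list \<Rightarrow> bool" where
  "shelling 0 X K Fs \<longleftrightarrow>
     pure_complex X 0 K \<and> distinct Fs \<and> set Fs = faces_of_dim X K 0"
| "shelling (Suc d) X K Fs \<longleftrightarrow>
     pure_complex X (int (Suc d)) K \<and> distinct Fs \<and> set Fs = faces_of_dim X K (int (Suc d)) \<and>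
     (\<forall>j<length Fs. \<exists>Gs. shelling d X (face_boundary X (Fs ! j)) Gs) \<and>
     (\<forall>j<length Fs. 0 < j \<longrightarrow>
        (let L = face_boundary X (Fs ! j) \<inter> (\<Union>i<j. face_boundary X (Fs ! i)) in
           pure_complex X (int d) L \<and>
           (\<exists>Gs m. shelling d X (face_boundary X (Fs ! j)) Gs \<and>
                   set (take m Gs) = faces_of_dim X L (int d))))"

definition shellable :: "nat \<Rightarrow> ('i, 'a) cw \<Rightarrow> bool" where
  "shellable d X \<longleftrightarrow> (\<exists>Fs. shelling d X (faces X) Fs)"


section \<open>Spheres and balls\<close>

definition cw_sphere :: "nat \<Rightarrow> ('i, 'a) cw \<Rightarrow> bool" where
  "cw_sphere d X \<longleftrightarrow> strongly_regular_cw X \<and> complex_dim X (faces X) = int d \<and>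
     cw_space X homeomorphic_space nsphere d"

definition cw_ball :: "nat \<Rightarrow> ('i, 'a) cw \<Rightarrow> bool" where
  "cw_ball d X \<longleftrightarrow> strongly_regular_cw X \<and> complex_dim X (faces X) = int d \<and>
     cw_space X homeomorphic_space unit_ball d"

end

theory Submission
  imports Defs "HOL-Homology.Invariance_of_Domain"
begin

text \<open>Let \<open>A\<close> be the set of ridges along which the facet \<open>F\<close> is attached in the shelling, and \<open>B\<close> the
  set of its other ridges. The \<open>k\<close>-faces that are new in \<open>F\<close> are those contained in no ridge of \<open>A\<close>, so
  the numbers of these add up to \<open>f\<^sub>k(X)\<close>. Dually, a face contained in no ridge of \<open>B\<close> has its star
  completed by \<open>F\<close>; it is an interior face and occurs for only one \<open>F\<close>, so the numbers of these add up
  to at most \<open>f\<^sub>k(X) - f\<^sub>k(\<partial>X)\<close>. The facet \<open>F\<close> has faces \<open>G\<close> and \<open>H\<close> whose codimensions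
  \<open>a\<close> and \<open>b\<close> in \<open>F\<close> satisfy \<open>a + b \<ge> d + 1\<close>, such that \<open>A\<close> contains all ridges through \<open>G\<close> and none
  through \<open>H\<close>. As an interval of rank \<open>a\<close> in a lattice with the diamond property has at least as many
  elements of every rank as a Boolean lattice, \<open>F\<close> contributes at least
  \<open>(a choose d - k) + (b choose d - k)\<close> to the two sums together, which is smallest for balanced \<open>a\<close> and \<open>b\<close>. For
  \<open>k \<le> d - 2\<close> the first facet, where \<open>A\<close> is empty, contributes strictly more.\<close>

section \<open>Graded face lattices with the diamond property\<close>

text \<open>For spheres the dual count would follow if the reversed order were again a shelling. The
  argument needs less: at most one facet completes the star of a given face, and a completed star
  leaves no boundary ridge through that face. Both are proved with chains modulo 2, by induction on
  the dimension. The factor 1/2 arises because the counts of new and of completed faces are both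
  compared with the same face number. In codimension 1 both counts are exact, so twice the number of
  ridges is the sum of the ridge numbers of the facets plus the number of boundary ridges. Equality
  therefore means \<open>d + 1\<close> ridges in every facet. Such a facet is a simplex: sending a
  face to the set of ridges not containing it embeds its faces into the subsets of a set of size
  \<open>d + 1\<close>, and there are too many faces to miss a subset. Topology is confined to two
  consequences of invariance of domain: the boundary sphere of a cell yields the grading and the
  diamond property, and a ridge of a sphere or ball lies in at most two facets.\<close>

lemma face_dim_empty [simp]: "face_dim X {} = -1"
  by (simp add: face_dim_def)

text \<open>All that the combinatorial argument takes from topology. The empty face is the bottom
  element, of dimension -1, so \<open>grading\<close> and \<open>diamond\<close> also speak about
  it: \<open>diamond\<close> at \<open>{}\<close> says that an edge has two vertices.\<close>

locale face_lattice =
  fixes X :: "('i, 'a) cw"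
  assumes finite_faces: "finite (faces X)"
    and inter_face: "G \<in> faces X \<Longrightarrow> H \<in> faces X \<Longrightarrow> G \<inter> H \<in> faces X"
    and face_dim_strict: "G \<in> faces X \<Longrightarrow> H \<in> faces X \<Longrightarrow> G \<subset> H \<Longrightarrow> face_dim X G < face_dim X H"
    and grading: "G \<in> faces X \<Longrightarrow> H \<in> faces X \<Longrightarrow> G \<subset> H \<Longrightarrow>
      \<exists>M\<in>faces X. G \<subseteq> M \<and> M \<subset> H \<and> face_dim X M = face_dim X H - 1"
    and diamond: "G \<in> faces X \<Longrightarrow> H \<in> faces X \<Longrightarrow> G \<subseteq> H \<Longrightarrow> face_dim X H = face_dim X G + 2 \<Longrightarrow>
      card {M \<in> faces X. G \<subseteq> M \<and> M \<subseteq> H \<and> face_dim X M = face_dim X G + 1} = 2"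
begin

definition ridges_of :: "'a set \<Rightarrow> 'a set set" where
  "ridges_of F = {R \<in> faces X. R \<subseteq> F \<and> face_dim X R = face_dim X F - 1}"

lemma empty_face: "{} \<in> faces X"
  by (simp add: faces_def)

lemma face_dim_nonneg: "G \<noteq> {} \<Longrightarrow> face_dim X G \<ge> 0"
  by (simp add: face_dim_def)

lemma face_dim_ge: "face_dim X G \<ge> -1"
  by (simp add: face_dim_def)

lemma face_dim_mono: "G \<in> faces X \<Longrightarrow> H \<in> faces X \<Longrightarrow> G \<subseteq> H \<Longrightarrow> face_dim X G \<le> face_dim X H"
  using face_dim_strict[of G H] by (cases "G = H") (simp_all add: psubset_eq order_less_imp_le)

lemma face_eqI: "G \<in> faces X \<Longrightarrow> H \<in> faces X \<Longrightarrow> G \<subseteq> H \<Longrightarrow> face_dim X H \<le> face_dim X G \<Longrightarrow> G = H"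
  using face_dim_strict[of G H] by auto

lemma ridges_of_subset_faces: "ridges_of F \<subseteq> faces X"
  by (auto simp: ridges_of_def)

lemma finite_ridges_of: "finite (ridges_of F)"
  using finite_faces ridges_of_subset_faces finite_subset by blast

section \<open>Atomic intervals and lower bounds for their rank numbers\<close>

lemma ridge_above:
  assumes "G \<in> faces X" "F \<in> faces X" "G \<subset> F"
  obtains R where "R \<in> ridges_of F" "G \<subseteq> R"
  using grading[OF assms] by (auto simp: ridges_of_def)

text \<open>Descend from \<open>F\<close> through a ridge to a face \<open>Q\<close> of codimension
  2 that still contains \<open>G\<close>; the diamond between \<open>Q\<close> and \<open>F\<close>
  supplies the two ridges.\<close>

lemma two_ridges_above:
  assumes "G \<in> faces X" "F \<in> faces X" "G \<subseteq> F" "face_dim X G \<le> face_dim X F - 2"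
  obtains R S where "R \<in> ridges_of F" "S \<in> ridges_of F" "G \<subseteq> R" "G \<subseteq> S" "R \<noteq> S"
proof -
  have "G \<subset> F" using assms by auto
  then obtain R where R: "R \<in> ridges_of F" "G \<subseteq> R" using ridge_above assms by metis
  have Rf: "R \<in> faces X" "face_dim X R = face_dim X F - 1" "R \<subseteq> F" using R by (auto simp: ridges_of_def)
  have "G \<subset> R" using R Rf assms(4) by (cases "G = R") auto
  then obtain Q where Q: "Q \<in> ridges_of R" "G \<subseteq> Q" using ridge_above assms Rf by metis
  have Qf: "Q \<in> faces X" "face_dim X Q = face_dim X F - 2" "Q \<subseteq> R"
    using Q Rf by (auto simp: ridges_of_def)
  have "card {M \<in> faces X. Q \<subseteq> M \<and> M \<subseteq> F \<and> face_dim X M = face_dim X Q + 1} = 2"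
    by (rule diamond) (use Qf Rf assms in auto)
  then obtain M N where MN: "{M \<in> faces X. Q \<subseteq> M \<and> M \<subseteq> F \<and> face_dim X M = face_dim X Q + 1} = {M, N}" "M \<noteq> N"
    by (auto simp: card_2_iff)
  have M: "M \<in> faces X" "Q \<subseteq> M" "M \<subseteq> F" "face_dim X M = face_dim X Q + 1"
    using MN(1) by blast+
  have N: "N \<in> faces X" "Q \<subseteq> N" "N \<subseteq> F" "face_dim X N = face_dim X Q + 1"
    using MN(1) by blast+
  show ?thesis
    by (rule that[of M N]) (use M N Q Qf MN(2) in \<open>auto simp: ridges_of_def\<close>)
qed

text \<open>Intervals are atomic. A face \<open>M\<close> of least dimension that contains
  \<open>G\<close> but does not lie in \<open>E\<close> must cover \<open>G\<close>: otherwise it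
  has two ridges through \<open>G\<close>, which lie in \<open>E\<close> by minimality, hence in the
  proper face \<open>M \<inter> E\<close>, so both equal it.\<close>

lemma cover_outside:
  assumes "G \<in> faces X" "E \<in> faces X" "F \<in> faces X" "G \<subseteq> E" "E \<subset> F"
  obtains M where "M \<in> faces X" "G \<subseteq> M" "M \<subseteq> F" "\<not> M \<subseteq> E" "face_dim X M = face_dim X G + 1"
proof -
  define P where "P = (\<lambda>M. M \<in> faces X \<and> G \<subseteq> M \<and> M \<subseteq> F \<and> \<not> M \<subseteq> E)"
  have "P F" using assms by (auto simp: P_def)
  then obtain M where M: "P M" and min: "\<And>N. P N \<Longrightarrow> nat (face_dim X M + 1) \<le> nat (face_dim X N + 1)"
    using ex_has_least_nat[of P F "\<lambda>N. nat (face_dim X N + 1)"] by blast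
  have min': "face_dim X M \<le> face_dim X N" if "P N" for N
    using min[OF that] face_dim_ge[of M] face_dim_ge[of N] by linarith
  have Mf: "M \<in> faces X" "G \<subseteq> M" "M \<subseteq> F" "\<not> M \<subseteq> E" using M by (auto simp: P_def)
  have GM: "G \<subset> M" using Mf assms by auto
  have "face_dim X M = face_dim X G + 1"
  proof (rule ccontr)
    assume "face_dim X M \<noteq> face_dim X G + 1"
    then have "face_dim X G \<le> face_dim X M - 2"
      using face_dim_strict[OF assms(1) Mf(1) GM] by auto
    then obtain R S where RS: "R \<in> ridges_of M" "S \<in> ridges_of M" "G \<subseteq> R" "G \<subseteq> S" "R \<noteq> S"
      using two_ridges_above[OF assms(1) Mf(1) Mf(2)] by metis
    have below: "N \<subseteq> M \<inter> E" if "N \<in> ridges_of M" "G \<subseteq> N" for N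
    proof -
      have "\<not> P N" using min'[of N] that by (auto simp: ridges_of_def)
      then show ?thesis using that Mf by (auto simp: P_def ridges_of_def)
    qed
    have ME: "M \<inter> E \<in> faces X" "M \<inter> E \<subset> M" using inter_face Mf assms by auto
    have "N = M \<inter> E" if "N \<in> ridges_of M" "G \<subseteq> N" for N
      by (rule face_eqI) (use that below ME face_dim_strict[OF ME(1) Mf(1) ME(2)] in \<open>auto simp: ridges_of_def\<close>)
    then show False using RS by metis
  qed
  then show ?thesis using that Mf by blast
qed

definition interval_faces :: "'a set \<Rightarrow> 'a set \<Rightarrow> nat \<Rightarrow> 'a set set" where
  "interval_faces G F m = {H \<in> faces X. G \<subseteq> H \<and> H \<subseteq> F \<and> face_dim X H = face_dim X F - int m}"

lemma finite_interval_faces: "finite (interval_faces G F m)"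
  unfolding interval_faces_def using finite_faces by auto

text \<open>Induction by Pascal's rule. For a ridge \<open>R\<close> of \<open>F\<close> through
  \<open>G\<close> and a face \<open>M\<close> covering \<open>G\<close> outside \<open>R\<close>,
  the intervals from \<open>G\<close> to \<open>R\<close> and from \<open>M\<close> to
  \<open>F\<close> are disjoint, and each has rank one less. The index \<open>m\<close> is the
  codimension in \<open>F\<close>, which drops by one when \<open>F\<close> is replaced by
  \<open>R\<close>.\<close>

lemma card_interval_faces_ge:
  assumes "G \<in> faces X" "F \<in> faces X" "G \<subseteq> F" "face_dim X F - face_dim X G = int a"
  shows "a choose m \<le> card (interval_faces G F m)"
  using assms
proof (induction a arbitrary: G F m)
  case 0
  show ?case
  proof (cases m)
    case [simp]: 0
    have "F \<in> interval_faces G F m" using 0 "0.prems" by (auto simp: interval_faces_def)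
    then have "card (interval_faces G F m) > 0" using finite_interval_faces card_gt_0_iff by blast
    then show ?thesis by simp
  qed auto
next
  case (Suc a)
  show ?case
  proof (cases m)
    case [simp]: 0
    have "F \<in> interval_faces G F m" using 0 Suc.prems by (auto simp: interval_faces_def)
    then have "card (interval_faces G F m) > 0" using finite_interval_faces card_gt_0_iff by blast
    then show ?thesis by simp
  next
    case [simp]: (Suc m')
    have GF: "G \<subset> F" using Suc.prems by auto
    obtain R where R: "R \<in> ridges_of F" "G \<subseteq> R" using ridge_above Suc.prems GF by metis
    then have Rf: "R \<in> faces X" "R \<subseteq> F" "face_dim X R = face_dim X F - 1" by (auto simp: ridges_of_def)
    then have "R \<subset> F" by auto
    then obtain M where M: "M \<in> faces X" "G \<subseteq> M" "M \<subseteq> F" "\<not> M \<subseteq> R" "face_dim X M = face_dim X G + 1"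
      using cover_outside[of G R F] R Rf Suc.prems by metis
    have 1: "a choose m' \<le> card (interval_faces G R m')"
      by (rule Suc.IH) (use R Rf Suc.prems in auto)
    have 2: "a choose m \<le> card (interval_faces M F m)"
      by (rule Suc.IH) (use M Suc.prems in auto)
    have disj: "interval_faces G R m' \<inter> interval_faces M F m = {}"
      using M by (auto simp: interval_faces_def)
    have "Suc a choose m \<le> card (interval_faces G R m') + card (interval_faces M F m)"
      using 1 2 by simp
    also have "\<dots> = card (interval_faces G R m' \<union> interval_faces M F m)"
      using disj by (simp add: card_Un_disjoint finite_interval_faces)
    also have "\<dots> \<le> card (interval_faces G F m)"
      by (rule card_mono[OF finite_interval_faces]) (use M Rf in \<open>auto simp: interval_faces_def\<close>)
    finally show ?thesis .
  qed
qed

subsection \<open>Boundaries of faces\<close>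

lemma face_closure_single: "F \<in> faces X \<Longrightarrow> face_closure X {F} = {G \<in> faces X. G \<subseteq> F}"
  by (auto simp: face_closure_def)

lemma complex_dim_face_closure:
  assumes "F \<in> faces X"
  shows "complex_dim X (face_closure X {F}) = face_dim X F"
  unfolding complex_dim_def
  by (rule Max_eqI) (use assms finite_faces face_dim_mono in \<open>auto simp: face_closure_single\<close>)

text \<open>Only \<open>F\<close> itself has top dimension in its closure, so each of its ridges
  lies in exactly one top face there; by \<open>grading\<close> every proper face lies in some
  ridge.\<close>

lemma face_boundary_eq:
  assumes "F \<in> faces X"
  shows "face_boundary X F = {G \<in> faces X. G \<subset> F}"
proof -
  have top: "{F' \<in> faces_of_dim X (face_closure X {F}) (face_dim X F). G \<subseteq> F'} = {F}" if "G \<subseteq> F" for G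
  proof -
    have "F' = F" if "F' \<in> faces X" "F' \<subseteq> F" "face_dim X F' = face_dim X F" for F'
      using face_eqI[of F' F] that assms by simp
    then show ?thesis using that assms unfolding faces_of_dim_def face_closure_single[OF assms] by blast
  qed
  have "{G \<in> faces_of_dim X (face_closure X {F}) (face_dim X F - 1).
      card {F' \<in> faces_of_dim X (face_closure X {F}) (face_dim X F). G \<subseteq> F'} = 1} = ridges_of F"
    (is "?S = _")
  proof (intro Set.set_eqI iffI)
    fix G assume "G \<in> ?S"
    then show "G \<in> ridges_of F"
      by (simp add: ridges_of_def faces_of_dim_def face_closure_single assms)
  next
    fix G assume "G \<in> ridges_of F"
    then show "G \<in> ?S"
      using top[of G] by (simp add: ridges_of_def faces_of_dim_def face_closure_single assms)
  qed
  then have "face_boundary X F = face_closure X (ridges_of F)"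
    unfolding face_boundary_def boundary_complex_def complex_dim_face_closure[OF assms] by simp
  also have "\<dots> = {G \<in> faces X. G \<subset> F}"
  proof (intro Set.set_eqI iffI)
    fix G assume "G \<in> face_closure X (ridges_of F)"
    then obtain R where R: "G \<in> faces X" "R \<in> ridges_of F" "G \<subseteq> R" by (auto simp: face_closure_def)
    then have "R \<noteq> F" "R \<subseteq> F" by (auto simp: ridges_of_def)
    then show "G \<in> {G \<in> faces X. G \<subset> F}" using R by auto
  next
    fix G assume "G \<in> {G \<in> faces X. G \<subset> F}"
    then show "G \<in> face_closure X (ridges_of F)"
      using ridge_above[OF _ assms, of G] by (auto simp: face_closure_def)
  qed
  finally show ?thesis .
qed

lemma faces_of_dim_face_boundary:
  assumes "F \<in> faces X" "face_dim X F = e + 1"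
  shows "faces_of_dim X (face_boundary X F) e = ridges_of F"
  using assms by (auto simp: faces_of_dim_def face_boundary_eq ridges_of_def)

lemma ridge_two_facets:
  assumes "F \<in> faces X" "Q \<in> faces X" "Q \<subseteq> F" "face_dim X F = face_dim X Q + 2"
  shows "card {R \<in> ridges_of F. Q \<subseteq> R} = 2"
proof -
  have "{R \<in> ridges_of F. Q \<subseteq> R} = {M \<in> faces X. Q \<subseteq> M \<and> M \<subseteq> F \<and> face_dim X M = face_dim X Q + 1}"
    using assms by (auto simp: ridges_of_def)
  then show ?thesis using diamond[of Q F] assms by simp
qed

subsection \<open>Shellings\<close>

text \<open>The set \<open>A\<close> of the overview for the facet \<open>Fs ! j\<close>; it is
  empty for \<open>j = 0\<close>.\<close>

definition early :: "'a set list \<Rightarrow> nat \<Rightarrow> 'a set set" where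
  "early Fs j = {R \<in> ridges_of (Fs ! j). \<exists>i<j. R \<subseteq> Fs ! i}"

text \<open>The part of the definition of a shelling which the argument uses, uniformly in the dimension.\<close>

definition weak_shelling :: "nat \<Rightarrow> 'a set list \<Rightarrow> bool" where
  "weak_shelling d Fs \<longleftrightarrow> distinct Fs \<and> set Fs \<subseteq> faces X \<and> (\<forall>F\<in>set Fs. face_dim X F = int d) \<and>
     (\<forall>j<length Fs. \<forall>i<j. \<forall>G\<in>faces X. G \<subseteq> Fs ! j \<longrightarrow> G \<subseteq> Fs ! i \<longrightarrow> (\<exists>R\<in>early Fs j. G \<subseteq> R)) \<and>
     (\<forall>e. d = Suc e \<longrightarrow> (\<forall>j<length Fs. \<exists>Gs m. shelling e X (face_boundary X (Fs ! j)) Gs \<and>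
         m \<le> length Gs \<and> set (take m Gs) = early Fs j))"

lemma shelling_weak:
  assumes "shelling d X K Fs"
  shows "weak_shelling d Fs" "set Fs = faces_of_dim X K (int d)"
proof -
  have pure: "pure_complex X (int d) K" and dist: "distinct Fs" and set: "set Fs = faces_of_dim X K (int d)"
    using assms by (cases d; simp)+
  have sub: "set Fs \<subseteq> faces X" "\<forall>F\<in>set Fs. face_dim X F = int d"
    using pure set by (auto simp: pure_complex_def subcomplex_def faces_of_dim_def)
  have nthf: "Fs ! j \<in> faces X" "face_dim X (Fs ! j) = int d" if "j < length Fs" for j
    using sub nth_mem[OF that] by auto
  have inj: "Fs ! i \<noteq> Fs ! j" if "i < j" "j < length Fs" for i j
    using dist that by (simp add: nth_eq_iff_index_eq)
  show "set Fs = faces_of_dim X K (int d)" by (fact set)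
  \<comment> \<open>Distinct facets of equal dimension are incomparable, so a common face is proper
    in both and lies in both boundary complexes.\<close>
  have proper: "G \<subset> Fs ! j" "G \<subset> Fs ! i" if "i < j" "j < length Fs" "G \<in> faces X" "G \<subseteq> Fs ! j" "G \<subseteq> Fs ! i" for i j G
  proof -
    have ne: "Fs ! i \<noteq> Fs ! j" using inj that by auto
    have len: "i < length Fs" using that by auto
    have "G \<noteq> Fs ! j" using face_eqI[of "Fs ! j" "Fs ! i"] ne nthf[OF that(2)] nthf[OF len] that by auto
    moreover have "G \<noteq> Fs ! i" using face_eqI[of "Fs ! i" "Fs ! j"] ne nthf[OF that(2)] nthf[OF len] that by auto
    ultimately show "G \<subset> Fs ! j" "G \<subset> Fs ! i" using that by auto
  qed
  show "weak_shelling d Fs"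
  proof (cases d)
    case [simp]: 0
    have "\<exists>R\<in>early Fs j. G \<subseteq> R"
      if "i < j" "j < length Fs" "G \<in> faces X" "G \<subseteq> Fs ! j" "G \<subseteq> Fs ! i" for i j G
    proof -
      \<comment> \<open>Two distinct vertices meet only in the empty face, which is also their only
        ridge.\<close>
      have "face_dim X G < 0" using face_dim_strict[OF that(3) nthf(1)[OF that(2)] proper(1)[OF that]] nthf[OF that(2)] by simp
      then have "G = {}" using face_dim_nonneg[of G] by force
      then have "G \<in> early Fs j" using that nthf[OF that(2)] empty_face face_dim_empty by (auto simp: early_def ridges_of_def)
      then show ?thesis by auto
    qed
    then show ?thesis using dist sub by (auto simp: weak_shelling_def)
  next
    case [simp]: (Suc e)
    define L where "L = (\<lambda>j. face_boundary X (Fs ! j) \<inter> (\<Union>i<j. face_boundary X (Fs ! i)))"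
    have *: "\<And>j. j < length Fs \<Longrightarrow> \<exists>Gs. shelling e X (face_boundary X (Fs ! j)) Gs"
      "\<And>j. j < length Fs \<Longrightarrow> 0 < j \<Longrightarrow> pure_complex X (int e) (L j) \<and>
         (\<exists>Gs m. shelling e X (face_boundary X (Fs ! j)) Gs \<and> set (take m Gs) = faces_of_dim X (L j) (int e))"
      using assms by (auto simp: Let_def L_def)
    have L: "L j = {G \<in> faces X. G \<subseteq> Fs ! j \<and> (\<exists>i<j. G \<subseteq> Fs ! i)}" if "j < length Fs" for j
    proof -
      have fb: "face_boundary X (Fs ! i) = {G \<in> faces X. G \<subset> Fs ! i}" if "i \<le> j" for i
        using face_boundary_eq[of "Fs ! i"] nthf(1)[of i] \<open>j < length Fs\<close> that by simp
      have "L j = {G \<in> faces X. G \<subset> Fs ! j \<and> (\<exists>i<j. G \<subset> Fs ! i)}"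
        unfolding L_def using fb by auto
      also have "\<dots> = {G \<in> faces X. G \<subseteq> Fs ! j \<and> (\<exists>i<j. G \<subseteq> Fs ! i)}"
        using proper[OF _ that] by (meson psubset_imp_subset)
      finally show ?thesis .
    qed
    have earlyL: "early Fs j = faces_of_dim X (L j) (int e)" if "j < length Fs" for j
      using L[OF that] nthf[OF that] by (auto simp: early_def ridges_of_def faces_of_dim_def)
    have A: "\<exists>R\<in>early Fs j. G \<subseteq> R" if "i < j" "j < length Fs" "G \<in> faces X" "G \<subseteq> Fs ! j" "G \<subseteq> Fs ! i" for i j G
    proof -
      have "pure_complex X (int e) (L j)" using *(2)[of j] that by simp
      moreover have "G \<in> L j" using L[OF that(2)] that by blast
      ultimately show ?thesis unfolding pure_complex_def earlyL[OF that(2)] by blast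
    qed
    have B: "\<exists>Gs m. shelling e X (face_boundary X (Fs ! j)) Gs \<and> m \<le> length Gs \<and> set (take m Gs) = early Fs j"
      if j: "j < length Fs" for j
    proof (cases "j = 0")
      case True
      obtain Gs where "shelling e X (face_boundary X (Fs ! j)) Gs" using *(1)[OF j] by blast
      \<comment> \<open>The first facet has no early ridges, which the empty prefix of any shelling
        of its boundary matches.\<close>
      moreover have "set (take 0 Gs) = early Fs j" using True by (simp add: early_def)
      ultimately show ?thesis by blast
    next
      case False
      then obtain Gs m where Gs: "shelling e X (face_boundary X (Fs ! j)) Gs" "set (take m Gs) = early Fs j"
        using *(2)[OF j] earlyL[OF j] by (metis gr0I)
      \<comment> \<open>The definition of a shelling lets the prefix length exceed the length of the
        list.\<close>
      have "set (take (min m (length Gs)) Gs) = early Fs j" using Gs(2) by (cases "m \<le> length Gs") (simp_all add: min_def)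
      then show ?thesis using Gs(1) min.cobounded2 by blast
    qed
    show ?thesis unfolding weak_shelling_def
      using dist sub A B \<open>d = Suc e\<close> by (intro conjI allI impI) (blast | simp)+
  qed
qed

end

section \<open>Completed stars in a shelling\<close>

lemma even_card_sym_diff:
  assumes "finite A" "finite B"
  shows "even (card (sym_diff A B)) \<longleftrightarrow> (even (card A) \<longleftrightarrow> even (card B))"
proof -
  have 1: "card (sym_diff A B) = card (A - B) + card (B - A)"
    by (rule card_Un_disjoint) (use assms in auto)
  have 2: "card A = card (A - B) + card (A \<inter> B)" "card B = card (B - A) + card (A \<inter> B)"
    using assms by (metis card_Diff_subset_Int card_mono finite_Int inf_le1 le_add_diff_inverse2 Int_commute)+
  show ?thesis using 1 2 by presburger
qed

context face_lattice
begin

lemma weak_shellingD: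
  assumes "weak_shelling d Fs"
  shows "distinct Fs" "set Fs \<subseteq> faces X" "\<And>F. F \<in> set Fs \<Longrightarrow> face_dim X F = int d"
    "\<And>i j H. j < length Fs \<Longrightarrow> i < j \<Longrightarrow> H \<in> faces X \<Longrightarrow> H \<subseteq> Fs ! j \<Longrightarrow> H \<subseteq> Fs ! i \<Longrightarrow>
      \<exists>R\<in>early Fs j. H \<subseteq> R"
  using assms unfolding weak_shelling_def by simp_all

lemma weak_shelling_Suc:
  assumes "weak_shelling (Suc d) Fs" "j < length Fs"
  obtains Gs m where "shelling d X (face_boundary X (Fs ! j)) Gs" "m \<le> length Gs"
    "set (take m Gs) = early Fs j"
proof -
  have "\<forall>j<length Fs. \<exists>Gs m. shelling d X (face_boundary X (Fs ! j)) Gs \<and>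
         m \<le> length Gs \<and> set (take m Gs) = early Fs j"
    using assms(1) unfolding weak_shelling_def by simp
  then show ?thesis using assms(2) that by meson
qed

text \<open>The facet \<open>Fs ! c\<close> completes the star of \<open>G\<close>: it is attached along all its ridges through \<open>G\<close>.\<close>

definition closing :: "'a set list \<Rightarrow> 'a set \<Rightarrow> nat \<Rightarrow> bool" where
  "closing Fs G c \<longleftrightarrow> c < length Fs \<and> G \<subseteq> Fs ! c \<and> (\<forall>R\<in>ridges_of (Fs ! c). G \<subseteq> R \<longrightarrow> R \<in> early Fs c)"

text \<open>The pseudomanifold condition, stated for a bare set of \<open>d\<close>-faces so that it
  applies to the facets of a complex as well as to the ridges of a single face.\<close>

definition thin :: "nat \<Rightarrow> 'a set set \<Rightarrow> bool" where
  "thin d S \<longleftrightarrow> (\<forall>R\<in>faces X. face_dim X R = int d - 1 \<longrightarrow> card {F \<in> S. R \<subseteq> F} \<le> 2)"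

lemma thin_ridges_of:
  assumes "F \<in> faces X" "face_dim X F = int d + 1"
  shows "thin d (ridges_of F)"
  unfolding thin_def
proof (intro ballI impI)
  fix R assume R: "R \<in> faces X" "face_dim X R = int d - 1"
  show "card {F' \<in> ridges_of F. R \<subseteq> F'} \<le> 2"
  proof (cases "R \<subseteq> F")
    case True
    then show ?thesis using ridge_two_facets[of F R] assms R by simp
  next
    case False
    then have "{F' \<in> ridges_of F. R \<subseteq> F'} = {}" by (auto simp: ridges_of_def)
    then show ?thesis by (metis card.empty zero_le)
  qed
qed

lemma card_facets_nth:
  assumes "distinct Fs"
  shows "card {F \<in> set Fs. R \<subseteq> F} = card {u. u < length Fs \<and> R \<subseteq> Fs ! u}"
proof -
  have "bij_betw (\<lambda>u. Fs ! u) {u. u < length Fs \<and> R \<subseteq> Fs ! u} {F \<in> set Fs. R \<subseteq> F}"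
    using assms by (auto simp: bij_betw_def inj_on_def nth_eq_iff_index_eq in_set_conv_nth image_iff)
  then show ?thesis by (metis bij_betw_same_card)
qed

text \<open>\<open>IH\<close> is the first half of the induction hypothesis of
  \<open>closing_last_aux\<close>, applied in the boundary of \<open>F\<close>. As
  \<open>Gs ! i\<close> comes after \<open>Gs ! q\<close>, the star of \<open>G\<close> is not
  completed at \<open>q\<close>, so some ridge \<open>Q\<close> of \<open>Gs ! q\<close> through
  \<open>G\<close> is not early; the second ridge of \<open>F\<close> through \<open>Q\<close> then
  comes later.\<close>

lemma later_neighbour:
  assumes IH: "\<And>Gs G c i. weak_shelling d Gs \<Longrightarrow> thin d (set Gs) \<Longrightarrow> G \<in> faces X \<Longrightarrow> closing Gs G c \<Longrightarrow>
      i < length Gs \<Longrightarrow> G \<subseteq> Gs ! i \<Longrightarrow> i \<le> c"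
    and F: "F \<in> faces X" "face_dim X F = int d + 1"
    and Gs: "weak_shelling d Gs" "set Gs = ridges_of F"
    and G: "G \<in> faces X" "q < length Gs" "G \<subseteq> Gs ! q" "i < length Gs" "G \<subseteq> Gs ! i" "q < i"
  obtains q' Q where "q < q'" "q' < length Gs" "Q \<in> ridges_of (Gs ! q)" "G \<subseteq> Q" "Q \<subseteq> Gs ! q'"
proof -
  have "\<not> closing Gs G q"
    using IH[OF Gs(1) _ G(1) _ G(4,5)] thin_ridges_of[OF F] Gs(2) G(6) by fastforce
  then obtain Q where Q: "Q \<in> ridges_of (Gs ! q)" "G \<subseteq> Q" "Q \<notin> early Gs q"
    using G unfolding closing_def by blast
  have gq: "Gs ! q \<in> ridges_of F" using G(2) Gs(2) nth_mem by blast
  then have Qf: "Q \<in> faces X" "Q \<subseteq> F" "face_dim X F = face_dim X Q + 2"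
    using Q(1) by (auto simp: ridges_of_def)
  have "card {R \<in> ridges_of F. Q \<subseteq> R} = 2" using ridge_two_facets F Qf by blast
  then have "\<not> {R \<in> ridges_of F. Q \<subseteq> R} \<subseteq> {Gs ! q}"
    using card_mono[of "{Gs ! q}" "{R \<in> ridges_of F. Q \<subseteq> R}"] by fastforce
  then obtain R where R: "R \<in> ridges_of F" "Q \<subseteq> R" "R \<noteq> Gs ! q" by blast
  then obtain q' where q': "q' < length Gs" "R = Gs ! q'" using Gs(2) by (metis in_set_conv_nth)
  have "\<not> q' < q" using Q R q' unfolding early_def by blast
  then have "q < q'" using q' R by (metis linorder_neqE_nat)
  then show ?thesis using that Q R q' by blast
qed

text \<open>Modulo 2, the ridges of a completing facet through \<open>G\<close> form a cycle in the earlier facets,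
  which bounds a set \<open>C\<close> of these. Then every ridge through \<open>G\<close> lies in an even number of the facets in
  \<open>insert c C\<close>, so this set is closed under adjacency at \<open>G\<close>, and it is the whole star of \<open>G\<close>.\<close>

lemma closing_last_aux:
  assumes "weak_shelling d Fs" "thin d (set Fs)" "G \<in> faces X" "closing Fs G c"
    "i < length Fs" "G \<subseteq> Fs ! i"
  shows "i \<le> c \<and> (\<forall>R\<in>ridges_of (Fs ! i). G \<subseteq> R \<longrightarrow> card {F \<in> set Fs. R \<subseteq> F} = 2)"
  using assms
proof (induction d arbitrary: Fs G c i)
  case 0
  have dist: "distinct Fs" and sub: "set Fs \<subseteq> faces X" and dim: "\<And>j. j < length Fs \<Longrightarrow> face_dim X (Fs ! j) = 0"
    using weak_shellingD[OF "0.prems"(1)] nth_mem by simp_all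
  have nthf: "Fs ! j \<in> faces X" if "j < length Fs" for j using sub nth_mem that by blast
  have c: "c < length Fs" "G \<subseteq> Fs ! c" using "0.prems"(4) by (auto simp: closing_def)
  show ?case
  proof (cases "G = {}")
    case True
    have "{} \<in> ridges_of (Fs ! c)" using dim[OF c(1)] by (simp add: ridges_of_def empty_face face_dim_empty)
    then have "{} \<in> early Fs c" using "0.prems"(4) True unfolding closing_def by blast
    then have "0 < c" unfolding early_def by auto
    \<comment> \<open>The empty face is a ridge of every vertex, so \<open>thin\<close> allows at
      most two vertices, and \<open>c\<close> must be the second one.\<close>
    have "card {F \<in> set Fs. {} \<subseteq> F} \<le> 2"
      using "0.prems"(2)[unfolded thin_def, rule_format, OF empty_face] face_dim_empty by simp
    then have "length Fs \<le> 2" using distinct_card[OF dist] by simp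
    then have len: "length Fs = 2" "c = 1" using \<open>0 < c\<close> c by linarith+
    have e: "R = {}" if "R \<in> ridges_of (Fs ! i)" for R
      using that dim[OF "0.prems"(5)] face_dim_nonneg[of R] by (force simp: ridges_of_def)
    have "card {F \<in> set Fs. R \<subseteq> F} = 2" if "R \<in> ridges_of (Fs ! i)" for R
      using e[OF that] len distinct_card[OF dist] by simp
    then show ?thesis using len "0.prems"(5) by simp
  next
    case False
    have eq: "G = Fs ! j" if "j < length Fs" "G \<subseteq> Fs ! j" for j
      using face_eqI[OF "0.prems"(3) nthf[OF that(1)] that(2)] dim[OF that(1)] face_dim_nonneg[OF False] by simp
    then have "i = c" using c "0.prems" dist nth_eq_iff_index_eq by metis
    moreover have "\<not> G \<subseteq> R" if "R \<in> ridges_of (Fs ! i)" for R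
      using that eq[OF "0.prems"(5,6)] by (auto simp: ridges_of_def)
    ultimately show ?thesis by auto
  qed
next
  case (Suc d)
  define n where "n = length Fs"
  note ws = weak_shellingD[OF Suc.prems(1), folded n_def]
  have nthf: "Fs ! j \<in> faces X" "face_dim X (Fs ! j) = int d + 1" if "j < n" for j
    using ws(2) ws(3)[of "Fs ! j"] nth_mem[of j Fs] that by (auto simp: n_def)
  have c: "c < n" "G \<subseteq> Fs ! c" "\<forall>R\<in>ridges_of (Fs ! c). G \<subseteq> R \<longrightarrow> R \<in> early Fs c"
    using Suc.prems(4) by (auto simp: closing_def n_def)
  define RR where "RR = {R \<in> faces X. face_dim X R = int d \<and> G \<subseteq> R}"
  \<comment> \<open>Sets of ridges through \<open>G\<close> are chains modulo 2 in the link of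
    \<open>G\<close>. \<open>cyc\<close> says that the boundary of such a chain vanishes, and
    \<open>E j\<close> is the boundary of the \<open>j\<close>-th facet.\<close>
  define cyc where "cyc = (\<lambda>Z. \<forall>Q\<in>faces X. face_dim X Q = int d - 1 \<longrightarrow> G \<subseteq> Q \<longrightarrow> even (card {R \<in> Z. Q \<subseteq> R}))"
  define E where "E = (\<lambda>j. {R \<in> ridges_of (Fs ! j). G \<subseteq> R})"
  have finRR: "finite RR" using finite_faces by (simp add: RR_def)
  have E_RR: "E j \<subseteq> RR" if "j < n" for j using nthf[OF that] by (auto simp: E_def RR_def ridges_of_def)
  have E_iff: "R \<in> E j \<longleftrightarrow> R \<subseteq> Fs ! j" if "R \<in> RR" "j < n" for R j
    using that nthf[OF that(2)] by (auto simp: E_def RR_def ridges_of_def)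
  have card2: "card {R \<in> ridges_of (Fs ! j). Q \<subseteq> R} = 2"
    if "j < n" "Q \<in> faces X" "face_dim X Q = int d - 1" "Q \<subseteq> Fs ! j" for Q j
    using ridge_two_facets[of "Fs ! j" Q] nthf[OF that(1)] that by simp
  have cycE: "cyc (E j)" if "j < n" for j
    unfolding cyc_def
  proof (intro ballI impI)
    fix Q assume Q: "Q \<in> faces X" "face_dim X Q = int d - 1" "G \<subseteq> Q"
    show "even (card {R \<in> E j. Q \<subseteq> R})"
    proof (cases "Q \<subseteq> Fs ! j")
      case True
      have "{R \<in> E j. Q \<subseteq> R} = {R \<in> ridges_of (Fs ! j). Q \<subseteq> R}" using Q by (auto simp: E_def)
      then show ?thesis using card2[OF that Q(1,2) True] by simp
    next
      case False
      then have "{R \<in> E j. Q \<subseteq> R} = {}" by (auto simp: E_def ridges_of_def)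
      then show ?thesis by (metis card.empty even_zero)
    qed
  qed
  text \<open>The ridges through \<open>G\<close> that are new in the \<open>j\<close>-th facet are connected through new faces of
    codimension 2, so a cycle contains either all of them or none.\<close>
  have all_new: "R \<in> Z"
    if j: "j < n" and Z: "Z \<subseteq> RR" "\<forall>R\<in>Z. \<exists>t\<le>j. R \<subseteq> Fs ! t" "cyc Z"
      and R0: "R0 \<in> Z" "\<not> (\<exists>t<j. R0 \<subseteq> Fs ! t)" and R: "R \<in> E j" "\<not> (\<exists>t<j. R \<subseteq> Fs ! t)" for j Z R0 R
  proof -
    obtain Gs m where Gs: "shelling d X (face_boundary X (Fs ! j)) Gs" "m \<le> length Gs" "set (take m Gs) = early Fs j"
      using weak_shelling_Suc[OF Suc.prems(1)] j n_def by metis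
    have wGs: "weak_shelling d Gs" using shelling_weak Gs(1) by blast
    have sGs: "set Gs = ridges_of (Fs ! j)"
      using shelling_weak(2)[OF Gs(1)] faces_of_dim_face_boundary nthf[OF j] by simp
    have dGs: "distinct Gs" using wGs by (simp add: weak_shelling_def)
    have early_iff: "Gs ! q \<in> early Fs j \<longleftrightarrow> q < m" if "q < length Gs" for q
    proof -
      have "Gs ! q \<in> set (take m Gs) \<longleftrightarrow> q < m"
        using dGs Gs(2) that by (auto simp: in_set_conv_nth nth_eq_iff_index_eq)
      then show ?thesis using Gs(3) by simp
    qed
    define P where "P = {q. m \<le> q \<and> q < length Gs \<and> G \<subseteq> Gs ! q}"
    have finP: "finite P" by (simp add: P_def)
    \<comment> \<open>Before the last position of \<open>P\<close>, \<open>later_neighbour\<close>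
      gives a later one sharing a codimension 2 face \<open>Q\<close>. This \<open>Q\<close> is new
      in \<open>Fs ! j\<close>, so these are the only two ridges that \<open>Z\<close> can have
      through \<open>Q\<close>, and evenness at \<open>Q\<close> ties them together.\<close>
    have step: "\<exists>q'\<in>P. q < q' \<and> (Gs ! q \<in> Z \<longleftrightarrow> Gs ! q' \<in> Z)" if q: "q \<in> P" "i \<in> P" "q < i" for q i
    proof -
      obtain q' Q where Q: "q < q'" "q' < length Gs" "Q \<in> ridges_of (Gs ! q)" "G \<subseteq> Q" "Q \<subseteq> Gs ! q'"
        using later_neighbour[OF _ nthf(1)[OF j] nthf(2)[OF j] wGs sGs Suc.prems(3), of q i] Suc.IH q
        unfolding P_def by blast
      have gq: "Gs ! q \<in> ridges_of (Fs ! j)" "Gs ! q' \<in> ridges_of (Fs ! j)" "Gs ! q \<noteq> Gs ! q'"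
        using q Q sGs nth_mem dGs by (auto simp: P_def nth_eq_iff_index_eq)
      have Qf: "Q \<in> faces X" "face_dim X Q = int d - 1" "Q \<subseteq> Gs ! q"
        using Q(3) gq nthf[OF j] by (auto simp: ridges_of_def)
      have Qj: "Q \<subseteq> Fs ! j" using Qf gq by (auto simp: ridges_of_def)
      have "{Gs ! q, Gs ! q'} \<subseteq> {R \<in> ridges_of (Fs ! j). Q \<subseteq> R}" using gq Q Qf by auto
      moreover have "finite {R \<in> ridges_of (Fs ! j). Q \<subseteq> R}" using finite_ridges_of by simp
      moreover have "card {Gs ! q, Gs ! q'} = 2" using gq by simp
      ultimately have two: "{R \<in> ridges_of (Fs ! j). Q \<subseteq> R} = {Gs ! q, Gs ! q'}"
        using card2[OF j Qf(1,2) Qj] by (metis card_subset_eq)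
      \<comment> \<open>An earlier facet containing \<open>Q\<close> would put \<open>Q\<close> into
        an early ridge, but both ridges of \<open>Fs ! j\<close> through \<open>Q\<close> come after
        the prefix of length \<open>m\<close>.\<close>
      have new: "\<not> Q \<subseteq> Fs ! t" if "t < j" for t
      proof
        assume "Q \<subseteq> Fs ! t"
        then obtain R' where R': "R' \<in> early Fs j" "Q \<subseteq> R'" using ws(4)[OF j \<open>t < j\<close> Qf(1) Qj] by blast
        then have "R' \<in> {Gs ! q, Gs ! q'}" using two by (auto simp: early_def)
        then show False using R' early_iff[of q] early_iff[of q'] q Q by (auto simp: P_def)
      qed
      have "{R \<in> Z. Q \<subseteq> R} \<subseteq> {Gs ! q, Gs ! q'}"
      proof
        fix R assume RZ: "R \<in> {R \<in> Z. Q \<subseteq> R}"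
        then obtain t where "t \<le> j" "R \<subseteq> Fs ! t" using Z(2) by blast
        then have "R \<subseteq> Fs ! j" using new[of t] RZ by (metis (no_types, lifting) le_neq_implies_less mem_Collect_eq order_trans)
        then have "R \<in> E j" using E_iff j RZ Z(1) by blast
        then show "R \<in> {Gs ! q, Gs ! q'}" using two RZ by (auto simp: E_def)
      qed
      then have *: "{R \<in> Z. Q \<subseteq> R} = Z \<inter> {Gs ! q, Gs ! q'}" using Q(5) Qf(3) by auto
      have "even (card (Z \<inter> {Gs ! q, Gs ! q'}))"
        using Z(3) Qf Q(4) unfolding cyc_def *[symmetric] by blast
      then have "Gs ! q \<in> Z \<longleftrightarrow> Gs ! q' \<in> Z"
        using gq(3) by (auto simp: Int_insert_right split: if_splits)
      moreover have "q' \<in> P" using q Q by (auto simp: P_def)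
      ultimately show ?thesis using Q(1) by blast
    qed
    \<comment> \<open>Moving to ever later positions ends at \<open>Max P\<close>, which therefore
      decides for all of \<open>P\<close>.\<close>
    have agree: "Gs ! q \<in> Z \<longleftrightarrow> Gs ! Max P \<in> Z" if "q \<in> P" for q
      using that
    proof (induction "length Gs - q" arbitrary: q rule: less_induct)
      case less
      show ?case
      proof (cases "q = Max P")
        case False
        then have "q < Max P" "Max P \<in> P" using less.prems finP by (metis Max_ge le_neq_implies_less, metis Max_in empty_iff)
        then obtain q' where "q' \<in> P" "q < q'" "Gs ! q \<in> Z \<longleftrightarrow> Gs ! q' \<in> Z" using step less.prems by blast
        moreover have "length Gs - q' < length Gs - q" using \<open>q' \<in> P\<close> \<open>q < q'\<close> by (auto simp: P_def)
        ultimately show ?thesis using less.hyps by blast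
      qed simp
    qed
    have inP: "\<exists>q\<in>P. S = Gs ! q" if "S \<in> E j" "\<not> (\<exists>t<j. S \<subseteq> Fs ! t)" for S
    proof -
      obtain q where q: "q < length Gs" "S = Gs ! q"
        using \<open>S \<in> E j\<close> sGs unfolding E_def by (metis (no_types, lifting) in_set_conv_nth mem_Collect_eq)
      then have "\<not> q < m" using early_iff[of q] that by (auto simp: early_def)
      then have "q \<in> P" using q that(1) by (simp add: P_def E_def)
      then show ?thesis using q by blast
    qed
    have "R0 \<in> E j" using E_iff[of R0 j] Z R0 j by (metis le_neq_implies_less subsetD)
    then show "R \<in> Z" using inP[of R0] inP[of R] R0 R agree by metis
  qed
  \<comment> \<open>Acyclicity of the partial complexes at \<open>G\<close>: a cycle of ridges lying
    in the first \<open>j\<close> facets bounds a set \<open>C\<close> of these modulo 2, found by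
    peeling off the last facet.\<close>
  have bound: "\<exists>C\<subseteq>{..<j}. \<forall>R\<in>RR. R \<in> Z \<longleftrightarrow> odd (card {t \<in> C. R \<subseteq> Fs ! t})"
    if "j \<le> n" "Z \<subseteq> RR" "\<forall>R\<in>Z. \<exists>t<j. R \<subseteq> Fs ! t" "cyc Z" for j Z
    using that
  proof (induction j arbitrary: Z)
    case 0
    then have "Z = {}" by auto
    then show ?case by (intro exI[of _ "{}"]) auto
  next
    case (Suc j)
    show ?case
    proof (cases "\<forall>R\<in>Z. \<exists>t<j. R \<subseteq> Fs ! t")
      case True
      then obtain C where "C\<subseteq>{..<j}" "\<forall>R\<in>RR. R \<in> Z \<longleftrightarrow> odd (card {t \<in> C. R \<subseteq> Fs ! t})"
        using Suc.IH[of Z] Suc.prems by auto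
      then show ?thesis by (intro exI[of _ C]) auto
    next
      case False
      then obtain R0 where R0: "R0 \<in> Z" "\<not> (\<exists>t<j. R0 \<subseteq> Fs ! t)" by blast
      have j: "j < n" using Suc.prems by simp
      have le: "\<forall>R\<in>Z. \<exists>t\<le>j. R \<subseteq> Fs ! t" using Suc.prems(3) less_Suc_eq_le by blast
      have new: "R \<in> Z" if "R \<in> E j" "\<not> (\<exists>t<j. R \<subseteq> Fs ! t)" for R
        using all_new[OF j Suc.prems(2) le Suc.prems(4) R0 that] .
      \<comment> \<open>By \<open>all_new\<close> the cycle contains every ridge of
        \<open>E j\<close> that is new in the \<open>j\<close>-th facet. Adding \<open>E j\<close>
        cancels all of these and leaves a cycle supported on the first \<open>j\<close>
        facets.\<close>
      define Z' where "Z' = sym_diff Z (E j)"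
      have finZ: "finite Z" "finite (E j)" using Suc.prems(2) finRR E_RR[OF j] finite_subset by blast+
      have Z'RR: "Z' \<subseteq> RR" using Suc.prems(2) E_RR[OF j] by (auto simp: Z'_def)
      have "\<exists>t<j. R \<subseteq> Fs ! t" if "R \<in> Z'" for R
      proof (cases "R \<in> Z")
        case True
        then have "R \<notin> E j" using that by (auto simp: Z'_def)
        then have "\<not> R \<subseteq> Fs ! j" using E_iff[OF _ j] True Suc.prems(2) by blast
        then show ?thesis using True le by (metis le_neq_implies_less)
      next
        case False
        then show ?thesis using new[of R] that by (auto simp: Z'_def)
      qed
      moreover have "cyc Z'"
        unfolding cyc_def
      proof (intro ballI impI)
        fix Q assume Q: "Q \<in> faces X" "face_dim X Q = int d - 1" "G \<subseteq> Q"
        have "{R \<in> Z'. Q \<subseteq> R} = sym_diff {R \<in> Z. Q \<subseteq> R} {R \<in> E j. Q \<subseteq> R}" by (auto simp: Z'_def)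
        then show "even (card {R \<in> Z'. Q \<subseteq> R})"
          using even_card_sym_diff[of "{R \<in> Z. Q \<subseteq> R}" "{R \<in> E j. Q \<subseteq> R}"] finZ
            Suc.prems(4) cycE[OF j] Q unfolding cyc_def by simp
      qed
      ultimately obtain C where C: "C\<subseteq>{..<j}" "\<forall>R\<in>RR. R \<in> Z' \<longleftrightarrow> odd (card {t \<in> C. R \<subseteq> Fs ! t})"
        using Suc.IH[of Z'] Z'RR j by auto
      have "R \<in> Z \<longleftrightarrow> odd (card {t \<in> insert j C. R \<subseteq> Fs ! t})" if R: "R \<in> RR" for R
      proof (cases "R \<subseteq> Fs ! j")
        case True
        then have eq: "{t \<in> insert j C. R \<subseteq> Fs ! t} = insert j {t \<in> C. R \<subseteq> Fs ! t}" by auto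
        have "finite {t \<in> C. R \<subseteq> Fs ! t}" "j \<notin> {t \<in> C. R \<subseteq> Fs ! t}"
          using C(1) finite_subset[OF C(1)] by auto
        then have "odd (card {t \<in> insert j C. R \<subseteq> Fs ! t}) \<longleftrightarrow> \<not> odd (card {t \<in> C. R \<subseteq> Fs ! t})"
          unfolding eq by simp
        moreover have "R \<in> Z \<longleftrightarrow> R \<notin> Z'" using True E_iff[OF R j] by (auto simp: Z'_def)
        ultimately show ?thesis using C(2) R by blast
      next
        case False
        then have eq: "{t \<in> insert j C. R \<subseteq> Fs ! t} = {t \<in> C. R \<subseteq> Fs ! t}" by auto
        have "R \<in> Z \<longleftrightarrow> R \<in> Z'" using False E_iff[OF R j] by (auto simp: Z'_def)
        then show ?thesis using C(2) R eq by simp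
      qed
      then show ?thesis using C(1) by (intro exI[of _ "insert j C"]) auto
    qed
  qed
  \<comment> \<open>Completion of the star puts the boundary of facet \<open>c\<close> at
    \<open>G\<close> into the earlier facets, so it also bounds a set \<open>C0\<close> of
    these.\<close>
  have "\<forall>R\<in>E c. \<exists>t<c. R \<subseteq> Fs ! t" using c(3) by (auto simp: E_def early_def)
  then obtain C0 where C0: "C0\<subseteq>{..<c}" "\<forall>R\<in>RR. R \<in> E c \<longleftrightarrow> odd (card {t \<in> C0. R \<subseteq> Fs ! t})"
    using bound[of c "E c"] E_RR[OF c(1)] cycE[OF c(1)] c(1) by auto
  define C where "C = insert c C0"
  have CC: "c \<in> C" "C \<subseteq> {..c}" using C0 by (auto simp: C_def)
  then have finC: "finite C" using finite_subset by blast
  have evenC: "even (card {t \<in> C. R \<subseteq> Fs ! t})" if R: "R \<in> RR" for R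
  proof (cases "R \<subseteq> Fs ! c")
    case True
    then have eq: "{t \<in> C. R \<subseteq> Fs ! t} = insert c {t \<in> C0. R \<subseteq> Fs ! t}" by (auto simp: C_def)
    have "finite {t \<in> C0. R \<subseteq> Fs ! t}" "c \<notin> {t \<in> C0. R \<subseteq> Fs ! t}"
      using C0(1) finite_subset[OF C0(1)] by auto
    then show ?thesis using C0(2) R E_iff[OF R c(1)] True unfolding eq by simp
  next
    case False
    then have eq: "{t \<in> C. R \<subseteq> Fs ! t} = {t \<in> C0. R \<subseteq> Fs ! t}" by (auto simp: C_def)
    then show ?thesis using C0(2) R E_iff[OF R c(1)] False by simp
  qed
  have cardU: "card {F \<in> set Fs. R \<subseteq> F} = card {u. u < n \<and> R \<subseteq> Fs ! u}" for R
    using card_facets_nth[OF ws(1)] n_def by simp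
  \<comment> \<open>A positive even number that is at most 2 by \<open>thin\<close> equals 2, so
    \<open>C\<close> contains every facet through such a ridge.\<close>
  have sat: "{u \<in> C. R \<subseteq> Fs ! u} = {u. u < n \<and> R \<subseteq> Fs ! u} \<and> card {u. u < n \<and> R \<subseteq> Fs ! u} = 2"
    if R: "R \<in> RR" and t: "t \<in> C" "R \<subseteq> Fs ! t" for R t
  proof -
    have sub: "{u \<in> C. R \<subseteq> Fs ! u} \<subseteq> {u. u < n \<and> R \<subseteq> Fs ! u}" using CC c(1) by auto
    have "card {u \<in> C. R \<subseteq> Fs ! u} \<noteq> 0" using finC t by auto
    moreover have "even (card {u \<in> C. R \<subseteq> Fs ! u})" by (rule evenC[OF R])
    ultimately have 2: "card {u \<in> C. R \<subseteq> Fs ! u} \<ge> 2" by presburger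
    have "card {F \<in> set Fs. R \<subseteq> F} \<le> 2" using Suc.prems(2) R by (auto simp: thin_def RR_def)
    then have le: "card {u. u < n \<and> R \<subseteq> Fs ! u} \<le> 2" using cardU by simp
    have "{u \<in> C. R \<subseteq> Fs ! u} = {u. u < n \<and> R \<subseteq> Fs ! u}"
      by (rule card_seteq[OF _ sub]) (use le 2 in auto)
    then show ?thesis using le 2 by auto
  qed
  define f where "f = (LEAST t. G \<subseteq> Fs ! t)"
  have fG: "G \<subseteq> Fs ! f" "f \<le> c" unfolding f_def using c(2)
    by (fact LeastI[of "\<lambda>t. G \<subseteq> Fs ! t"], fact Least_le[of "\<lambda>t. G \<subseteq> Fs ! t"])
  \<comment> \<open>Every facet through \<open>G\<close> other than the first shares a ridge through
    \<open>G\<close> with an earlier one, and by \<open>sat\<close> membership in \<open>C\<close>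
    passes across that ridge both ways. Hence \<open>C\<close> contains all facets through
    \<open>G\<close> or none, and it contains \<open>c\<close>.\<close>
  have allC: "t \<in> C \<longleftrightarrow> f \<in> C" if "t < n" "G \<subseteq> Fs ! t" for t
    using that
  proof (induction t rule: less_induct)
    case (less t)
    have "f \<le> t" unfolding f_def using less.prems by (simp add: Least_le)
    show ?case
    proof (cases "t = f")
      case False
      then have "f < t" using \<open>f \<le> t\<close> by simp
      then obtain R where R: "R \<in> early Fs t" "G \<subseteq> R"
        using ws(4)[OF less.prems(1) _ Suc.prems(3) less.prems(2) fG(1)] by blast
      then obtain s where s: "s < t" "R \<subseteq> Fs ! s" by (auto simp: early_def)
      have Rt: "R \<subseteq> Fs ! t" "R \<in> RR" using R E_RR[OF less.prems(1)] by (auto simp: E_def early_def ridges_of_def)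
      have U: "t \<in> {u. u < n \<and> R \<subseteq> Fs ! u}" "s \<in> {u. u < n \<and> R \<subseteq> Fs ! u}"
        using Rt(1) s less.prems(1) by simp_all
      have "s \<in> {u \<in> C. R \<subseteq> Fs ! u}" if "t \<in> C"
        using sat[OF Rt(2) that Rt(1)] U by simp
      moreover have "t \<in> {u \<in> C. R \<subseteq> Fs ! u}" if "s \<in> C"
        using sat[OF Rt(2) that s(2)] U by simp
      ultimately have "t \<in> C \<longleftrightarrow> s \<in> C" by blast
      moreover have "s \<in> C \<longleftrightarrow> f \<in> C" using less.IH[OF s(1)] s R(2) less.prems(1) by auto
      ultimately show ?thesis by simp
    qed simp
  qed
  have iC: "i \<in> C" using allC[of i] allC[of c] c CC Suc.prems(5,6) n_def by auto
  then have "i \<le> c" using CC by auto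
  moreover have "card {F \<in> set Fs. R \<subseteq> F} = 2" if "R \<in> ridges_of (Fs ! i)" "G \<subseteq> R" for R
  proof -
    have "R \<in> RR" using E_RR[of i] that Suc.prems(5) n_def by (auto simp: E_def)
    moreover have "R \<subseteq> Fs ! i" using that by (auto simp: ridges_of_def)
    ultimately show ?thesis using sat[OF _ iC] cardU by simp
  qed
  ultimately show ?case by blast
qed

lemmas closing_last = closing_last_aux[THEN conjunct1]

text \<open>A face whose star is completed is interior: none of the ridges that generate the
  boundary complex can pass through it.\<close>

lemma closing_saturated:
  assumes "weak_shelling d Fs" "thin d (set Fs)" "G \<in> faces X" "closing Fs G c"
    "i < length Fs" "G \<subseteq> Fs ! i" "R \<in> ridges_of (Fs ! i)" "G \<subseteq> R"
  shows "card {F \<in> set Fs. R \<subseteq> F} = 2"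
  using closing_last_aux[OF assms(1-6)] assms(7,8) by blast

end

section \<open>Counting the faces attached at each step\<close>

lemma nth_in_take_iff:
  assumes "distinct xs" "i < length xs"
  shows "xs ! i \<in> set (take p xs) \<longleftrightarrow> i < p"
proof
  assume "xs ! i \<in> set (take p xs)"
  then obtain k where "k < length xs" "k < p" "xs ! i = xs ! k" by (auto simp: in_set_conv_nth)
  then show "i < p" using assms by (simp add: nth_eq_iff_index_eq)
next
  assume "i < p"
  then have "i < length (take p xs)" "take p xs ! i = xs ! i" using assms by auto
  then show "xs ! i \<in> set (take p xs)" by (metis nth_mem)
qed

context face_lattice
begin

lemma not_subset_ridge: "R \<in> ridges_of F \<Longrightarrow> \<not> F \<subseteq> R"
  by (auto simp: ridges_of_def)

text \<open>For a simplex \<open>F\<close>, the two faces are those spanned by the vertices opposite to the late and to the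
  early ridges.\<close>

lemma complementary_faces:
  assumes "shelling d X (face_boundary X F) Gs" "F \<in> faces X" "face_dim X F = int d + 1" "p \<le> length Gs"
  shows "\<exists>G\<in>faces X. \<exists>H\<in>faces X. G \<subseteq> F \<and> H \<subseteq> F \<and> face_dim X G + face_dim X H \<le> int d \<and>
    (\<forall>R\<in>set Gs. G \<subseteq> R \<longrightarrow> R \<in> set (take p Gs)) \<and> (\<forall>R\<in>set Gs. H \<subseteq> R \<longrightarrow> R \<notin> set (take p Gs))"
  using assms
proof (induction d arbitrary: F Gs p)
  case 0
  note ws = weak_shellingD[OF shelling_weak(1)[OF "0.prems"(1)]]
  have sGs: "set Gs = ridges_of F"
    using shelling_weak(2)[OF "0.prems"(1)] faces_of_dim_face_boundary[OF "0.prems"(2,3)] by simp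
  consider "p = 0" | "p = length Gs" | "0 < p" "p < length Gs" using "0.prems"(4) by linarith
  then show ?case
  proof cases
    case 1
    \<comment> \<open>With no early ridge the pair is \<open>F\<close> and the empty face: no ridge
      contains \<open>F\<close>, and all ridges are late. The dimensions add up to
      \<open>d + 1 - 1\<close>. When all ridges are early the roles are exchanged.\<close>
    show ?thesis
      by (rule bexI[of _ F], rule bexI[of _ "{}"])
         (use 1 "0.prems" sGs not_subset_ridge face_dim_empty empty_face in auto)
  next
    case 2
    show ?thesis
      by (rule bexI[of _ "{}"], rule bexI[of _ F])
         (use 2 "0.prems" sGs not_subset_ridge face_dim_empty empty_face in auto)
  next
    case 3
    have g: "Gs ! 0 \<in> set Gs" "Gs ! p \<in> set Gs" using 3 by (auto intro!: nth_mem)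
    have eq: "R = S" if "R \<in> set Gs" "S \<in> set Gs" "S \<subseteq> R" for R S
      using face_eqI[of S R] ws(2) ws(3)[OF that(1)] ws(3)[OF that(2)] that by auto
    have 0: "Gs ! 0 \<in> set (take p Gs)" 
    proof -
      have "0 < length Gs" using 3 by linarith
      then show ?thesis using 3 nth_in_take_iff[OF ws(1)] by blast
    qed
    have p: "Gs ! p \<notin> set (take p Gs)" using 3 nth_in_take_iff[OF ws(1)] by simp
    show ?thesis
    proof (rule bexI[of _ "Gs ! 0"], rule bexI[of _ "Gs ! p"], intro conjI ballI impI)
      show "Gs ! 0 \<subseteq> F" "Gs ! p \<subseteq> F" using g sGs by (auto simp: ridges_of_def)
      show "face_dim X (Gs ! 0) + face_dim X (Gs ! p) \<le> int 0" using ws(3)[OF g(1)] ws(3)[OF g(2)] by simp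
    qed (use eq g 0 p ws(2) in blast)+
  qed
next
  case (Suc d)
  note w = shelling_weak(1)[OF Suc.prems(1)]
  note ws = weak_shellingD[OF w]
  have sGs: "set Gs = ridges_of F"
    using shelling_weak(2)[OF Suc.prems(1)] faces_of_dim_face_boundary[OF Suc.prems(2,3)] by simp
  consider "p = 0" | "p = length Gs" | "0 < p" "p < length Gs" using Suc.prems(4) by linarith
  then show ?case
  proof cases
    case 1
    show ?thesis
      by (rule bexI[of _ F], rule bexI[of _ "{}"])
         (use 1 Suc.prems sGs not_subset_ridge face_dim_empty empty_face in auto)
  next
    case 2
    show ?thesis
      by (rule bexI[of _ "{}"], rule bexI[of _ F])
         (use 2 Suc.prems sGs not_subset_ridge face_dim_empty empty_face in auto)
  next
    case 3
    \<comment> \<open>\<open>E\<close> is the first late ridge. The pair for \<open>F\<close> is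
      built from the pair for \<open>E\<close>, whose ridges are split by being early in
      \<open>Gs\<close> or not; \<open>H\<close> is kept and \<open>G\<close> grows by one
      dimension.\<close>
    define E where "E = Gs ! p"
    have EGs: "E \<in> set Gs" using 3 by (simp add: E_def)
    have E: "E \<in> faces X" "face_dim X E = int d + 1" "E \<subset> F"
      using EGs ws(2) ws(3)[OF EGs] sGs by (auto simp: ridges_of_def)
    have Ep: "E \<notin> set (take p Gs)"
      using 3 nth_in_take_iff[OF ws(1)] by (simp add: E_def)
    obtain Es m where Es: "shelling d X (face_boundary X E) Es" "m \<le> length Es" "set (take m Es) = early Gs p"
      using weak_shelling_Suc[OF w 3(2)] unfolding E_def by metis
    have sEs: "set Es = ridges_of E"
      using shelling_weak(2)[OF Es(1)] faces_of_dim_face_boundary[OF E(1,2)] by simp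
    obtain G H where GH: "G \<in> faces X" "H \<in> faces X" "G \<subseteq> E" "H \<subseteq> E" "face_dim X G + face_dim X H \<le> int d"
      and GH': "\<forall>R\<in>set Es. G \<subseteq> R \<longrightarrow> R \<in> set (take m Es)" "\<forall>R\<in>set Es. H \<subseteq> R \<longrightarrow> R \<notin> set (take m Es)"
      using Suc.IH[OF Es(1) E(1,2) Es(2)] by (elim bexE conjE) (rule that)
    have Gearly: "R \<in> early Gs p" if "R \<in> ridges_of E" "G \<subseteq> R" for R
      using GH'(1) that unfolding Es(3) sEs by simp
    have Hlate: "R \<notin> early Gs p" if "R \<in> ridges_of E" "H \<subseteq> R" for R
      using GH'(2) that unfolding Es(3) sEs by simp
    \<comment> \<open>If an earlier ridge contained \<open>H\<close>, the shelling of the boundary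
      would place \<open>H\<close> in an early ridge of \<open>E\<close>, contrary to the choice of
      \<open>H\<close>.\<close>
    have H: "R \<notin> set (take p Gs)" if "R \<in> set Gs" "H \<subseteq> R" for R
    proof
      assume "R \<in> set (take p Gs)"
      then obtain i where i: "i < p" "R = Gs ! i" by (auto simp: in_set_conv_nth)
      then obtain Q where "Q \<in> early Gs p" "H \<subseteq> Q"
        using ws(4)[OF 3(2) i(1) GH(2)] GH(4) \<open>H \<subseteq> R\<close> unfolding E_def by blast
      then show False using Hlate[of Q] by (auto simp: early_def E_def)
    qed
    \<comment> \<open>\<open>E\<close> completes the star of \<open>G\<close>, so it is the last
      ridge of \<open>F\<close> through \<open>G\<close>. A cover of \<open>G\<close> that does not
      lie in \<open>E\<close> is then contained only in ridges of the prefix.\<close>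
    have "thin (Suc d) (set Gs)" using thin_ridges_of[OF Suc.prems(2,3)] sGs by simp
    moreover have "closing Gs G p" using 3 GH(3) Gearly by (auto simp: closing_def E_def)
    ultimately have last: "i \<le> p" if "i < length Gs" "G \<subseteq> Gs ! i" for i
      using closing_last[OF w _ GH(1)] that by blast
    show ?thesis
    proof (cases "G = E")
      case True
      \<comment> \<open>If \<open>G\<close> is \<open>E\<close> itself, \<open>F\<close> is its
        cover, and no ridge contains \<open>F\<close>.\<close>
      then have "face_dim X F + face_dim X H \<le> int (Suc d)" using GH(5) E Suc.prems(3) by simp
      moreover have "\<not> F \<subseteq> R" if "R \<in> set Gs" for R using that sGs not_subset_ridge by simp
      moreover have "H \<subseteq> F" using GH(4) E(3) by blast
      ultimately show ?thesis using Suc.prems(2) GH(2) H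
        by (intro bexI[of _ F] bexI[of _ H]) blast+
    next
      case False
      obtain M where M: "M \<in> faces X" "G \<subseteq> M" "M \<subseteq> F" "\<not> M \<subseteq> E" "face_dim X M = face_dim X G + 1"
        using cover_outside[OF GH(1) E(1) Suc.prems(2) GH(3) E(3)] .
      have "R \<in> set (take p Gs)" if R: "R \<in> set Gs" "M \<subseteq> R" for R
      proof -
        obtain i where i: "i < length Gs" "R = Gs ! i" using R(1) by (metis in_set_conv_nth)
        have "i \<le> p" using last[OF i(1)] i(2) M(2) R(2) by blast
        moreover have "i \<noteq> p" using i(2) R(2) M(4) by (auto simp: E_def)
        ultimately have "i < p" by simp
        then show ?thesis using i nth_in_take_iff[OF ws(1)] by simp
      qed
      moreover have "face_dim X M + face_dim X H \<le> int (Suc d)" using M(5) GH(5) by simp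
      moreover have "H \<subseteq> F" using GH(4) E(3) by blast
      ultimately show ?thesis using M(1,3) GH(2) H
        by (intro bexI[of _ M] bexI[of _ H]) blast+
    qed
  qed
qed

text \<open>Serves both counts: \<open>A\<close> is \<open>early Fs j\<close> for the new faces, and
  its complement among the ridges for the completed ones.\<close>

definition faces_off :: "'a set \<Rightarrow> 'a set set \<Rightarrow> int \<Rightarrow> 'a set set" where
  "faces_off F A k = {G \<in> faces X. G \<subseteq> F \<and> face_dim X G = k \<and> (\<forall>R\<in>ridges_of F. G \<subseteq> R \<longrightarrow> R \<notin> A)}"

lemma finite_faces_off: "finite (faces_off F A k)"
  using finite_faces by (simp add: faces_off_def)

text \<open>A ridge that contains a face above \<open>G\<close> contains \<open>G\<close>, so the
  whole interval from \<open>G\<close> to \<open>F\<close> avoids \<open>A\<close>.\<close>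

lemma card_faces_off_ge:
  assumes "G \<in> faces X" "F \<in> faces X" "G \<subseteq> F" "\<And>R. R \<in> ridges_of F \<Longrightarrow> G \<subseteq> R \<Longrightarrow> R \<notin> A"
  shows "nat (face_dim X F - face_dim X G) choose m \<le> card (faces_off F A (face_dim X F - int m))"
proof -
  have "nat (face_dim X F - face_dim X G) choose m \<le> card (interval_faces G F m)"
    by (rule card_interval_faces_ge) (use assms face_dim_mono[OF assms(1-3)] in auto)
  also have "\<dots> \<le> card (faces_off F A (face_dim X F - int m))"
    by (rule card_mono[OF finite_faces_off]) (use assms(4) in \<open>auto simp: interval_faces_def faces_off_def\<close>)
  finally show ?thesis .
qed

text \<open>The roles cross: a face through which all ridges are early yields faces off the late
  ridges, and conversely. Two faces whose dimensions add up to at most \<open>e\<close>, in a facet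
  of dimension \<open>e + 1\<close>, have codimensions with sum at least
  \<open>2 * (e + 1) - e = e + 2\<close>.\<close>

lemma facet_split:
  assumes "weak_shelling (Suc e) Fs" "j < length Fs"
  obtains a b where "Suc (Suc e) \<le> a + b"
    "\<And>m. a choose m \<le> card (faces_off (Fs ! j) (ridges_of (Fs ! j) - early Fs j) (int (Suc e) - int m))"
    "\<And>m. b choose m \<le> card (faces_off (Fs ! j) (early Fs j) (int (Suc e) - int m))"
proof -
  note ws = weak_shellingD[OF assms(1)]
  have F: "Fs ! j \<in> faces X" "face_dim X (Fs ! j) = int e + 1"
    using ws(2) ws(3)[of "Fs ! j"] assms(2) nth_mem by auto
  obtain Gs m where Gs: "shelling e X (face_boundary X (Fs ! j)) Gs" "m \<le> length Gs" "set (take m Gs) = early Fs j"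
    using weak_shelling_Suc[OF assms] .
  have sGs: "set Gs = ridges_of (Fs ! j)"
    using shelling_weak(2)[OF Gs(1)] faces_of_dim_face_boundary[OF F] by simp
  obtain G H where GH: "G \<in> faces X" "H \<in> faces X" "G \<subseteq> Fs ! j" "H \<subseteq> Fs ! j" "face_dim X G + face_dim X H \<le> int e"
    and GH': "\<forall>R\<in>set Gs. G \<subseteq> R \<longrightarrow> R \<in> set (take m Gs)" "\<forall>R\<in>set Gs. H \<subseteq> R \<longrightarrow> R \<notin> set (take m Gs)"
    using complementary_faces[OF Gs(1) F Gs(2)] by (elim bexE conjE) (rule that)
  have Gearly: "R \<in> early Fs j" if "R \<in> ridges_of (Fs ! j)" "G \<subseteq> R" for R
    using GH'(1) that unfolding Gs(3) sGs by simp
  have Hlate: "R \<notin> early Fs j" if "R \<in> ridges_of (Fs ! j)" "H \<subseteq> R" for R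
    using GH'(2) that unfolding Gs(3) sGs by simp
  have le: "face_dim X G \<le> int e + 1" "face_dim X H \<le> int e + 1"
    using face_dim_mono[OF GH(1) F(1) GH(3)] face_dim_mono[OF GH(2) F(1) GH(4)] F(2) by simp_all
  show ?thesis
  proof (rule that)
    show "Suc (Suc e) \<le> nat (face_dim X (Fs ! j) - face_dim X G) + nat (face_dim X (Fs ! j) - face_dim X H)"
      using GH(5) F(2) le by linarith
    fix m
    have eq: "int (Suc e) - int m = face_dim X (Fs ! j) - int m" using F(2) by simp
    show "nat (face_dim X (Fs ! j) - face_dim X G) choose m
        \<le> card (faces_off (Fs ! j) (ridges_of (Fs ! j) - early Fs j) (int (Suc e) - int m))"
      unfolding eq by (rule card_faces_off_ge) (use GH F Gearly in auto)
    show "nat (face_dim X (Fs ! j) - face_dim X H) choose m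
        \<le> card (faces_off (Fs ! j) (early Fs j) (int (Suc e) - int m))"
      unfolding eq by (rule card_faces_off_ge) (use GH F Hlate in auto)
  qed
qed

subsection \<open>Simplices\<close>

text \<open>Dual to atomicity. A face \<open>M\<close> of largest dimension that contains
  \<open>H\<close> but not \<open>G\<close> must be a ridge: otherwise it has two distinct covers
  inside \<open>F\<close>, both containing \<open>G\<close> by maximality, and they intersect in
  \<open>M\<close>.\<close>

lemma coatomic:
  assumes "G \<in> faces X" "H \<in> faces X" "F \<in> faces X" "G \<subseteq> F" "H \<subseteq> F" "\<not> G \<subseteq> H"
  obtains R where "R \<in> ridges_of F" "H \<subseteq> R" "\<not> G \<subseteq> R"
proof -
  define P where "P = (\<lambda>M. M \<in> faces X \<and> H \<subseteq> M \<and> M \<subseteq> F \<and> \<not> G \<subseteq> M)"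
  have "P H" using assms by (auto simp: P_def)
  moreover have "nat (face_dim X N + 1) < nat (face_dim X F + 2)" if "P N" for N
  proof -
    have "face_dim X N \<le> face_dim X F" using that face_dim_mono[of N F] assms(3) by (simp add: P_def)
    then show ?thesis using face_dim_ge[of N] by linarith
  qed
  ultimately obtain M where M: "P M" and max: "\<And>N. P N \<Longrightarrow> nat (face_dim X N + 1) \<le> nat (face_dim X M + 1)"
    using ex_has_greatest_nat[of P H "\<lambda>N. nat (face_dim X N + 1)" "nat (face_dim X F + 2)"] by metis
  have Mf: "M \<in> faces X" "H \<subseteq> M" "M \<subseteq> F" "\<not> G \<subseteq> M" using M by (auto simp: P_def)
  have above: "G \<subseteq> N" if "N \<in> faces X" "M \<subseteq> N" "N \<subseteq> F" "face_dim X N = face_dim X M + 1" for N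
  proof (rule ccontr)
    assume "\<not> G \<subseteq> N"
    then have "P N" using that Mf by (auto simp: P_def)
    then show False using max[of N] that(4) face_dim_ge[of M] by simp
  qed
  have MF: "M \<subset> F" using Mf assms(4) by auto
  obtain N where N: "N \<in> faces X" "M \<subseteq> N" "N \<subseteq> F" "\<not> N \<subseteq> M" "face_dim X N = face_dim X M + 1"
    using cover_outside[OF Mf(1) Mf(1) assms(3) order_refl MF] .
  show ?thesis
  proof (cases "N = F")
    case True
    then show ?thesis using that[of M] Mf N by (auto simp: ridges_of_def)
  next
    case False
    then have NF: "N \<subset> F" using N by auto
    obtain N' where N': "N' \<in> faces X" "M \<subseteq> N'" "N' \<subseteq> F" "\<not> N' \<subseteq> N" "face_dim X N' = face_dim X M + 1"
      using cover_outside[OF Mf(1) N(1) assms(3) N(2) NF] .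
    have "N \<inter> N' \<subset> N'" using N' by auto
    then have "face_dim X (N \<inter> N') < face_dim X N'"
      using face_dim_strict[OF inter_face[OF N(1) N'(1)] N'(1)] by simp
    then have "M = N \<inter> N'"
      using face_eqI[OF Mf(1) inter_face[OF N(1) N'(1)]] N N' by auto
    then have "G \<subseteq> M" using above N N' by blast
    then show ?thesis using Mf by blast
  qed
qed

text \<open>\<open>\<phi>\<close> preserves rank: if \<open>R\<close> is a ridge of
  \<open>G\<close>, adding to \<open>\<phi> R\<close> one element of \<open>\<phi> G\<close> gives
  the image of a face within \<open>G\<close> and strictly above \<open>R\<close>, which can only be
  \<open>G\<close>.\<close>

lemma simplex_card:
  assumes "F \<in> faces X" "finite V" "bij_betw \<phi> (face_closure X {F}) (Pow V)"
    "\<And>G H. G \<in> face_closure X {F} \<Longrightarrow> H \<in> face_closure X {F} \<Longrightarrow> G \<subseteq> H \<longleftrightarrow> \<phi> G \<subseteq> \<phi> H"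
    "G \<in> faces X" "G \<subseteq> F"
  shows "int (card (\<phi> G)) = face_dim X G + 1"
  using assms(5,6)
proof (induction "nat (face_dim X G + 1)" arbitrary: G rule: less_induct)
  case less
  have cl: "H \<in> face_closure X {F} \<longleftrightarrow> H \<in> faces X \<and> H \<subseteq> F" for H
    using face_closure_single[OF assms(1)] by auto
  have range: "\<phi> H \<subseteq> V" if "H \<in> face_closure X {F}" for H
    using that bij_betwE[OF assms(3)] by blast
  have onto: "\<exists>H\<in>face_closure X {F}. \<phi> H = S" if "S \<subseteq> V" for S
    using that assms(3) unfolding bij_betw_def by (metis Pow_iff imageE)
  show ?case
  proof (cases "G = {}")
    case True
    obtain H where H: "H \<in> face_closure X {F}" "\<phi> H = {}" using onto by blast
    then have "\<phi> G \<subseteq> \<phi> H" using assms(4)[of G H] True less.prems cl by blast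
    then show ?thesis using H True face_dim_empty by simp
  next
    case False
    then obtain R where R: "R \<in> ridges_of G" using ridge_above[OF empty_face less.prems(1)] by blast
    then have Rf: "R \<in> faces X" "R \<subseteq> G" "face_dim X R = face_dim X G - 1" by (auto simp: ridges_of_def)
    have IH: "int (card (\<phi> R)) = face_dim X R + 1"
      by (rule less.hyps) (use Rf less.prems face_dim_nonneg[OF False] in auto)
    have clG: "G \<in> face_closure X {F}" "R \<in> face_closure X {F}" using cl less.prems Rf by auto
    have sub: "\<phi> R \<subseteq> \<phi> G" "\<not> \<phi> G \<subseteq> \<phi> R"
      using assms(4)[OF clG(2,1)] assms(4)[OF clG] Rf not_subset_ridge[OF R] by auto
    then obtain v where v: "v \<in> \<phi> G" "v \<notin> \<phi> R" by blast
    have "insert v (\<phi> R) \<subseteq> V" using v range[OF clG(1)] range[OF clG(2)] by blast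
    then obtain H where H: "H \<in> face_closure X {F}" "\<phi> H = insert v (\<phi> R)" using onto by blast
    have "R \<subseteq> H" "H \<subseteq> G" "\<not> H \<subseteq> R"
      using assms(4)[OF clG(2) H(1)] assms(4)[OF H(1) clG(1)] assms(4)[OF H(1) clG(2)] H(2) v sub by auto
    then have "face_dim X R < face_dim X H" using face_dim_strict[of R H] Rf H cl by blast
    then have "H = G" using face_eqI[of H G] H cl less.prems \<open>H \<subseteq> G\<close> Rf by auto
    then have "\<phi> G = insert v (\<phi> R)" using H by simp
    moreover have "finite (\<phi> R)" using range[OF clG(2)] assms(2) finite_subset by blast
    ultimately show ?thesis using IH v Rf by simp
  qed
qed

lemma simplex_ridges:
  assumes "F \<in> faces X" "is_simplex X F"
  shows "int (card (ridges_of F)) = face_dim X F + 1"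
proof -
  obtain V :: "nat set" and \<phi> where V: "finite V" "int (card V) = face_dim X F + 1"
    and bij: "bij_betw \<phi> (face_closure X {F}) (Pow V)"
    and ord': "\<forall>G\<in>face_closure X {F}. \<forall>H\<in>face_closure X {F}. G \<subseteq> H \<longleftrightarrow> \<phi> G \<subseteq> \<phi> H"
    using assms(2) unfolding is_simplex_def by (elim exE conjE) (rule that)
  have ord: "G \<subseteq> H \<longleftrightarrow> \<phi> G \<subseteq> \<phi> H"
    if "G \<in> face_closure X {F}" "H \<in> face_closure X {F}" for G H
    using ord' that by simp
  note card = simplex_card[OF assms(1) V(1) bij ord]
  have cl: "face_closure X {F} = {H \<in> faces X. H \<subseteq> F}" by (rule face_closure_single[OF assms(1)])
  show ?thesis
  proof (cases "card V = 0")
    case True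
    have "R \<notin> ridges_of F" for R using V(2) True face_dim_ge[of R] by (auto simp: ridges_of_def)
    then have "ridges_of F = {}" by blast
    then show ?thesis using True V by simp
  next
    case False
    have "bij_betw \<phi> (ridges_of F) {S. S \<subseteq> V \<and> card S = card V - 1}"
      unfolding bij_betw_def
    proof
      show "inj_on \<phi> (ridges_of F)"
        by (rule inj_on_subset[of _ "face_closure X {F}"]) (use bij cl in \<open>auto simp: bij_betw_def ridges_of_def\<close>)
      show "\<phi> ` ridges_of F = {S. S \<subseteq> V \<and> card S = card V - 1}"
      proof (intro equalityI subsetI)
        fix S assume "S \<in> \<phi> ` ridges_of F"
        then obtain R where R: "R \<in> faces X" "R \<subseteq> F" "face_dim X R = face_dim X F - 1" "S = \<phi> R"
          by (auto simp: ridges_of_def)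
        have "\<phi> R \<in> Pow V" using bij_betwE[OF bij] R(1,2) cl by blast
        moreover have "int (card (\<phi> R)) = face_dim X R + 1" by (rule card) (use R in auto)
        ultimately show "S \<in> {S. S \<subseteq> V \<and> card S = card V - 1}" using R(3,4) V(2) False by auto
      next
        fix S assume S: "S \<in> {S. S \<subseteq> V \<and> card S = card V - 1}"
        then obtain R where R: "R \<in> faces X" "R \<subseteq> F" "\<phi> R = S"
          using bij cl unfolding bij_betw_def by (metis (no_types, lifting) Pow_iff imageE mem_Collect_eq)
        have "int (card (\<phi> R)) = face_dim X R + 1" by (rule card) (use R in auto)
        then show "S \<in> \<phi> ` ridges_of F" using R S V(2) False by (auto simp: ridges_of_def)
      qed
    qed
    then have "card (ridges_of F) = card {S. S \<subseteq> V \<and> card S = card V - 1}" by (rule bij_betw_same_card)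
    also have "\<dots> = card V choose (card V - 1)" by (rule n_subsets[OF V(1)])
    also have "\<dots> = card V" using False binomial_symmetric[of 1 "card V"] by simp
    finally show ?thesis using V(2) by simp
  qed
qed

lemma card_ridges_ge:
  assumes "F \<in> faces X"
  shows "face_dim X F + 1 \<le> int (card (ridges_of F))"
proof -
  have "interval_faces {} F 1 = ridges_of F" by (auto simp: interval_faces_def ridges_of_def)
  moreover have "nat (face_dim X F + 1) choose 1 \<le> card (interval_faces {} F 1)"
    by (rule card_interval_faces_ge) (use assms empty_face face_dim_empty face_dim_ge[of F] in auto)
  ultimately show ?thesis by simp
qed

text \<open>Summing the binomial bounds over all ranks gives the size of the Boolean lattice. This
  settles surjectivity in \<open>ridges_simplex\<close>.\<close>

lemma card_face_closure_ge:
  assumes "F \<in> faces X"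
  shows "2 ^ nat (face_dim X F + 1) \<le> card (face_closure X {F})"
proof -
  define a where "a = nat (face_dim X F + 1)"
  have a: "int a = face_dim X F + 1" using face_dim_ge[of F] by (simp add: a_def)
  have "2 ^ a = (\<Sum>m\<le>a. a choose m)" by (rule choose_row_sum[symmetric])
  also have "\<dots> \<le> (\<Sum>m\<le>a. card (interval_faces {} F m))"
    by (rule sum_mono, rule card_interval_faces_ge) (use assms empty_face face_dim_empty a in auto)
  also have "\<dots> = card (\<Union>m\<in>{..a}. interval_faces {} F m)"
    by (rule card_UN_disjoint[symmetric]) (auto simp: finite_interval_faces, auto simp: interval_faces_def)
  also have "\<dots> \<le> card (face_closure X {F})"
    by (rule card_mono) (use finite_faces in \<open>auto simp: face_closure_def interval_faces_def\<close>)
  finally show ?thesis by (simp add: a_def)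
qed

text \<open>The labelling sends a face to the set of ridges that do not contain it. Coatomicity
  makes this an order embedding into the subsets of a set of size \<open>face_dim X F + 1\<close>,
  and the lower bound on the number of faces makes it onto.\<close>

lemma ridges_simplex:
  assumes "F \<in> faces X" "int (card (ridges_of F)) = face_dim X F + 1"
  shows "is_simplex X F"
proof -
  define a where "a = card (ridges_of F)"
  obtain h where h: "bij_betw h (ridges_of F) {0..<a}"
    using ex_bij_betw_finite_nat[OF finite_ridges_of] unfolding a_def by blast
  define \<phi> where "\<phi> = (\<lambda>G. h ` {R \<in> ridges_of F. \<not> G \<subseteq> R})"
  have cl: "face_closure X {F} = {H \<in> faces X. H \<subseteq> F}" by (rule face_closure_single[OF assms(1)])
  have inj: "inj_on h (ridges_of F)" using h by (simp add: bij_betw_def)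
  have ord: "G \<subseteq> H \<longleftrightarrow> \<phi> G \<subseteq> \<phi> H" if "G \<in> face_closure X {F}" "H \<in> face_closure X {F}" for G H
  proof -
    have GH: "G \<in> faces X" "H \<in> faces X" "G \<subseteq> F" "H \<subseteq> F" using that unfolding cl by simp_all
    have "\<phi> G \<subseteq> \<phi> H \<longleftrightarrow> {R \<in> ridges_of F. \<not> G \<subseteq> R} \<subseteq> {R \<in> ridges_of F. \<not> H \<subseteq> R}"
      unfolding \<phi>_def by (rule inj_on_image_subset_iff[OF inj]) auto
    also have "\<dots> \<longleftrightarrow> G \<subseteq> H"
    proof
      assume sub: "{R \<in> ridges_of F. \<not> G \<subseteq> R} \<subseteq> {R \<in> ridges_of F. \<not> H \<subseteq> R}"
      show "G \<subseteq> H"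
      proof (rule ccontr)
        assume "\<not> G \<subseteq> H"
        then obtain R where "R \<in> ridges_of F" "H \<subseteq> R" "\<not> G \<subseteq> R"
          by (rule coatomic[OF GH(1,2) assms(1) GH(3,4)])
        then show False using sub by blast
      qed
    qed blast
    finally show ?thesis by simp
  qed
  have injphi: "inj_on \<phi> (face_closure X {F})" using ord by (intro inj_onI equalityI) simp_all
  have sub: "\<phi> ` face_closure X {F} \<subseteq> Pow {0..<a}" using h by (auto simp: \<phi>_def bij_betw_def)
  have "card (Pow {0..<a}) \<le> card (\<phi> ` face_closure X {F})"
    using card_face_closure_ge[OF assms(1)] card_image[OF injphi] assms(2)
    by (simp add: card_Pow flip: a_def) (metis nat_int)
  then have "\<phi> ` face_closure X {F} = Pow {0..<a}" using sub by (intro card_seteq) auto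
  then have "bij_betw \<phi> (face_closure X {F}) (Pow {0..<a})" using injphi by (simp add: bij_betw_def)
  then show ?thesis unfolding is_simplex_def using ord assms(2)
    by (intro exI[of _ "{0..<a}"] exI[of _ \<phi>]) (auto simp: a_def)
qed

text \<open>A lower interval of a Boolean lattice is Boolean: the labelling of \<open>F\<close>
  restricts to one of \<open>G\<close> by the subsets of \<open>\<phi> G\<close>.\<close>

lemma simplex_subface:
  assumes "F \<in> faces X" "is_simplex X F" "G \<in> faces X" "G \<subseteq> F"
  shows "is_simplex X G"
proof -
  obtain V :: "nat set" and \<phi> where V: "finite V" "int (card V) = face_dim X F + 1"
    and bij: "bij_betw \<phi> (face_closure X {F}) (Pow V)"
    and ord': "\<forall>G\<in>face_closure X {F}. \<forall>H\<in>face_closure X {F}. G \<subseteq> H \<longleftrightarrow> \<phi> G \<subseteq> \<phi> H"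
    using assms(2) unfolding is_simplex_def by (elim exE conjE) (rule that)
  have ord: "G \<subseteq> H \<longleftrightarrow> \<phi> G \<subseteq> \<phi> H"
    if "G \<in> face_closure X {F}" "H \<in> face_closure X {F}" for G H
    using ord' that by simp
  have cl: "face_closure X {F} = {H \<in> faces X. H \<subseteq> F}" by (rule face_closure_single[OF assms(1)])
  have clG: "face_closure X {G} = {H \<in> faces X. H \<subseteq> G}" by (rule face_closure_single[OF assms(3)])
  have sub: "face_closure X {G} \<subseteq> face_closure X {F}" using cl clG assms(4) by auto
  have G: "G \<in> face_closure X {F}" using cl assms by simp
  have GV: "\<phi> G \<subseteq> V" using bij_betwE[OF bij] G by blast
  have "\<phi> ` face_closure X {G} = Pow (\<phi> G)"
  proof (intro equalityI subsetI)
    fix S assume "S \<in> \<phi> ` face_closure X {G}"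
    then show "S \<in> Pow (\<phi> G)" using ord[OF _ G] sub clG by auto
  next
    fix S assume S: "S \<in> Pow (\<phi> G)"
    then have "S \<in> \<phi> ` face_closure X {F}" using bij GV by (auto simp: bij_betw_def)
    then obtain H where H: "H \<in> face_closure X {F}" "S = \<phi> H" by blast
    then have "H \<subseteq> G" using ord[OF H(1) G] S by simp
    then show "S \<in> \<phi> ` face_closure X {G}" using H cl clG by auto
  qed
  moreover have "inj_on \<phi> (face_closure X {G})" using bij sub inj_on_subset by (auto simp: bij_betw_def)
  ultimately have "bij_betw \<phi> (face_closure X {G}) (Pow (\<phi> G))" by (simp add: bij_betw_def)
  moreover have "int (card (\<phi> G)) = face_dim X G + 1"
    by (rule simplex_card[OF assms(1) V(1) bij ord assms(3,4)])
  moreover have "finite (\<phi> G)" using GV V(1) finite_subset by blast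
  ultimately show ?thesis unfolding is_simplex_def using ord sub
    by (intro exI[of _ "\<phi> G"] exI[of _ \<phi>]) (auto simp: subset_iff)
qed

end

section \<open>Face numbers of shellable complexes\<close>

lemma binomial_add_balanced:
  fixes a b n m :: nat
  assumes "n \<le> a + b"
  shows "(n div 2 choose m) + ((n + 1) div 2 choose m) \<le> (a choose m) + (b choose m)"
proof -
  have le: "(n div 2 choose m) + ((n + 1) div 2 choose m) \<le> (a choose m) + (b choose m)"
    if "a \<le> b" "n \<le> a + b" for a b :: nat
    using that
  proof (induction "n div 2 - a" arbitrary: a b)
    case 0
    then have "n div 2 \<le> a" "(n + 1) div 2 \<le> b" by linarith+
    then show ?case by (intro add_mono binomial_right_mono)
  next
    case (Suc x)
    have c: "b = Suc (b - 1)" "Suc a \<le> b - 1" using Suc by linarith+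
    \<comment> \<open>For positive \<open>m\<close>, moving \<open>a\<close> and \<open>b\<close>
      one step towards each other loses \<open>b - 1 choose (m - 1)\<close> and gains only
      \<open>a choose (m - 1)\<close>.\<close>
    have "(n div 2 choose m) + ((n + 1) div 2 choose m) \<le> (Suc a choose m) + (b - 1 choose m)"
      by (rule Suc.hyps) (use Suc c in linarith)+
    also have "\<dots> \<le> (a choose m) + (b choose m)"
      using binomial_right_mono[of a "b - 1" "m - 1"] c by (cases m; cases b) auto
    finally show ?case .
  qed
  show ?thesis using le[of a b] le[of b a] assms by (cases "a \<le> b") auto
qed

lemma binomial_less_add:
  fixes p q r :: nat
  assumes "0 < p" "0 < r" "r \<le> p + q"
  shows "q choose r < p + q choose r"
proof (cases "r \<le> q + 1")
  case True
  have "q choose r < Suc q choose r" using True assms(2) by (cases r) auto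
  also have "\<dots> \<le> p + q choose r" by (rule binomial_right_mono) (use assms in simp)
  finally show ?thesis .
next
  case False
  then show ?thesis using assms(3) by (simp add: binomial_eq_0)
qed

lemma binomial_add_le:
  fixes p q m :: nat
  assumes "0 < m"
  shows "(p choose m) + (q choose m) \<le> p + q choose m"
proof (induction q)
  case (Suc q)
  have "q choose (m - 1) \<le> p + q choose (m - 1)" by (rule binomial_right_mono) simp
  then show ?case using Suc assms by (cases m) auto
qed (use assms in simp)

text \<open>For \<open>m \<ge> 2\<close> some \<open>m\<close>-subset of a disjoint union meets both
  parts. This is the surplus by which the first facet exceeds the average bound.\<close>

lemma binomial_add_less:
  fixes p q m :: nat
  assumes "2 \<le> m" "0 < p" "0 < q" "m \<le> p + q"
  shows "(p choose m) + (q choose m) < p + q choose m"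
proof -
  obtain q' where q: "q = Suc q'" using assms(3) by (cases q) auto
  obtain r where m: "m = Suc r" "0 < r" using assms(1) by (cases m) auto
  have "(p choose m) + (q' choose m) \<le> p + q' choose m" by (rule binomial_add_le) (use m in simp)
  moreover have "q' choose r < p + q' choose r" by (rule binomial_less_add) (use assms q m in auto)
  ultimately show ?thesis using q m by simp
qed

section \<open>Counts of new faces, completed faces and ridges\<close>

context face_lattice
begin

lemma shelling_facet_above:
  assumes "shelling d X (faces X) Fs" "G \<in> faces X"
  obtains j where "j < length Fs" "G \<subseteq> Fs ! j"
proof -
  have "pure_complex X (int d) (faces X)" using assms(1) by (cases d) simp_all
  then obtain F where "F \<in> faces_of_dim X (faces X) (int d)" "G \<subseteq> F"
    using assms(2) unfolding pure_complex_def by blast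
  then show ?thesis using that shelling_weak(2)[OF assms(1)] by (metis in_set_conv_nth)
qed

text \<open>Each face is counted once, at the first facet of the shelling that contains it.\<close>

lemma f_num_new:
  assumes "shelling d X (faces X) Fs"
  shows "f_num X k (faces X) = (\<Sum>j<length Fs. card (faces_off (Fs ! j) (early Fs j) k))"
proof -
  note ws = weak_shellingD[OF shelling_weak(1)[OF assms]]
  have "faces_of_dim X (faces X) k = (\<Union>j<length Fs. faces_off (Fs ! j) (early Fs j) k)"
  proof (intro equalityI subsetI)
    fix G assume G: "G \<in> faces_of_dim X (faces X) k"
    then have Gf: "G \<in> faces X" by (simp add: faces_of_dim_def)
    obtain i where i: "i < length Fs" "G \<subseteq> Fs ! i" using shelling_facet_above[OF assms Gf] .
    define j where "j = (LEAST t. G \<subseteq> Fs ! t)"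
    have j: "G \<subseteq> Fs ! j" "j \<le> i" unfolding j_def using i(2)
      by (fact LeastI[of "\<lambda>t. G \<subseteq> Fs ! t"], fact Least_le[of "\<lambda>t. G \<subseteq> Fs ! t"])
    have "R \<notin> early Fs j" if "G \<subseteq> R" for R
    proof
      assume "R \<in> early Fs j"
      then obtain t where "t < j" "G \<subseteq> Fs ! t" using \<open>G \<subseteq> R\<close> unfolding early_def by blast
      then show False unfolding j_def using not_less_Least by blast
    qed
    then have "G \<in> faces_off (Fs ! j) (early Fs j) k" using j G by (simp add: faces_off_def faces_of_dim_def)
    then show "G \<in> (\<Union>j<length Fs. faces_off (Fs ! j) (early Fs j) k)" using j i by auto
  qed (auto simp: faces_off_def faces_of_dim_def)
  moreover have "card (\<Union>j<length Fs. faces_off (Fs ! j) (early Fs j) k)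
      = (\<Sum>j<length Fs. card (faces_off (Fs ! j) (early Fs j) k))"
  proof (rule card_UN_disjoint)
    have disj: "faces_off (Fs ! i) (early Fs i) k \<inter> faces_off (Fs ! j) (early Fs j) k = {}"
      if "i < j" "j < length Fs" for i j
    proof -
      have False if G: "G \<in> faces_off (Fs ! i) (early Fs i) k" "G \<in> faces_off (Fs ! j) (early Fs j) k" for G
      proof -
        have g: "G \<in> faces X" "G \<subseteq> Fs ! j" "G \<subseteq> Fs ! i" using G by (auto simp: faces_off_def)
        obtain R where "R \<in> early Fs j" "G \<subseteq> R" using ws(4)[OF \<open>j < length Fs\<close> \<open>i < j\<close> g] by blast
        then show False using G(2) by (auto simp: faces_off_def early_def)
      qed
      then show ?thesis by blast
    qed
    show "\<forall>i\<in>{..<length Fs}. \<forall>j\<in>{..<length Fs}. i \<noteq> j \<longrightarrow>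
        faces_off (Fs ! i) (early Fs i) k \<inter> faces_off (Fs ! j) (early Fs j) k = {}"
    proof (intro ballI impI)
      fix i j assume "i \<in> {..<length Fs}" "j \<in> {..<length Fs}" "i \<noteq> j"
      then show "faces_off (Fs ! i) (early Fs i) k \<inter> faces_off (Fs ! j) (early Fs j) k = {}"
        using disj[of i j] disj[of j i] by (cases "i < j") (simp_all add: Int_commute)
    qed
  qed (simp_all add: finite_faces_off)
  ultimately show ?thesis by (simp add: f_num_def)
qed

lemma complex_dim_shelling:
  assumes "shelling d X (faces X) Fs"
  shows "complex_dim X (faces X) = int d"
  using assms by (cases d) (simp_all add: pure_complex_def)

lemma boundary_faces:
  assumes "shelling d X (faces X) Fs"
  shows "boundary_complex X (faces X) = face_closure X {R \<in> faces X. face_dim X R = int d - 1 \<and> card {F \<in> set Fs. R \<subseteq> F} = 1}"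
  unfolding boundary_complex_def complex_dim_shelling[OF assms] shelling_weak(2)[OF assms]
  by (simp add: faces_of_dim_def)

text \<open>The completed faces of different facets are distinct by \<open>closing_last\<close>, and
  they are not in the boundary complex by \<open>closing_saturated\<close>.\<close>

lemma f_num_late:
  assumes "shelling d X (faces X) Fs" "thin d (set Fs)"
  shows "(\<Sum>j<length Fs. card (faces_off (Fs ! j) (ridges_of (Fs ! j) - early Fs j) k))
      + f_num X k (boundary_complex X (faces X)) \<le> f_num X k (faces X)"
proof -
  note w = shelling_weak(1)[OF assms(1)]
  note ws = weak_shellingD[OF w]
  let ?late = "\<lambda>j. faces_off (Fs ! j) (ridges_of (Fs ! j) - early Fs j) k"
  let ?B = "faces_of_dim X (boundary_complex X (faces X)) k"
  have closing: "closing Fs G j" "G \<in> faces X" "G \<subseteq> Fs ! j" if "G \<in> ?late j" "j < length Fs" for G j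
    using that by (auto simp: faces_off_def closing_def)
  have "(\<Sum>j<length Fs. card (?late j)) = card (\<Union>j<length Fs. ?late j)"
  proof (rule card_UN_disjoint[symmetric])
    show "\<forall>i\<in>{..<length Fs}. \<forall>j\<in>{..<length Fs}. i \<noteq> j \<longrightarrow> ?late i \<inter> ?late j = {}"
    proof (intro ballI impI)
      fix i j assume ij: "i \<in> {..<length Fs}" "j \<in> {..<length Fs}" "i \<noteq> j"
      have False if "G \<in> ?late i" "G \<in> ?late j" for G
      proof -
        have "i \<le> j" "j \<le> i"
          using closing_last[OF w assms(2)] closing[OF that(1)] closing[OF that(2)] ij by auto
        then show False using ij(3) by simp
      qed
      then show "?late i \<inter> ?late j = {}" by blast
    qed
  qed (simp_all add: finite_faces_off)
  moreover have "card (\<Union>j<length Fs. ?late j) + card ?B = card ((\<Union>j<length Fs. ?late j) \<union> ?B)"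
  proof (rule card_Un_disjoint[symmetric])
    have "boundary_complex X (faces X) \<subseteq> faces X"
      unfolding boundary_faces[OF assms(1)] by (auto simp: face_closure_def)
    then show "finite ?B"
      using finite_faces by (auto simp: faces_of_dim_def intro: finite_subset)
    have False if late: "G \<in> ?late j" "j < length Fs" and B: "G \<in> ?B" for G j
    proof -
      obtain R where R: "R \<in> faces X" "face_dim X R = int d - 1" "card {F \<in> set Fs. R \<subseteq> F} = 1" "G \<subseteq> R"
        using B unfolding boundary_faces[OF assms(1)] faces_of_dim_def face_closure_def by blast
      then obtain F where "F \<in> set Fs" "R \<subseteq> F" by (metis (no_types, lifting) card_1_singletonE insertI1 mem_Collect_eq)
      then obtain i where i: "i < length Fs" "R \<subseteq> Fs ! i" "face_dim X (Fs ! i) = int d"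
        using ws(3) by (metis in_set_conv_nth)
      have "R \<in> ridges_of (Fs ! i)" using R i by (simp add: ridges_of_def)
      then have "card {F \<in> set Fs. R \<subseteq> F} = 2"
        using closing_saturated[OF w assms(2) closing(2)[OF late] closing(1)[OF late] i(1)] R(4) i(2) by blast
      then show False using R(3) by simp
    qed
    then show "(\<Union>j<length Fs. ?late j) \<inter> ?B = {}" by blast
  qed (simp add: finite_faces_off)
  moreover have "card ((\<Union>j<length Fs. ?late j) \<union> ?B) \<le> card (faces_of_dim X (faces X) k)"
  proof (rule card_mono)
    show "finite (faces_of_dim X (faces X) k)" using finite_faces by (simp add: faces_of_dim_def)
    show "(\<Union>j<length Fs. ?late j) \<union> ?B \<subseteq> faces_of_dim X (faces X) k"
      unfolding boundary_faces[OF assms(1)] by (auto simp: faces_of_dim_def faces_off_def face_closure_def)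
  qed
  ultimately show ?thesis by (simp add: f_num_def)
qed

text \<open>The converse estimate in codimension 1: a ridge that does not lie in exactly one facet
  lies in two, and it is early in the later of these.\<close>

lemma f_num_ridges_le:
  assumes "shelling d X (faces X) Fs" "thin d (set Fs)"
  shows "f_num X (int d - 1) (faces X)
      \<le> (\<Sum>j<length Fs. card (early Fs j)) + f_num X (int d - 1) (boundary_complex X (faces X))"
proof -
  note ws = weak_shellingD[OF shelling_weak(1)[OF assms(1)]]
  let ?B = "faces_of_dim X (boundary_complex X (faces X)) (int d - 1)"
  have fin: "finite (early Fs j)" for j by (rule finite_subset[OF _ finite_ridges_of[of "Fs ! j"]]) (auto simp: early_def)
  have finB: "finite ?B" unfolding boundary_faces[OF assms(1)]
    using finite_faces by (simp add: faces_of_dim_def face_closure_def)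
  have "faces_of_dim X (faces X) (int d - 1) \<subseteq> (\<Union>j<length Fs. early Fs j) \<union> ?B"
  proof
    fix R assume "R \<in> faces_of_dim X (faces X) (int d - 1)"
    then have R: "R \<in> faces X" "face_dim X R = int d - 1" by (simp_all add: faces_of_dim_def)
    obtain i where i: "i < length Fs" "R \<subseteq> Fs ! i" using shelling_facet_above[OF assms(1) R(1)] .
    show "R \<in> (\<Union>j<length Fs. early Fs j) \<union> ?B"
    proof (cases "card {F \<in> set Fs. R \<subseteq> F} = 1")
      case True
      then have "R \<in> ?B" unfolding boundary_faces[OF assms(1)] using R by (auto simp: faces_of_dim_def face_closure_def)
      then show ?thesis by blast
    next
      case False
      then have "{F \<in> set Fs. R \<subseteq> F} \<noteq> {Fs ! i}" by auto
      then obtain l where l: "l < length Fs" "R \<subseteq> Fs ! l" "l \<noteq> i"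
        using i nth_mem by (smt (verit) Collect_cong in_set_conv_nth singleton_conv)
      have early: "R \<in> early Fs (max i l)"
      proof -
        have m: "max i l < length Fs" "R \<subseteq> Fs ! max i l" using i l by (auto simp: max_def)
        then have "R \<in> ridges_of (Fs ! max i l)" using R ws(3)[of "Fs ! max i l"] by (simp add: ridges_of_def)
        moreover have "min i l < max i l" "R \<subseteq> Fs ! min i l" using i l by (auto simp: min_def)
        ultimately show ?thesis by (auto simp: early_def)
      qed
      then show ?thesis using i l by (auto simp: max_def split: if_splits)
    qed
  qed
  then have "card (faces_of_dim X (faces X) (int d - 1)) \<le> card ((\<Union>j<length Fs. early Fs j) \<union> ?B)"
    by (rule card_mono[rotated]) (use fin finB in auto)
  also have "\<dots> \<le> card (\<Union>j<length Fs. early Fs j) + card ?B" by (rule card_Un_le)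
  also have "\<dots> \<le> (\<Sum>j<length Fs. card (early Fs j)) + card ?B"
    by (simp add: card_UN_le)
  finally show ?thesis by (simp add: f_num_def)
qed

lemma faces_off_ridges:
  assumes "A \<subseteq> ridges_of F" "F \<in> faces X"
  shows "faces_off F A (face_dim X F - 1) = ridges_of F - A"
proof -
  have eq: "G = R" if "G \<in> ridges_of F" "R \<in> ridges_of F" "G \<subseteq> R" for G R
    using face_eqI[of G R] that by (auto simp: ridges_of_def)
  have "faces_off F A (face_dim X F - 1) = {G \<in> ridges_of F. \<forall>R\<in>ridges_of F. G \<subseteq> R \<longrightarrow> R \<notin> A}"
    by (auto simp: faces_off_def ridges_of_def)
  also have "\<dots> = ridges_of F - A" using eq by blast
  finally show ?thesis .
qed

text \<open>Double counting of incidences between ridges and facets. Among the ridges of a facet the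
  new ones are those that are not early and the completed ones are the early ones, so
  \<open>f_num_late\<close> and \<open>f_num_ridges_le\<close> together give an exact count.\<close>

lemma f_num_ridges:
  assumes "shelling d X (faces X) Fs" "thin d (set Fs)"
  shows "2 * f_num X (int d - 1) (faces X)
    = (\<Sum>j<length Fs. card (ridges_of (Fs ! j))) + f_num X (int d - 1) (boundary_complex X (faces X))"
proof -
  note ws = weak_shellingD[OF shelling_weak(1)[OF assms(1)]]
  have sub: "early Fs j \<subseteq> ridges_of (Fs ! j)" for j by (auto simp: early_def)
  have off: "faces_off (Fs ! j) A (int d - 1) = ridges_of (Fs ! j) - A"
    if "j < length Fs" "A \<subseteq> ridges_of (Fs ! j)" for j A
    using faces_off_ridges[OF that(2)] ws(2) ws(3)[of "Fs ! j"] nth_mem[OF that(1)] by (metis subsetD)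
  have new: "f_num X (int d - 1) (faces X) = (\<Sum>j<length Fs. card (ridges_of (Fs ! j) - early Fs j))"
    unfolding f_num_new[OF assms(1)] using off sub by simp
  have dd: "ridges_of (Fs ! j) - (ridges_of (Fs ! j) - early Fs j) = early Fs j" for j using sub by auto
  have late: "(\<Sum>j<length Fs. card (early Fs j)) + f_num X (int d - 1) (boundary_complex X (faces X))
      = f_num X (int d - 1) (faces X)"
    using f_num_late[OF assms, of "int d - 1"] f_num_ridges_le[OF assms] off by (simp add: dd)
  have "(\<Sum>j<length Fs. card (ridges_of (Fs ! j)))
      = (\<Sum>j<length Fs. card (ridges_of (Fs ! j) - early Fs j) + card (early Fs j))"
    by (rule sum.cong) (use sub finite_ridges_of finite_subset[OF sub] in
      \<open>auto simp: card_Diff_subset card_mono\<close>)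
  then show ?thesis using new late by (simp add: sum.distrib)
qed

text \<open>Faces of simplices are simplices, so only the facets need testing, and for these the
  number of ridges decides.\<close>

lemma simplicial_iff_ridges:
  assumes "shelling d X (faces X) Fs"
  shows "simplicial X \<longleftrightarrow> (\<forall>j<length Fs. card (ridges_of (Fs ! j)) = d + 1)"
proof -
  note ws = weak_shellingD[OF shelling_weak(1)[OF assms]]
  have F: "Fs ! j \<in> faces X" "face_dim X (Fs ! j) = int d" if "j < length Fs" for j
    using ws(2) ws(3)[of "Fs ! j"] that nth_mem[OF that] by auto
  have iff: "is_simplex X (Fs ! j) \<longleftrightarrow> card (ridges_of (Fs ! j)) = d + 1" if "j < length Fs" for j
    using simplex_ridges[OF F(1)[OF that]] ridges_simplex[OF F(1)[OF that]] F(2)[OF that] by auto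
  show ?thesis
  proof
    assume "simplicial X"
    then show "\<forall>j<length Fs. card (ridges_of (Fs ! j)) = d + 1"
      using F iff by (simp add: simplicial_def)
  next
    assume *: "\<forall>j<length Fs. card (ridges_of (Fs ! j)) = d + 1"
    show "simplicial X"
      unfolding simplicial_def
    proof
      fix G assume G: "G \<in> faces X"
      obtain i where i: "i < length Fs" "G \<subseteq> Fs ! i" using shelling_facet_above[OF assms G] .
      show "is_simplex X G" using simplex_subface[OF F(1)[OF i(1)] _ G i(2)] iff[OF i(1)] * i(1) by blast
    qed
  qed
qed

text \<open>Doubled and expressed by the codimension \<open>m\<close>, so that both sides are
  natural numbers; \<open>(d + 2) div 2\<close> is the ceiling of
  \<open>(d + 1) / 2\<close>.\<close>

lemma f_num_bound:
  fixes d m :: nat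
  assumes sh: "shelling d X (faces X) Fs" and thin: "thin d (set Fs)"
    and d: "1 \<le> d" and m: "m \<le> (d + 2) div 2"
  defines "k \<equiv> int d - int m"
  defines "p \<equiv> ((d + 2) div 2 choose m) + ((d + 1) div 2 choose m)"
  shows "p * f_num X (int d) (faces X) + f_num X k (boundary_complex X (faces X)) \<le> 2 * f_num X k (faces X)"
    and "2 * f_num X k (faces X) = p * f_num X (int d) (faces X) + f_num X k (boundary_complex X (faces X))
      \<longleftrightarrow> m = 0 \<or> m = 1 \<and> simplicial X"
proof -
  note w = shelling_weak(1)[OF sh]
  note ws = weak_shellingD[OF w]
  obtain e where e: "d = Suc e" using d by (cases d) auto
  let ?n = "length Fs"
  let ?new = "\<lambda>j. card (faces_off (Fs ! j) (early Fs j) k)"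
  let ?late = "\<lambda>j. card (faces_off (Fs ! j) (ridges_of (Fs ! j) - early Fs j) k)"
  let ?b = "f_num X k (boundary_complex X (faces X))"
  have F: "Fs ! j \<in> faces X" "face_dim X (Fs ! j) = int d" if "j < ?n" for j
    using ws(2) ws(3)[of "Fs ! j"] that nth_mem[OF that] by auto
  have fd: "f_num X (int d) (faces X) = ?n"
    using distinct_card[OF ws(1)] shelling_weak(2)[OF sh] by (simp add: f_num_def)
  obtain j0 where "j0 < ?n" using shelling_facet_above[OF sh empty_face] .
  then have n: "0 < ?n" by linarith
  have pj: "p \<le> ?new j + ?late j" if j: "j < ?n" for j
  proof -
    obtain a b where ab: "Suc (Suc e) \<le> a + b" "a choose m \<le> ?late j" "b choose m \<le> ?new j"
      using facet_split[OF w[unfolded e] j] unfolding k_def e by metis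
    have "p \<le> (a choose m) + (b choose m)"
      using binomial_add_balanced[OF ab(1), of m] unfolding p_def e by simp
    then show ?thesis using ab by linarith
  qed
  have sum: "(\<Sum>j<?n. ?new j + ?late j) + ?b \<le> 2 * f_num X k (faces X)"
    using f_num_new[OF sh, of k] f_num_late[OF sh thin, of k] by (simp add: sum.distrib)
  have psum: "p * ?n = (\<Sum>j<?n. p)" by simp
  also have "\<dots> \<le> (\<Sum>j<?n. ?new j + ?late j)" by (rule sum_mono) (use pj in auto)
  finally have le: "p * ?n \<le> (\<Sum>j<?n. ?new j + ?late j)" .
  show "p * f_num X (int d) (faces X) + ?b \<le> 2 * f_num X k (faces X)" using sum le fd by simp
  consider "m = 0" | "m = 1" | "2 \<le> m" by linarith
  then show "2 * f_num X k (faces X) = p * f_num X (int d) (faces X) + ?b \<longleftrightarrow> m = 0 \<or> m = 1 \<and> simplicial X"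
  proof cases
    case 1
    \<comment> \<open>For \<open>k = d\<close> both binomials are 1 and the boundary has no
      \<open>d\<close>-faces, so both sides are twice the number of facets.\<close>
    have "faces_of_dim X (boundary_complex X (faces X)) (int d) = {}"
    proof -
      have "face_dim X G \<le> int d - 1" if "G \<in> boundary_complex X (faces X)" for G
      proof -
        obtain R where "G \<in> faces X" "R \<in> faces X" "face_dim X R = int d - 1" "G \<subseteq> R"
          using \<open>G \<in> boundary_complex X (faces X)\<close> unfolding boundary_faces[OF sh] face_closure_def by blast
        then show ?thesis using face_dim_mono[of G R] by simp
      qed
      then show ?thesis unfolding faces_of_dim_def by fastforce
    qed
    then have "?b = 0" using 1 by (simp add: k_def f_num_def)
    then show ?thesis using 1 by (simp add: k_def p_def)
  next
    case 2
    have p: "p = d + 1" using 2 by (simp add: p_def)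
    have k: "k = int d - 1" using 2 by (simp add: k_def)
    have ge: "d + 1 \<le> card (ridges_of (Fs ! j))" if "j < ?n" for j
      using card_ridges_ge[OF F(1)[OF that]] F(2)[OF that] by simp
    \<comment> \<open>By the exact count, equality concerns only the sum of the ridge numbers, whose
      summands are all at least \<open>d + 1\<close>.\<close>
    have "2 * f_num X k (faces X) = p * f_num X (int d) (faces X) + ?b
        \<longleftrightarrow> (\<Sum>j<?n. card (ridges_of (Fs ! j))) = (\<Sum>j<?n. d + 1)"
      using f_num_ridges[OF sh thin] fd unfolding k p by (simp add: mult.commute)
    also have "\<dots> \<longleftrightarrow> (\<forall>j<?n. card (ridges_of (Fs ! j)) = d + 1)"
    proof
      assume *: "(\<Sum>j<?n. card (ridges_of (Fs ! j))) = (\<Sum>j<?n. d + 1)"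
      show "\<forall>j<?n. card (ridges_of (Fs ! j)) = d + 1"
      proof (rule ccontr)
        assume "\<not> (\<forall>j<?n. card (ridges_of (Fs ! j)) = d + 1)"
        then obtain j where j: "j < ?n" "card (ridges_of (Fs ! j)) \<noteq> d + 1" by blast
        have "(\<Sum>j<?n. d + 1) < (\<Sum>j<?n. card (ridges_of (Fs ! j)))"
          by (rule sum_strict_mono_ex1) (use ge j le_neq_implies_less[OF ge[OF j(1)]] in auto)
        then show False using * by simp
      qed
    qed simp
    also have "\<dots> \<longleftrightarrow> simplicial X" using simplicial_iff_ridges[OF sh] by simp
    finally show ?thesis using 2 by simp
  next
    case 3
    have early0: "early Fs 0 = {}" by (simp add: early_def)
    have dd: "(d + 2) div 2 + (d + 1) div 2 = d + 1" by presburger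
    \<comment> \<open>Nothing precedes the first facet, so all its \<open>k\<close>-faces are new.
      There are at least \<open>d + 1 choose m\<close> of them, while \<open>p\<close> comes from
      splitting \<open>d + 1\<close> into two positive parts.\<close>
    have "p < d + 1 choose m"
      unfolding p_def using binomial_add_less[of m "(d + 2) div 2" "(d + 1) div 2"] 3 m d dd by simp
    also have "d + 1 choose m \<le> ?new 0"
      using card_faces_off_ge[OF empty_face F(1)[OF n], of "{}" m] F(2)[OF n] face_dim_empty
      unfolding early0 k_def by (simp add: nat_add_distrib)
    finally have "p < ?new 0 + ?late 0" by simp
    then have "(\<Sum>j<?n. p) < (\<Sum>j<?n. ?new j + ?late j)"
      by (intro sum_strict_mono_ex1) (use pj n in auto)
    then have "p * f_num X (int d) (faces X) + ?b < 2 * f_num X k (faces X)" using sum fd by (simp add: mult.commute)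
    then show ?thesis using 3 by simp
  qed
qed

theorem shellable_face_numbers:
  fixes k :: int and d :: nat
  assumes "d \<ge> 1" "shellable d X" "thin d (faces_of_dim X (faces X) (int d))"
    and k: "\<lfloor>(real d - 1) / 2\<rfloor> \<le> k" "k \<le> int d"
  shows
    "real (f_num X k (faces X)) \<ge>
       1/2 * (real (nat \<lceil>(real d + 1) / 2\<rceil> choose nat (int d - k)) +
              real (nat \<lfloor>(real d + 1) / 2\<rfloor> choose nat (int d - k))) * real (f_num X (int d) (faces X))
       + 1/2 * real (f_num X k (boundary_complex X (faces X)))
     \<and>
     (real (f_num X k (faces X)) =
       1/2 * (real (nat \<lceil>(real d + 1) / 2\<rceil> choose nat (int d - k)) +
              real (nat \<lfloor>(real d + 1) / 2\<rfloor> choose nat (int d - k))) * real (f_num X (int d) (faces X))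
       + 1/2 * real (f_num X k (boundary_complex X (faces X)))
      \<longleftrightarrow> k = int d \<or> (k = int d - 1 \<and> simplicial X))"
proof -
  obtain Fs where sh: "shelling d X (faces X) Fs" using assms(2) unfolding shellable_def by blast
  have thin: "thin d (set Fs)" using assms(3) shelling_weak(2)[OF sh] by simp
  define m where "m = nat (int d - k)"
  have km: "k = int d - int m" using k(2) by (simp add: m_def)
  have f1: "\<lfloor>(real d - 1) / 2\<rfloor> = (int d - 1) div 2"
    using floor_divide_of_int_eq[of "int d - 1" 2, where 'a = real] by simp
  have f2: "nat \<lfloor>(real d + 1) / 2\<rfloor> = (d + 1) div 2"
    using floor_divide_of_nat_eq[of "d + 1" 2, where 'a = real] by (simp add: add.commute)
  have f3: "nat \<lceil>(real d + 1) / 2\<rceil> = (d + 2) div 2"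
  proof -
    have "\<lceil>(real d + 1) / 2\<rceil> = - ((- int d - 1) div 2)"
      using ceiling_divide_eq_div[of "int d + 1" 2, where 'a = real] by simp
    also have "\<dots> = (int d + 2) div 2" by presburger
    finally show ?thesis by (simp add: nat_div_distrib nat_add_distrib)
  qed
  have mle: "m \<le> (d + 2) div 2" using k(1) unfolding f1 km by presburger
  let ?p = "((d + 2) div 2 choose m) + ((d + 1) div 2 choose m)"
  let ?n = "f_num X (int d) (faces X)" and ?f = "f_num X k (faces X)" and ?b = "f_num X k (boundary_complex X (faces X))"
  note bound = f_num_bound[OF sh thin assms(1) mle, folded km]
  have eq: "1/2 * (real ((d + 2) div 2 choose m) + real ((d + 1) div 2 choose m)) * real ?n + 1/2 * real ?b
      = real (?p * ?n + ?b) / 2" by (simp add: algebra_simps add_divide_distrib)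
  have f: "real ?f = real (2 * ?f) / 2" by simp
  have "real (?p * ?n + ?b) \<le> real (2 * ?f)" using bound(1) of_nat_le_iff by blast
  moreover have "real (2 * ?f) = real (?p * ?n + ?b) \<longleftrightarrow> m = 0 \<or> m = 1 \<and> simplicial X"
    using bound(2) of_nat_eq_iff by blast
  moreover have "m = 0 \<or> m = 1 \<and> simplicial X \<longleftrightarrow> k = int d \<or> (k = int d - 1 \<and> simplicial X)"
    unfolding km by auto
  moreover have "v / 2 \<le> x \<longleftrightarrow> v \<le> u" "x = v / 2 \<longleftrightarrow> u = v" if "x = u / 2" for x u v :: real
    using that by auto
  ultimately show ?thesis
    unfolding f2 f3 m_def[symmetric] eq using f by blast
qed

end

section \<open>Invariance of domain for spheres and balls\<close>

text \<open>\<open>open_into\<close> and \<open>open_from\<close> are the two halves of invariance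
  of domain, with \<open>Y\<close> as target or as source. A closed ball of positive dimension has
  only the first, which bounds the number of facets at a ridge by two; a sphere has both, which
  makes this number exactly two.\<close>

definition open_into :: "nat \<Rightarrow> 'a topology \<Rightarrow> bool" where
  "open_into n Y \<longleftrightarrow> (\<forall>U f. openin (Euclidean_space n) U \<longrightarrow>
     continuous_map (subtopology (Euclidean_space n) U) Y f \<longrightarrow> inj_on f U \<longrightarrow> openin Y (f ` U))"

definition open_from :: "nat \<Rightarrow> 'a topology \<Rightarrow> bool" where
  "open_from n Y \<longleftrightarrow> (\<forall>W f. openin Y W \<longrightarrow>
     continuous_map (subtopology Y W) (Euclidean_space n) f \<longrightarrow> inj_on f W \<longrightarrow> openin (Euclidean_space n) (f ` W))"

lemma open_into_homeomorphic:
  assumes "Y homeomorphic_space Z" "open_into n Z"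
  shows "open_into n Y"
  unfolding open_into_def
proof (intro allI impI)
  fix U f
  assume U: "openin (Euclidean_space n) U" and f: "continuous_map (subtopology (Euclidean_space n) U) Y f" "inj_on f U"
  obtain g h where gh: "homeomorphic_maps Y Z g h" using assms(1) by (auto simp: homeomorphic_space_def)
  have g: "homeomorphic_map Y Z g" using gh homeomorphic_maps_map by blast
  have UU: "U \<subseteq> topspace (subtopology (Euclidean_space n) U)" using openin_subset[OF U] by auto
  have fU: "f ` U \<subseteq> topspace Y" using continuous_map_image_subset_topspace[OF f(1)] UU by blast
  have "openin Z ((g \<circ> f) ` U)"
  proof -
    have "continuous_map (subtopology (Euclidean_space n) U) Z (g \<circ> f)"
      using continuous_map_compose f(1) homeomorphic_imp_continuous_map[OF g] by blast
    moreover have "inj_on (g \<circ> f) U"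
      by (rule comp_inj_on[OF f(2)]) (use homeomorphic_imp_injective_map[OF g] fU inj_on_subset in blast)
    ultimately show ?thesis using assms(2) U unfolding open_into_def by blast
  qed
  then show "openin Y (f ` U)" using homeomorphic_map_openness[OF g fU] by (simp add: image_comp)
qed

lemma open_from_homeomorphic:
  assumes "Y homeomorphic_space Z" "open_from n Z"
  shows "open_from n Y"
  unfolding open_from_def
proof (intro allI impI)
  fix W f
  assume W: "openin Y W" and f: "continuous_map (subtopology Y W) (Euclidean_space n) f" "inj_on f W"
  obtain g h where gh: "homeomorphic_maps Y Z g h" using assms(1) by (auto simp: homeomorphic_space_def)
  have g: "homeomorphic_map Y Z g" and h: "continuous_map Z Y h" and hg: "\<And>x. x \<in> topspace Y \<Longrightarrow> h (g x) = x"
    using gh homeomorphic_maps_map unfolding homeomorphic_maps_def by blast+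
  have WY: "W \<subseteq> topspace Y" using openin_subset[OF W] .
  have gW: "openin Z (g ` W)" using homeomorphic_map_openness[OF g WY] W by simp
  have hW: "h ` g ` W \<subseteq> W" using hg WY by force
  have "openin (Euclidean_space n) ((f \<circ> h) ` g ` W)"
  proof -
    have "continuous_map (subtopology Z (g ` W)) (subtopology Y W) h"
      using continuous_map_from_subtopology[OF h, of "g ` W"] hW
      by (auto simp: continuous_map_in_subtopology)
    then have "continuous_map (subtopology Z (g ` W)) (Euclidean_space n) (f \<circ> h)"
      using continuous_map_compose f(1) by blast
    moreover have "inj_on (f \<circ> h) (g ` W)"
      using f(2) hg WY by (auto simp: inj_on_def subset_iff)
    ultimately show ?thesis using assms(2) gW unfolding open_from_def by blast
  qed
  moreover have "(f \<circ> h) ` g ` W = f ` W" using hg WY by (force simp: image_iff subset_iff)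
  ultimately show "openin (Euclidean_space n) (f ` W)" by simp
qed

section \<open>Coordinates, cones and invariance of domain on spheres and balls\<close>

lemma Euclidean_space_eu: "Euclidean_space n = top_of_set {x. \<forall>i\<ge>n. x i = 0}"
  by (simp add: Euclidean_space_def euclidean_product_topology)

lemma nsphere_eu: "nsphere n = top_of_set {x. (\<Sum>i\<le>n. x i ^ 2) = 1 \<and> (\<forall>i>n. x i = 0)}"
  by (simp add: nsphere euclidean_product_topology)

lemma nsphere_subtopology: "nsphere n = subtopology (Euclidean_space (Suc n)) (topspace (nsphere n))"
  unfolding nsphere_def topspace_subtopology subtopology_restrict ..

definition truncate :: "nat \<Rightarrow> (nat \<Rightarrow> real) \<Rightarrow> nat \<Rightarrow> real" where
  "truncate n x = (\<lambda>i. if i < n then x i else 0)"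

lemma continuous_on_coordinate [continuous_intros]: "continuous_on S (\<lambda>x::nat \<Rightarrow> real. x i)"
  by (rule continuous_on_subset[OF continuous_on_product_coordinates]) simp

lemma continuous_on_truncate: "continuous_on S (truncate n)"
  unfolding truncate_def
proof (rule continuous_on_coordinatewise_then_product)
  show "continuous_on S (\<lambda>x. if i < n then x i else 0)" for i
    by (cases "i < n") (simp_all add: continuous_on_coordinate)
qed

lemma truncate_Euclidean: "truncate n x \<in> topspace (Euclidean_space n)"
  by (simp add: truncate_def topspace_Euclidean_space)

lemma truncate_eqD: "truncate n x = truncate n y \<Longrightarrow> x n = y n \<Longrightarrow>
    x \<in> topspace (Euclidean_space (Suc n)) \<Longrightarrow> y \<in> topspace (Euclidean_space (Suc n)) \<Longrightarrow> x = y"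
  by (auto simp: truncate_def topspace_Euclidean_space fun_eq_iff)
    (metis less_Suc_eq not_less)

text \<open>Invariance of domain is transferred to the sphere through the cone map \<open>(t, u) \<mapsto> t * u\<close>.\<close>

lemma open_into_nsphere: "open_into n (nsphere n)"
  unfolding open_into_def
proof (intro allI impI)
  fix U and f :: "(nat \<Rightarrow> real) \<Rightarrow> nat \<Rightarrow> real"
  assume U: "openin (Euclidean_space n) U" and f: "continuous_map (subtopology (Euclidean_space n) U) (nsphere n) f"
    and inj: "inj_on f U"
  have UE: "U \<subseteq> topspace (Euclidean_space n)" using U openin_subset by blast
  have fc: "continuous_on U f" and fS: "\<And>x. x \<in> U \<Longrightarrow> f x \<in> topspace (nsphere n)"
    using f UE by (auto simp: Euclidean_space_eu nsphere_eu subtopology_subtopology Int_absorb1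
        continuous_map_subtopology_eu continuous_map_in_subtopology)
  \<comment> \<open>\<open>V\<close> is the cylinder over \<open>U\<close> with positive heights. On
    it \<open>g\<close> is the cone over \<open>f\<close>, with the height turned into the
    norm.\<close>
  define V where "V = {x \<in> topspace (Euclidean_space (Suc n)). truncate n x \<in> U \<and> 0 < x n}"
  define g where "g = (\<lambda>x i. x n * f (truncate n x) i)"
  have contT: "continuous_map (Euclidean_space (Suc n)) (Euclidean_space n) (truncate n)"
    using truncate_Euclidean continuous_on_truncate
    by (auto simp: Euclidean_space_eu continuous_map_in_subtopology)
  have contn: "continuous_map (Euclidean_space (Suc n)) euclideanreal (\<lambda>x. x n)"
    unfolding Euclidean_space_eu by (simp add: continuous_intros)
  have "V = {x \<in> topspace (Euclidean_space (Suc n)). truncate n x \<in> U} \<inter>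
      {x \<in> topspace (Euclidean_space (Suc n)). x n \<in> {0<..}}" by (auto simp: V_def)
  then have V: "openin (Euclidean_space (Suc n)) V"
    using openin_continuous_map_preimage[OF contT U] openin_continuous_map_preimage[OF contn, of "{0<..}"]
    by (simp add: openin_Int)
  have VE: "V \<subseteq> topspace (Euclidean_space (Suc n))" by (auto simp: V_def)
  have gc: "continuous_on V g"
    unfolding g_def
  proof (rule continuous_on_coordinatewise_then_product)
    fix i
    have "continuous_on V (\<lambda>x. f (truncate n x))"
      by (rule continuous_on_compose2[OF fc continuous_on_truncate]) (auto simp: V_def)
    then have "continuous_on V (\<lambda>x. f (truncate n x) i)"
      by (rule continuous_on_product_then_coordinatewise)
    then show "continuous_on V (\<lambda>x. x n * f (truncate n x) i)" by (intro continuous_intros)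
  qed
  have sq: "(\<Sum>i\<le>n. (g x i)\<^sup>2) = (x n)\<^sup>2" if "x \<in> V" for x
  proof -
    have "(\<Sum>i\<le>n. (f (truncate n x) i)\<^sup>2) = 1" using that fS by (auto simp: V_def nsphere_eu)
    then show ?thesis by (simp add: g_def power_mult_distrib flip: sum_distrib_left)
  qed
  have gE: "g x \<in> topspace (Euclidean_space (Suc n))" if "x \<in> V" for x
    using fS[of "truncate n x"] that by (auto simp: g_def V_def nsphere_eu topspace_Euclidean_space)
  have "inj_on g V"
  proof (rule inj_onI)
    fix x y assume xy: "x \<in> V" "y \<in> V" "g x = g y"
    have "(x n)\<^sup>2 = (y n)\<^sup>2" using sq xy by metis
    then have n: "x n = y n" using xy by (auto simp: V_def power2_eq_iff)
    have "f (truncate n x) = f (truncate n y)"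
    proof
      fix i
      have "x n * f (truncate n x) i = y n * f (truncate n y) i" using xy(3) unfolding g_def by metis
      then show "f (truncate n x) i = f (truncate n y) i" using n xy(1) by (simp add: V_def)
    qed
    then have "truncate n x = truncate n y" using inj xy by (auto simp: V_def inj_on_def)
    then show "x = y" using truncate_eqD n xy VE by blast
  qed
  moreover have "continuous_map (subtopology (Euclidean_space (Suc n)) V) (Euclidean_space (Suc n)) g"
    using gc gE VE by (auto simp: Euclidean_space_eu subtopology_subtopology Int_absorb1 continuous_map_in_subtopology)
  ultimately have gV: "openin (Euclidean_space (Suc n)) (g ` V)"
    using invariance_of_domain_Euclidean_space V by blast
  have "f ` U = topspace (nsphere n) \<inter> g ` V"
  proof (intro equalityI subsetI)
    fix y assume "y \<in> f ` U"
    then obtain u where u: "u \<in> U" "y = f u" by blast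
    define x where "x = (\<lambda>i. if i = n then 1 else u i)"
    have "truncate n x = u" using u UE by (auto simp: x_def truncate_def topspace_Euclidean_space fun_eq_iff subset_iff)
    moreover have "x \<in> topspace (Euclidean_space (Suc n))"
      using u UE by (auto simp: x_def topspace_Euclidean_space subset_iff)
    moreover have "x n = 1" by (simp add: x_def)
    ultimately have "x \<in> V" "y = g x" using u by (simp_all add: V_def g_def)
    moreover have "y \<in> topspace (nsphere n)" using fS[OF u(1)] u(2) by simp
    ultimately show "y \<in> topspace (nsphere n) \<inter> g ` V" by (intro IntI image_eqI)
  next
    fix y assume y: "y \<in> topspace (nsphere n) \<inter> g ` V"
    then obtain x where x: "x \<in> V" "y = g x" by blast
    have "(x n)\<^sup>2 = 1" using sq[OF x(1)] y x(2) by (auto simp: nsphere_eu)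
    then have "x n = 1" using x(1) by (auto simp: V_def power2_eq_1_iff)
    then have "y = f (truncate n x)" using x by (simp add: g_def)
    then show "y \<in> f ` U" using x by (auto simp: V_def)
  qed
  then show "openin (nsphere n) (f ` U)"
    using gV by (subst nsphere_subtopology) (auto simp: openin_subtopology)
qed

text \<open>The inverse construction: on the open cone \<open>V\<close> over \<open>W\<close>,
  \<open>g\<close> applies \<open>f\<close> to the direction \<open>s x\<close> and records the norm
  \<open>r x\<close> as the extra coordinate. Slicing the open image at height 1 recovers the image
  of \<open>W\<close>.\<close>

lemma open_from_nsphere: "open_from n (nsphere n)"
  unfolding open_from_def
proof (intro allI impI)
  fix W and f :: "(nat \<Rightarrow> real) \<Rightarrow> nat \<Rightarrow> real"
  assume W: "openin (nsphere n) W" and f: "continuous_map (subtopology (nsphere n) W) (Euclidean_space n) f"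
    and inj: "inj_on f W"
  have WS: "W \<subseteq> topspace (nsphere n)" using W openin_subset by blast
  have fc: "continuous_on W f" and fE: "\<And>x. x \<in> W \<Longrightarrow> f x \<in> topspace (Euclidean_space n)"
    using f WS by (auto simp: Euclidean_space_eu nsphere_eu subtopology_subtopology Int_absorb1
        continuous_map_in_subtopology)
  define r where "r = (\<lambda>x::nat \<Rightarrow> real. sqrt (\<Sum>i\<le>n. (x i)\<^sup>2))"
  define s where "s = (\<lambda>x i. x i / r x)"
  define N where "N = {x \<in> topspace (Euclidean_space (Suc n)). 0 < r x}"
  define V where "V = {x \<in> N. s x \<in> W}"
  define g where "g = (\<lambda>x i. if i = n then r x else f (s x) i)"
  have rc: "continuous_on S r" for S unfolding r_def by (intro continuous_intros)
  have sc: "continuous_on N s"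
    unfolding s_def
    by (rule continuous_on_coordinatewise_then_product) (intro continuous_intros rc, auto simp: N_def)
  have sS: "s x \<in> topspace (nsphere n)" if "x \<in> N" for x
  proof -
    have "(\<Sum>i\<le>n. (s x i)\<^sup>2) = (\<Sum>i\<le>n. (x i)\<^sup>2) / (r x)\<^sup>2"
      by (simp add: s_def power_divide sum_divide_distrib)
    also have "(r x)\<^sup>2 = (\<Sum>i\<le>n. (x i)\<^sup>2)" by (simp add: r_def sum_nonneg)
    also have "(\<Sum>i\<le>n. (x i)\<^sup>2) / \<dots> = 1" using that by (auto simp: N_def r_def)
    finally show ?thesis using that by (auto simp: nsphere_eu N_def s_def topspace_Euclidean_space)
  qed
  have Nopen: "openin (Euclidean_space (Suc n)) N"
  proof -
    have "continuous_map (Euclidean_space (Suc n)) euclideanreal r"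
      using rc by (simp add: Euclidean_space_eu)
    from openin_continuous_map_preimage[OF this, of "{0<..}"] show ?thesis by (simp add: N_def)
  qed
  have NE: "N \<subseteq> topspace (Euclidean_space (Suc n))" by (auto simp: N_def)
  have "continuous_map (subtopology (Euclidean_space (Suc n)) N) (nsphere n) s"
    using sc sS NE by (auto simp: Euclidean_space_eu nsphere_eu subtopology_subtopology Int_absorb1 continuous_map_in_subtopology)
  from openin_continuous_map_preimage[OF this W]
  have "openin (subtopology (Euclidean_space (Suc n)) N) V" using NE by (simp add: V_def Int_absorb1)
  then have V: "openin (Euclidean_space (Suc n)) V" using Nopen openin_trans_full by blast
  have VE: "V \<subseteq> topspace (Euclidean_space (Suc n))" using V openin_subset by blast
  have gc: "continuous_on V g"
    unfolding g_def
  proof (rule continuous_on_coordinatewise_then_product)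
    fix i
    have "continuous_on V (\<lambda>x. f (s x))"
      by (rule continuous_on_compose2[OF fc continuous_on_subset[OF sc]]) (auto simp: V_def)
    then have "continuous_on V (\<lambda>x. f (s x) i)" by (rule continuous_on_product_then_coordinatewise)
    then show "continuous_on V (\<lambda>x. if i = n then r x else f (s x) i)" using rc by (cases "i = n") auto
  qed
  have gE: "g x \<in> topspace (Euclidean_space (Suc n))" if "x \<in> V" for x
    using fE[of "s x"] that by (auto simp: g_def V_def topspace_Euclidean_space)
  have gt: "truncate n (g x) = f (s x)" if "x \<in> V" for x
    using fE[of "s x"] that by (auto simp: g_def V_def topspace_Euclidean_space truncate_def fun_eq_iff)
  have "inj_on g V"
  proof (rule inj_onI)
    fix x y assume xy: "x \<in> V" "y \<in> V" "g x = g y"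
    have r: "r x = r y" using fun_cong[OF xy(3), of n] by (simp add: g_def)
    have "f (s x) = f (s y)" using gt xy by metis
    then have "s x = s y" using inj xy by (auto simp: V_def inj_on_def)
    then have "x i / r x = y i / r x" for i using r unfolding s_def by (metis)
    then show "x = y" using xy(1) by (auto simp: V_def N_def)
  qed
  moreover have "continuous_map (subtopology (Euclidean_space (Suc n)) V) (Euclidean_space (Suc n)) g"
    using gc gE VE by (auto simp: Euclidean_space_eu subtopology_subtopology Int_absorb1 continuous_map_in_subtopology)
  ultimately have gV: "openin (Euclidean_space (Suc n)) (g ` V)"
    using invariance_of_domain_Euclidean_space V by blast
  define l where "l = (\<lambda>y::nat \<Rightarrow> real. \<lambda>i. if i = n then 1 else y i)"
  have lc: "continuous_map (Euclidean_space n) (Euclidean_space (Suc n)) l"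
  proof -
    have "continuous_on S l" for S
      unfolding l_def
    proof (rule continuous_on_coordinatewise_then_product)
      show "continuous_on S (\<lambda>x. if i = n then 1 else x i)" for i
        by (cases "i = n") (simp_all add: continuous_on_coordinate)
    qed
    then show ?thesis by (auto simp: Euclidean_space_eu continuous_map_in_subtopology l_def)
  qed
  have "f ` W = {y \<in> topspace (Euclidean_space n). l y \<in> g ` V}"
  proof (intro equalityI subsetI)
    fix y assume "y \<in> f ` W"
    then obtain w where w: "w \<in> W" "y = f w" by blast
    have wS: "(\<Sum>i\<le>n. (w i)\<^sup>2) = 1" "\<forall>i>n. w i = 0" using w WS by (auto simp: nsphere_eu)
    then have "r w = 1" by (simp add: r_def)
    moreover then have "s w = w" by (simp add: s_def)
    ultimately have "w \<in> V" "g w = l y" using w wS fE[OF w(1)]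
      by (auto simp: V_def N_def g_def l_def topspace_Euclidean_space)
    then show "y \<in> {y \<in> topspace (Euclidean_space n). l y \<in> g ` V}" using fE w by (metis (mono_tags, lifting) image_eqI mem_Collect_eq)
  next
    fix y assume y: "y \<in> {y \<in> topspace (Euclidean_space n). l y \<in> g ` V}"
    then obtain x where x: "x \<in> V" "l y = g x" by blast
    have "truncate n (l y) = y" using y by (auto simp: l_def truncate_def topspace_Euclidean_space fun_eq_iff)
    then have "y = f (s x)" using gt x by metis
    then show "y \<in> f ` W" using x by (auto simp: V_def)
  qed
  then show "openin (Euclidean_space n) (f ` W)" using openin_continuous_map_preimage[OF lc gV] by simp
qed

lemma unit_ball_subtopology: "unit_ball n = subtopology (Euclidean_space n) (topspace (unit_ball n))"
  unfolding unit_ball_def topspace_subtopology subtopology_restrict ..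

lemma open_into_unit_ball: "open_into n (unit_ball n)"
  unfolding open_into_def
proof (intro allI impI)
  fix U and f :: "(nat \<Rightarrow> real) \<Rightarrow> nat \<Rightarrow> real"
  assume U: "openin (Euclidean_space n) U" and f: "continuous_map (subtopology (Euclidean_space n) U) (unit_ball n) f"
    and inj: "inj_on f U"
  have "continuous_map (subtopology (Euclidean_space n) U) (Euclidean_space n) f"
    using f unfolding unit_ball_def by (simp add: continuous_map_in_subtopology)
  then have o: "openin (Euclidean_space n) (f ` U)" using invariance_of_domain_Euclidean_space U inj by blast
  have "f ` U \<subseteq> topspace (unit_ball n)"
    using continuous_map_image_subset_topspace[OF f] openin_subset[OF U] by (simp add: Int_absorb1)
  then show "openin (unit_ball n) (f ` U)"
    using o by (subst unit_ball_subtopology) (auto simp: openin_subtopology)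
qed

section \<open>The face lattice of a strongly regular CW complex\<close>

lemma topspace_unit_ball: "topspace (unit_ball n) = {x. (\<forall>i\<ge>n. x i = 0) \<and> (\<Sum>i<n. (x i)\<^sup>2) \<le> 1}"
  by (auto simp: unit_ball_def topspace_Euclidean_space)

lemma topspace_open_unit_ball: "topspace (open_unit_ball n) = {x. (\<forall>i\<ge>n. x i = 0) \<and> (\<Sum>i<n. (x i)\<^sup>2) < 1}"
  by (auto simp: open_unit_ball_def topspace_Euclidean_space)

lemma topspace_ball_boundary: "topspace (ball_boundary n) = {x. (\<forall>i\<ge>n. x i = 0) \<and> (\<Sum>i<n. (x i)\<^sup>2) = 1}"
  by (auto simp: ball_boundary_def topspace_Euclidean_space)

lemma unit_ball_eu: "unit_ball n = top_of_set (topspace (unit_ball n))"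
  by (subst unit_ball_subtopology)
     (auto simp: Euclidean_space_eu topspace_unit_ball subtopology_subtopology intro!: arg_cong[where f = top_of_set])

lemma topspace_unit_ball_split:
  "topspace (unit_ball n) = topspace (open_unit_ball n) \<union> topspace (ball_boundary n)"
  by (auto simp: topspace_unit_ball topspace_open_unit_ball topspace_ball_boundary)

lemma ball_boundary_Suc: "ball_boundary (Suc n) = nsphere n"
  by (simp add: ball_boundary_def nsphere_def lessThan_Suc_atMost)

lemma compact_space_unit_ball: "compact_space (unit_ball n)"
proof -
  have 1: "compact (PiE UNIV (\<lambda>_::nat. {-1..1::real}))"
    using compactin_PiE[of "\<lambda>_. euclideanreal" UNIV "\<lambda>_::nat. {-1..1::real}"]
    by (simp add: euclidean_product_topology)
  have "closed {x::nat \<Rightarrow> real. x i = 0}" for i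
    using closed_Collect_eq[OF continuous_on_coordinate[of UNIV i] continuous_on_const[of UNIV 0]] by simp
  then have "closed (\<Inter>i\<in>{n..}. {x::nat \<Rightarrow> real. x i = 0})" by (intro closed_INT) auto
  moreover have "closed {x::nat \<Rightarrow> real. (\<Sum>i<n. (x i)\<^sup>2) \<le> 1}"
    by (intro closed_Collect_le continuous_intros)
  ultimately have "closed ((\<Inter>i\<in>{n..}. {x::nat \<Rightarrow> real. x i = 0}) \<inter> {x. (\<Sum>i<n. (x i)\<^sup>2) \<le> 1})"
    by (rule closed_Int)
  moreover have "(\<Inter>i\<in>{n..}. {x::nat \<Rightarrow> real. x i = 0}) \<inter> {x. (\<Sum>i<n. (x i)\<^sup>2) \<le> 1} = topspace (unit_ball n)"
    by (auto simp: topspace_unit_ball)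
  ultimately have 2: "closed (topspace (unit_ball n))" by simp
  have 3: "topspace (unit_ball n) \<subseteq> PiE UNIV (\<lambda>_. {-1..1})"
  proof
    fix x assume x: "x \<in> topspace (unit_ball n)"
    have "\<bar>x i\<bar> \<le> 1" for i
    proof (cases "i < n")
      case True
      have "(x i)\<^sup>2 \<le> (\<Sum>i<n. (x i)\<^sup>2)" by (rule member_le_sum) (use True in auto)
      also have "\<dots> \<le> 1" using x by (simp add: topspace_unit_ball)
      finally show ?thesis by (simp add: abs_square_le_1)
    qed (use x in \<open>simp add: topspace_unit_ball\<close>)
    then show "x \<in> PiE UNIV (\<lambda>_. {-1..1})" by (auto simp: PiE_iff abs_le_iff minus_le_iff)
  qed
  have "compact (topspace (unit_ball n))"
    using compact_Int_closed[OF 1 2] 3 by (simp add: Int_absorb1)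
  then show ?thesis by (metis compact_space_subtopology compactin_euclidean_iff unit_ball_eu)
qed

text \<open>A line in the direction of coordinate \<open>m\<close> leaves \<open>S\<close> at once,
  whereas the parameters at which it meets an open set form an open set of reals.\<close>

lemma open_subset_low_dim:
  assumes "openin (Euclidean_space n) S" "S \<subseteq> topspace (Euclidean_space m)" "m < n"
  shows "S = {}"
proof (rule ccontr)
  assume "S \<noteq> {}"
  then obtain x where x: "x \<in> S" by blast
  then have xm: "x \<in> topspace (Euclidean_space m)" using assms(2) by blast
  define p where "p = (\<lambda>(t::real) i. if i = m then t else x i)"
  have "continuous_on S' p" for S'
    unfolding p_def
  proof (rule continuous_on_coordinatewise_then_product)
    show "continuous_on S' (\<lambda>t. if i = m then t else x i)" for i by (cases "i = m") simp_all
  qed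
  then have "continuous_map euclideanreal (Euclidean_space n) p"
    using xm assms(3) by (auto simp: Euclidean_space_eu continuous_map_in_subtopology p_def)
  from openin_continuous_map_preimage[OF this assms(1)] have "open {t. p t \<in> S}" by simp
  moreover have "{t. p t \<in> S} = {0}"
  proof -
    have "p 0 = x" using xm by (auto simp: p_def topspace_Euclidean_space fun_eq_iff)
    moreover have "t = 0" if "p t \<in> S" for t
    proof -
      have "p t m = 0" using that assms(2) by (auto simp: topspace_Euclidean_space subset_iff)
      then show ?thesis by (simp add: p_def)
    qed
    ultimately show ?thesis using x by auto
  qed
  ultimately show False using not_open_singleton[of "0::real"] by simp
qed

lemma continuous_on_ray: "continuous_on S (\<lambda>t i. t * p i :: real)"
  by (rule continuous_on_coordinatewise_then_product) (intro continuous_intros)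

lemma sum_sq_scale: "(\<Sum>i<n. (t * x i)\<^sup>2) = t\<^sup>2 * (\<Sum>i<n. (x i :: real)\<^sup>2)"
  by (simp add: power_mult_distrib sum_distrib_left)

text \<open>An open set around a boundary point contains points of the ray through it just beyond
  the ball.\<close>

lemma open_subset_unit_ball:
  assumes "openin (Euclidean_space n) S" "S \<subseteq> topspace (unit_ball n)"
  shows "S \<inter> topspace (ball_boundary n) = {}"
proof (rule ccontr)
  assume "S \<inter> topspace (ball_boundary n) \<noteq> {}"
  then obtain p where p: "p \<in> S" "\<forall>i\<ge>n. p i = 0" "(\<Sum>i<n. (p i)\<^sup>2) = 1"
    by (auto simp: topspace_ball_boundary)
  define q where "q = (\<lambda>(t::real) i. t * p i)"
  have "continuous_map euclideanreal (Euclidean_space n) q"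
    using p(2) continuous_on_ray[of UNIV p] by (auto simp: Euclidean_space_eu continuous_map_in_subtopology q_def)
  from openin_continuous_map_preimage[OF this assms(1)] have "open {t. q t \<in> S}" by simp
  moreover have "1 \<in> {t. q t \<in> S}" using p(1) by (simp add: q_def)
  ultimately obtain e where e: "e > 0" "ball 1 e \<subseteq> {t. q t \<in> S}" by (meson open_contains_ball)
  have "q (1 + e/2) \<in> S" using e by (auto simp: subset_iff dist_real_def)
  then have "(\<Sum>i<n. (q (1 + e/2) i)\<^sup>2) \<le> 1" using assms(2) by (auto simp: topspace_unit_ball)
  then have "(1 + e/2)\<^sup>2 \<le> 1" using p(3) unfolding q_def sum_sq_scale by simp
  moreover have "1 < (1 + e/2)\<^sup>2" using e(1) by (intro one_less_power) auto
  ultimately show False by simp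
qed

section \<open>Cells and faces of a strongly regular complex\<close>

locale strong_cw =
  fixes X :: "('i, 'a) cw"
  assumes strongly_regular: "strongly_regular_cw X"
begin

abbreviation "T \<equiv> cw_space X"
abbreviation "J \<equiv> cw_cells X"
abbreviation "dm \<equiv> cw_dim X"
abbreviation "bd_cell i \<equiv> cw_map X i ` topspace (ball_boundary (dm i))"

lemma regular: "regular_cw X"
  using strongly_regular by (simp add: strongly_regular_cw_def)

lemma complex: "cw_complex X"
  using regular by (simp add: regular_cw_def)

lemma Hausdorff: "Hausdorff_space T" and finite_cells: "finite J"
  using complex by (auto simp: cw_complex_def)

lemma cell_map:
  assumes "i \<in> J"
  shows "continuous_map (unit_ball (dm i)) T (cw_map X i)"
    and "embedding_map (open_unit_ball (dm i)) T (cw_map X i)"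
    and "bd_cell i \<subseteq> skeleton_below X (dm i)"
    and "embedding_map (ball_boundary (dm i)) T (cw_map X i)"
  using complex regular assms by (auto simp: cw_complex_def regular_cw_def)

lemma open_cell_unique: "i \<in> J \<Longrightarrow> j \<in> J \<Longrightarrow> x \<in> open_cell X i \<Longrightarrow> x \<in> open_cell X j \<Longrightarrow> i = j"
  using complex unfolding cw_complex_def disjnt_def by blast

lemma cells_cover: "(\<Union>i\<in>J. open_cell X i) = topspace T"
  using complex by (simp add: cw_complex_def)

lemma skeleton_belowE:
  assumes "x \<in> skeleton_below X n"
  obtains j where "j \<in> J" "dm j < n" "x \<in> open_cell X j"
  using assms unfolding skeleton_below_def by blast

lemma closed_cell_split: "closed_cell X i = open_cell X i \<union> bd_cell i"
  by (simp add: closed_cell_def open_cell_def topspace_unit_ball_split image_Un)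

lemma open_subset_closed_cell: "open_cell X i \<subseteq> closed_cell X i"
  by (simp add: closed_cell_split)

lemma open_bd_disjoint:
  assumes "i \<in> J"
  shows "open_cell X i \<inter> bd_cell i = {}"
proof -
  have False if "x \<in> open_cell X i" "x \<in> bd_cell i" for x
  proof -
    obtain j where "j \<in> J" "dm j < dm i" "x \<in> open_cell X j"
      using cell_map(3)[OF assms] \<open>x \<in> bd_cell i\<close> skeleton_belowE by blast
    then show False using open_cell_unique[OF assms _ \<open>x \<in> open_cell X i\<close>] by blast
  qed
  then show ?thesis by blast
qed

text \<open>Regularity gives injectivity on the open ball and on its boundary separately; the two
  images are disjoint because the boundary lands in cells of lower dimension.\<close>

lemma cell_map_inj:
  assumes "i \<in> J"
  shows "inj_on (cw_map X i) (topspace (unit_ball (dm i)))"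
proof -
  have 1: "inj_on (cw_map X i) (topspace (open_unit_ball (dm i)))"
    using cell_map(2)[OF assms] homeomorphic_imp_injective_map unfolding embedding_map_def by blast
  have 2: "inj_on (cw_map X i) (topspace (ball_boundary (dm i)))"
    using cell_map(4)[OF assms] homeomorphic_imp_injective_map unfolding embedding_map_def by blast
  show ?thesis
    unfolding topspace_unit_ball_split inj_on_Un
    using 1 2 open_bd_disjoint[OF assms] unfolding open_cell_def by blast
qed

lemma cell_map_homeo:
  assumes "i \<in> J"
  shows "homeomorphic_map (unit_ball (dm i)) (subtopology T (closed_cell X i)) (cw_map X i)"
  using continuous_imp_embedding_map[OF cell_map(1)[OF assms] compact_space_unit_ball Hausdorff cell_map_inj[OF assms]]
  unfolding embedding_map_def closed_cell_def .

lemma closed_cell_subset: "i \<in> J \<Longrightarrow> closed_cell X i \<subseteq> topspace T"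
  using continuous_map_image_subset_topspace[OF cell_map(1)] unfolding closed_cell_def by blast

lemma closedin_closed_cell:
  assumes "i \<in> J"
  shows "closedin T (closed_cell X i)"
proof -
  have "compactin (unit_ball (dm i)) (topspace (unit_ball (dm i)))"
    using compact_space_unit_ball by (simp add: compact_space_def)
  then have "compactin T (closed_cell X i)"
    unfolding closed_cell_def using cell_map(1)[OF assms] image_compactin by blast
  then show ?thesis using compactin_imp_closedin[OF Hausdorff] by blast
qed

lemma zero_open_unit_ball: "(\<lambda>_. 0) \<in> topspace (open_unit_ball n)"
  by (simp add: topspace_open_unit_ball)

lemma open_cell_nonempty: "open_cell X i \<noteq> {}"
  using zero_open_unit_ball unfolding open_cell_def by blast

lemma closed_cell_nonempty: "closed_cell X i \<noteq> {}"
  using open_cell_nonempty open_subset_closed_cell by blast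

lemma closed_cell_pointE:
  assumes "i \<in> J" "x \<in> closed_cell X i"
  obtains j where "j \<in> J" "x \<in> open_cell X j" "j = i \<or> dm j < dm i"
  using assms cell_map(3)[OF assms(1)] skeleton_belowE unfolding closed_cell_split by blast

lemma closed_cell_subset_dim:
  assumes "i \<in> J" "j \<in> J" "closed_cell X i \<subseteq> closed_cell X j"
  shows "i = j \<or> dm i < dm j"
proof -
  obtain x where x: "x \<in> open_cell X i" using open_cell_nonempty by blast
  then have "x \<in> closed_cell X j" using assms(3) open_subset_closed_cell by blast
  then obtain l where "l \<in> J" "x \<in> open_cell X l" "l = j \<or> dm l < dm j" using closed_cell_pointE assms(2) by metis
  then show ?thesis using open_cell_unique[OF assms(1) _ x] by blast
qed

text \<open>In a regular complex every closed cell is a subcomplex; here strong regularity gives this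
  directly.\<close>

lemma closed_cell_subcomplex:
  assumes "i \<in> J" "j \<in> J" "x \<in> open_cell X j" "x \<in> closed_cell X i"
  shows "closed_cell X j \<subseteq> closed_cell X i"
proof -
  have "closed_cell X i \<inter> closed_cell X j \<in> faces X"
    using strongly_regular assms(1,2) unfolding strongly_regular_cw_def faces_def by blast
  moreover have xij: "x \<in> closed_cell X i \<inter> closed_cell X j"
    using assms open_subset_closed_cell by blast
  ultimately obtain l where l: "l \<in> J" "closed_cell X i \<inter> closed_cell X j = closed_cell X l"
    unfolding faces_def by blast
  \<comment> \<open>The open cell containing \<open>x\<close> is that of \<open>j\<close> and has
    dimension at most that of \<open>l\<close>, while \<open>l\<close> is a face of
    \<open>j\<close>; so \<open>l\<close> is \<open>j\<close>.\<close>
  obtain l' where l': "l' \<in> J" "x \<in> open_cell X l'" "l' = l \<or> dm l' < dm l"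
    using closed_cell_pointE[OF l(1)] xij l(2) by metis
  have "l' = j" using open_cell_unique[OF l'(1) assms(2) l'(2) assms(3)] .
  moreover have "l = j \<or> dm l < dm j" using closed_cell_subset_dim[OF l(1) assms(2)] l(2) by blast
  ultimately have "l = j" using l'(3) by auto
  then show ?thesis using l(2) by blast
qed

lemma closed_cell_inj:
  assumes "i \<in> J" "j \<in> J" "closed_cell X i = closed_cell X j"
  shows "i = j"
  using closed_cell_subset_dim[OF assms(1,2)] closed_cell_subset_dim[OF assms(2,1)] assms(3) by auto

lemma face_dim_closed_cell:
  assumes "i \<in> J"
  shows "face_dim X (closed_cell X i) = int (dm i)"
proof -
  have "(THE j. j \<in> J \<and> closed_cell X j = closed_cell X i) = i"
    using assms closed_cell_inj by (intro the_equality) blast+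
  then show ?thesis using closed_cell_nonempty by (simp add: face_dim_def)
qed

lemma faces_cases:
  assumes "G \<in> faces X"
  obtains "G = {}" | i where "i \<in> J" "G = closed_cell X i"
  using assms unfolding faces_def by blast

lemma closed_cell_face: "i \<in> J \<Longrightarrow> closed_cell X i \<in> faces X"
  by (simp add: faces_def)

text \<open>A subcomplex, given by its index set \<open>K\<close> and its point set
  \<open>B\<close>. The whole complex and the boundary of a cell are both of this form, so the local
  arguments cover both.\<close>

definition cell_cover :: "'i set \<Rightarrow> 'a set \<Rightarrow> bool" where
  "cell_cover K B \<longleftrightarrow> K \<subseteq> J \<and> B = (\<Union>i\<in>K. open_cell X i) \<and> (\<forall>i\<in>K. closed_cell X i \<subseteq> B)"

text \<open>What remains after deleting the finitely many closed cells outside \<open>L\<close> is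
  open; by assumption these do not touch the open cells of \<open>L\<close>.\<close>

lemma cell_cover_openin:
  assumes "cell_cover K B" "L \<subseteq> K"
    and L: "\<And>i j x. j \<in> K - L \<Longrightarrow> i \<in> L \<Longrightarrow> x \<in> open_cell X i \<Longrightarrow> x \<notin> closed_cell X j"
  shows "openin (subtopology T B) (\<Union>i\<in>L. open_cell X i)"
proof -
  have K: "K \<subseteq> J" "B = (\<Union>i\<in>K. open_cell X i)" "\<And>i. i \<in> K \<Longrightarrow> closed_cell X i \<subseteq> B"
    using assms(1) by (auto simp: cell_cover_def)
  have BT: "B \<subseteq> topspace T" using K closed_cell_subset open_subset_closed_cell by blast
  have "closedin T (\<Union>j\<in>K - L. closed_cell X j)"
  proof (rule closedin_Union)
    have "finite K" using K(1) finite_cells by (rule finite_subset)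
    then show "finite (closed_cell X ` (K - L))" by simp
  qed (use K(1) closedin_closed_cell in blast)
  then have "openin T (topspace T - (\<Union>j\<in>K - L. closed_cell X j))" by blast
  moreover have "B - (\<Union>j\<in>K - L. closed_cell X j) = (topspace T - (\<Union>j\<in>K - L. closed_cell X j)) \<inter> B"
    using BT by blast
  ultimately have "openin (subtopology T B) (B - (\<Union>j\<in>K - L. closed_cell X j))"
    unfolding openin_subtopology by blast
  moreover have "B - (\<Union>j\<in>K - L. closed_cell X j) = (\<Union>i\<in>L. open_cell X i)"
  proof (intro equalityI subsetI)
    fix x assume x: "x \<in> B - (\<Union>j\<in>K - L. closed_cell X j)"
    then obtain i where "i \<in> K" "x \<in> open_cell X i" using K(2) by blast
    then show "x \<in> (\<Union>i\<in>L. open_cell X i)" using x open_subset_closed_cell by blast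
  next
    fix x assume "x \<in> (\<Union>i\<in>L. open_cell X i)"
    then show "x \<in> B - (\<Union>j\<in>K - L. closed_cell X j)" using L K(2) assms(2) by blast
  qed
  ultimately show ?thesis by simp
qed

end

lemma unit_ball_subset_Euclidean: "m \<le> n \<Longrightarrow> topspace (unit_ball m) \<subseteq> topspace (Euclidean_space n)"
  by (auto simp: topspace_unit_ball topspace_Euclidean_space)

lemma continuous_map_unit_ball_Euclidean:
  assumes "continuous_map Y (unit_ball m) f" "m \<le> n"
  shows "continuous_map Y (Euclidean_space n) f"
proof -
  have "continuous_map Y (top_of_set (topspace (unit_ball m))) f" using assms(1) unit_ball_eu by metis
  then show ?thesis
    using unit_ball_subset_Euclidean[OF assms(2)] unfolding Euclidean_space_eu continuous_map_in_subtopology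
    by (auto simp: topspace_Euclidean_space Pi_iff subset_iff)
qed

lemma continuous_map_into_unit_ball:
  assumes "continuous_on S f" "f \<in> S \<rightarrow> topspace (unit_ball n)"
  shows "continuous_map (top_of_set S) (unit_ball n) f"
  using assms by (subst unit_ball_eu) (simp add: continuous_map_in_subtopology)

lemma open_unit_ball_eu: "open_unit_ball n = top_of_set (topspace (open_unit_ball n))"
  by (simp add: open_unit_ball_def Euclidean_space_eu subtopology_subtopology)

section \<open>Local structure of a manifold tiled by cells\<close>

context strong_cw
begin

definition cell_inv :: "'i \<Rightarrow> 'a \<Rightarrow> nat \<Rightarrow> real" where
  "cell_inv i = inv_into (topspace (unit_ball (dm i))) (cw_map X i)"

lemma cell_inv:
  assumes "i \<in> J"
  shows "continuous_map (subtopology T (closed_cell X i)) (unit_ball (dm i)) (cell_inv i)"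
    and "u \<in> topspace (unit_ball (dm i)) \<Longrightarrow> cell_inv i (cw_map X i u) = u"
    and "x \<in> closed_cell X i \<Longrightarrow> cw_map X i (cell_inv i x) = x"
    and "x \<in> closed_cell X i \<Longrightarrow> cell_inv i x \<in> topspace (unit_ball (dm i))"
proof -
  show inv: "u \<in> topspace (unit_ball (dm i)) \<Longrightarrow> cell_inv i (cw_map X i u) = u" for u
    unfolding cell_inv_def by (rule inv_into_f_f[OF cell_map_inj[OF assms]])
  show "x \<in> closed_cell X i \<Longrightarrow> cw_map X i (cell_inv i x) = x" for x
    unfolding cell_inv_def closed_cell_def by (rule f_inv_into_f[of x "cw_map X i"])
  show "x \<in> closed_cell X i \<Longrightarrow> cell_inv i x \<in> topspace (unit_ball (dm i))" for x
    unfolding cell_inv_def closed_cell_def by (rule inv_into_into)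
  obtain g where g: "homeomorphic_maps (unit_ball (dm i)) (subtopology T (closed_cell X i)) (cw_map X i) g"
    using cell_map_homeo[OF assms] homeomorphic_map_maps by blast
  then have gc: "continuous_map (subtopology T (closed_cell X i)) (unit_ball (dm i)) g"
    and gi: "\<And>u. u \<in> topspace (unit_ball (dm i)) \<Longrightarrow> g (cw_map X i u) = u"
    by (auto simp: homeomorphic_maps_def)
  have "g x = cell_inv i x" if "x \<in> topspace (subtopology T (closed_cell X i))" for x
  proof -
    have "x \<in> closed_cell X i" using that by simp
    then obtain u where "u \<in> topspace (unit_ball (dm i))" "x = cw_map X i u"
      unfolding closed_cell_def by blast
    then show ?thesis using gi inv by simp
  qed
  then show "continuous_map (subtopology T (closed_cell X i)) (unit_ball (dm i)) (cell_inv i)"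
    using continuous_map_eq[OF gc] by blast
qed

lemma cell_inv_inj: "i \<in> J \<Longrightarrow> inj_on (cell_inv i) (closed_cell X i)"
  by (metis cell_inv(3) inj_onI)

lemma cell_inv_Euclidean:
  assumes "i \<in> J" "dm i \<le> n" "W \<subseteq> closed_cell X i"
  shows "continuous_map (subtopology T W) (Euclidean_space n) (cell_inv i)"
  using continuous_map_from_subtopology_mono[OF continuous_map_unit_ball_Euclidean[OF cell_inv(1)[OF assms(1)] assms(2)] assms(3)] .

lemma cell_inv_boundary:
  assumes "h \<in> J" "x \<in> closed_cell X h" "x \<notin> open_cell X h"
  shows "cell_inv h x \<in> topspace (ball_boundary (dm h))"
proof (rule ccontr)
  assume "cell_inv h x \<notin> topspace (ball_boundary (dm h))"
  then have "cell_inv h x \<in> topspace (open_unit_ball (dm h))"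
    using cell_inv(4)[OF assms(1,2)] by (simp add: topspace_unit_ball_split)
  then show False using cell_inv(3)[OF assms(1,2)] assms(3) unfolding open_cell_def by force
qed

text \<open>The open cell of a maximal cell is open in \<open>B\<close>, so \<open>cell_inv\<close>
  would map it onto an open set of \<open>Euclidean_space n\<close>; inside a proper coordinate
  subspace this is impossible.\<close>

lemma maximal_cell_dim:
  assumes K: "cell_cover K B" and Y: "open_from n (subtopology T B)" and dim: "dm i \<le> n" and i: "i \<in> K"
    and max: "\<And>j. j \<in> K \<Longrightarrow> closed_cell X i \<subseteq> closed_cell X j \<Longrightarrow> j = i"
  shows "dm i = n"
proof (rule ccontr)
  assume "dm i \<noteq> n"
  then have lt: "dm i < n" using dim by simp
  have iJ: "i \<in> J" and B: "closed_cell X i \<subseteq> B" and KJ: "K \<subseteq> J" using K i by (auto simp: cell_cover_def)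
  let ?W = "open_cell X i"
  have "openin (subtopology T B) (\<Union>i\<in>{i}. open_cell X i)"
  proof (rule cell_cover_openin[OF K])
    fix l j x assume "j \<in> K - {i}" "l \<in> {i}" "x \<in> open_cell X l"
    then show "x \<notin> closed_cell X j" using max[of j] closed_cell_subcomplex[of j i x] iJ KJ by blast
  qed (use i in simp)
  then have W: "openin (subtopology T B) ?W" by simp
  have "subtopology (subtopology T B) ?W = subtopology T ?W"
    using B open_subset_closed_cell[of i] by (simp add: subtopology_subtopology Int_absorb1 order_trans[of _ "closed_cell X i"])
  then have "continuous_map (subtopology (subtopology T B) ?W) (Euclidean_space n) (cell_inv i)"
    using cell_inv_Euclidean[OF iJ dim open_subset_closed_cell] by simp
  moreover have "inj_on (cell_inv i) ?W" using cell_inv_inj[OF iJ] open_subset_closed_cell inj_on_subset by blast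
  ultimately have "openin (Euclidean_space n) (cell_inv i ` ?W)" using Y W unfolding open_from_def by blast
  moreover have "cell_inv i ` ?W \<subseteq> topspace (Euclidean_space (dm i))"
    using cell_inv(4)[OF iJ] open_subset_closed_cell unit_ball_subset_Euclidean[of "dm i" "dm i"] by blast
  ultimately have "cell_inv i ` ?W = {}" using open_subset_low_dim lt by blast
  then show False using open_cell_nonempty by simp
qed

text \<open>A page is an \<open>(m + 1)\<close>-cell containing the spine \<open>g\<close>. If
  \<open>h\<close> were the only page, its open cell and that of \<open>g\<close> would together be
  open in \<open>B\<close>, and the chart of \<open>h\<close> would produce an open set of Euclidean
  space that lies in the unit ball and yet contains boundary points, the image of the spine.\<close>

lemma another_page:
  assumes K: "cell_cover K B" and Y: "open_from (Suc m) (subtopology T B)" and dim: "\<And>i. i \<in> K \<Longrightarrow> dm i \<le> Suc m"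
    and g: "g \<in> K" "dm g = m" and h: "h \<in> K" "dm h = Suc m" "closed_cell X g \<subseteq> closed_cell X h"
  obtains h' where "h' \<in> K" "h' \<noteq> h" "dm h' = Suc m" "closed_cell X g \<subseteq> closed_cell X h'"
proof (rule ccontr)
  assume no: "\<not> thesis"
  note found = that
  have only: "h' = h" if "h' \<in> K" "dm h' = Suc m" "closed_cell X g \<subseteq> closed_cell X h'" for h'
    using no found[of h'] that by blast
  have KJ: "K \<subseteq> J" and B: "closed_cell X h \<subseteq> B" using K h by (auto simp: cell_cover_def)
  have hJ: "h \<in> J" and gJ: "g \<in> J" using KJ h g by auto
  let ?W = "open_cell X g \<union> open_cell X h"
  have "openin (subtopology T B) (\<Union>i\<in>{g, h}. open_cell X i)"
  proof (rule cell_cover_openin[OF K])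
    fix i j x assume j: "j \<in> K - {g, h}" and i: "i \<in> {g, h}" and x: "x \<in> open_cell X i"
    show "x \<notin> closed_cell X j"
    proof
      assume xj: "x \<in> closed_cell X j"
      have jJ: "j \<in> J" and iJ: "i \<in> J" using j i KJ hJ gJ by auto
      have sub: "closed_cell X i \<subseteq> closed_cell X j" by (rule closed_cell_subcomplex[OF jJ iJ x xj])
      have "dm i < dm j" using closed_cell_subset_dim[OF iJ jJ sub] i j by auto
      then have "i = g" "dm j = Suc m" using dim[of j] i j g h by auto
      then show False using only[of j] j sub by simp
    qed
  qed (use g h in simp)
  then have W: "openin (subtopology T B) ?W" by simp
  have Wh: "?W \<subseteq> closed_cell X h" using open_subset_closed_cell h(3) by blast
  have "subtopology (subtopology T B) ?W = subtopology T ?W"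
    using B Wh by (simp add: subtopology_subtopology Int_absorb1 order_trans[of _ "closed_cell X h"])
  then have "continuous_map (subtopology (subtopology T B) ?W) (Euclidean_space (Suc m)) (cell_inv h)"
    using cell_inv_Euclidean[OF hJ _ Wh, of "Suc m"] h(2) by simp
  moreover have "inj_on (cell_inv h) ?W" using cell_inv_inj[OF hJ] Wh inj_on_subset by blast
  ultimately have o: "openin (Euclidean_space (Suc m)) (cell_inv h ` ?W)" using Y W unfolding open_from_def by blast
  have "cell_inv h ` ?W \<subseteq> topspace (unit_ball (Suc m))"
    using cell_inv(4)[OF hJ] Wh h(2) by auto
  from open_subset_unit_ball[OF o this]
  have disj: "cell_inv h ` ?W \<inter> topspace (ball_boundary (Suc m)) = {}" .
  obtain x where x: "x \<in> open_cell X g" using open_cell_nonempty by blast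
  have "g \<noteq> h" using g h by auto
  then have "x \<notin> open_cell X h" using open_cell_unique[OF gJ hJ x] by blast
  then have "cell_inv h x \<in> topspace (ball_boundary (Suc m))"
    using cell_inv_boundary[OF hJ, of x] x Wh h(2) by auto
  then show False using disj x by blast
qed

text \<open>Two pages glued along their common spine \<open>g\<close> form an open set of the manifold, which a
  third page would approach along the spine.\<close>

lemma no_three_pages:
  assumes K: "cell_cover K B" and Y: "open_into (Suc m) (subtopology T B)"
    and g: "g \<in> K" "dm g = m"
    and h: "h1 \<in> K" "h2 \<in> K" "h3 \<in> K" "distinct [h1, h2, h3]"
    and dmh: "\<And>h. h \<in> {h1, h2, h3} \<Longrightarrow> dm h = Suc m"
    and sub: "\<And>h. h \<in> {h1, h2, h3} \<Longrightarrow> closed_cell X g \<subseteq> closed_cell X h"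
  shows False
proof -
  have KJ: "K \<subseteq> J" using K by (simp add: cell_cover_def)
  have gJ: "g \<in> J" using g KJ by blast
  let ?H = "{h1, h2, h3}"
  have hJ: "h \<in> J" if "h \<in> ?H" for h using that h KJ by blast
  have hB: "closed_cell X h \<subseteq> B" if "h \<in> ?H" for h using that h K by (auto simp: cell_cover_def)
  have gh: "g \<noteq> h" if "h \<in> ?H" for h using dmh[OF that] g by auto
  let ?E = "Euclidean_space (Suc m)"
  \<comment> \<open>The model of two glued pages: the first \<open>m\<close> coordinates run through
    the open ball of the spine, and \<open>x m\<close> is a signed depth, zero on the spine.\<close>
  define U where "U = {x \<in> topspace ?E. (\<Sum>i<m. (x i)\<^sup>2) < 1 \<and> \<bar>x m\<bar> < 1}"
  have UE: "U \<subseteq> topspace ?E" by (auto simp: U_def)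
  have U: "openin ?E U"
  proof -
    have "continuous_map ?E euclideanreal (\<lambda>x. (\<Sum>i<m. (x i)\<^sup>2))" "continuous_map ?E euclideanreal (\<lambda>x. \<bar>x m\<bar>)"
      unfolding Euclidean_space_eu by (simp_all add: continuous_intros)
    from openin_continuous_map_preimage[OF this(1), of "{..<1}"] openin_continuous_map_preimage[OF this(2), of "{..<1}"]
    have "openin ?E ({x \<in> topspace ?E. (\<Sum>i<m. (x i)\<^sup>2) \<in> {..<1}} \<inter> {x \<in> topspace ?E. \<bar>x m\<bar> \<in> {..<1}})"
      by (intro openin_Int) simp_all
    moreover have "{x \<in> topspace ?E. (\<Sum>i<m. (x i)\<^sup>2) \<in> {..<1}} \<inter> {x \<in> topspace ?E. \<bar>x m\<bar> \<in> {..<1}} = U"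
      by (auto simp: U_def)
    ultimately show ?thesis by simp
  qed
  have Ueu: "subtopology ?E U = top_of_set U"
    using UE by (simp add: Euclidean_space_eu subtopology_subtopology Int_absorb1)
  have tr: "truncate m x \<in> topspace (open_unit_ball m)" if "x \<in> U" for x
  proof -
    have "(\<Sum>i<m. (truncate m x i)\<^sup>2) = (\<Sum>i<m. (x i)\<^sup>2)" by (rule sum.cong) (auto simp: truncate_def)
    then show ?thesis using that by (simp add: topspace_open_unit_ball U_def) (simp add: truncate_def)
  qed
  \<comment> \<open>\<open>b h\<close> carries a point of the spine to the boundary sphere of the
    ball of \<open>h\<close>, and \<open>q h\<close> then moves it radially inwards by the fraction
    \<open>\<bar>x m\<bar>\<close>. As this is less than 1 the centre is never reached, so
    \<open>q h\<close> is injective up to the sign of \<open>x m\<close>.\<close>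
  define b where "b = (\<lambda>h u. cell_inv h (cw_map X g u))"
  define q where "q = (\<lambda>h x. cw_map X h (\<lambda>i. (1 - \<bar>x m\<bar>) * b h (truncate m x) i))"
  have og: "cw_map X g u \<in> open_cell X g" if "u \<in> topspace (open_unit_ball m)" for u
    using that g(2) by (auto simp: open_cell_def)
  have og_closed: "cw_map X g u \<in> closed_cell X h" if "u \<in> topspace (open_unit_ball m)" "h \<in> ?H" for u h
    using og[OF that(1)] sub[OF that(2)] open_subset_closed_cell by blast
  have b: "b h u \<in> topspace (ball_boundary (Suc m))" if "u \<in> topspace (open_unit_ball m)" "h \<in> ?H" for u h
  proof -
    have "cw_map X g u \<notin> open_cell X h" using open_cell_unique[OF gJ hJ[OF that(2)] og[OF that(1)]] gh[OF that(2)] by blast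
    then show ?thesis
      using cell_inv_boundary[OF hJ[OF that(2)] og_closed[OF that]] dmh[OF that(2)] unfolding b_def by simp
  qed
  have cb: "cw_map X h (b h u) = cw_map X g u" if "u \<in> topspace (open_unit_ball m)" "h \<in> ?H" for u h
    unfolding b_def by (rule cell_inv(3)[OF hJ[OF that(2)] og_closed[OF that]])
  have bc: "continuous_on U (\<lambda>x. b h (truncate m x))" if hH: "h \<in> ?H" for h
  proof -
    have 1: "continuous_map (top_of_set U) (open_unit_ball m) (truncate m)"
      using continuous_on_truncate[of U m] tr unfolding open_unit_ball_def Euclidean_space_eu
      by (auto simp: continuous_map_in_subtopology subtopology_subtopology)
    have "continuous_map (open_unit_ball m) T (cw_map X g)"
    proof -
      have "open_unit_ball m = subtopology (unit_ball m) (topspace (open_unit_ball m))"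
        by (subst unit_ball_eu, subst open_unit_ball_eu)
           (auto simp: subtopology_subtopology topspace_unit_ball_split intro!: arg_cong[where f = top_of_set])
      then show ?thesis using continuous_map_from_subtopology[OF cell_map(1)[OF gJ]] g(2) by metis
    qed
    then have 2: "continuous_map (open_unit_ball m) (subtopology T (closed_cell X h)) (cw_map X g)"
      using og_closed[OF _ hH] by (auto simp: continuous_map_in_subtopology)
    have "continuous_map (top_of_set U) (unit_ball (Suc m)) (cell_inv h \<circ> (cw_map X g \<circ> truncate m))"
      using continuous_map_compose[OF continuous_map_compose[OF 1 2] cell_inv(1)[OF hJ[OF hH]]] dmh[OF hH] by simp
    then have "continuous_map (top_of_set U) (top_of_set (topspace (unit_ball (Suc m)))) (cell_inv h \<circ> (cw_map X g \<circ> truncate m))"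
      using unit_ball_eu by metis
    then show ?thesis by (simp add: continuous_map_in_subtopology b_def comp_def)
  qed
  have scale: "(\<Sum>i<Suc m. (t * b h u i)\<^sup>2) = t\<^sup>2" "\<forall>i\<ge>Suc m. t * b h u i = 0"
    if "u \<in> topspace (open_unit_ball m)" "h \<in> ?H" for t u h
    using b[OF that] unfolding sum_sq_scale topspace_ball_boundary by simp_all
  have scale_ball: "(\<lambda>i. t * b h u i) \<in> topspace (unit_ball (Suc m))"
    if "u \<in> topspace (open_unit_ball m)" "h \<in> ?H" "\<bar>t\<bar> \<le> 1" for t u h
    using scale[OF that(1,2), of t] that(3) by (simp add: topspace_unit_ball abs_square_le_1)
  have scale_open: "cw_map X h (\<lambda>i. t * b h u i) \<in> open_cell X h"
    if "u \<in> topspace (open_unit_ball m)" "h \<in> ?H" "\<bar>t\<bar> < 1" for t u h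
  proof -
    have "(\<lambda>i. t * b h u i) \<in> topspace (open_unit_ball (dm h))"
      using scale[OF that(1,2), of t] that(3) dmh[OF that(2)] by (simp add: topspace_open_unit_ball abs_square_less_1)
    then show ?thesis by (simp add: open_cell_def)
  qed
  have hc: "continuous_map (unit_ball (Suc m)) T (cw_map X h)" if "h \<in> ?H" for h
    using cell_map(1)[OF hJ[OF that]] dmh[OF that] by simp
  have qc: "continuous_map (top_of_set U) (subtopology T B) (q h)" if hH: "h \<in> ?H" for h
  proof -
    let ?s = "\<lambda>x i. (1 - \<bar>x m\<bar>) * b h (truncate m x) i"
    have "continuous_on U ?s"
    proof (rule continuous_on_coordinatewise_then_product)
      show "continuous_on U (\<lambda>x. (1 - \<bar>x m\<bar>) * b h (truncate m x) i)" for i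
        by (intro continuous_intros continuous_on_product_then_coordinatewise[OF bc[OF hH]])
    qed
    moreover have sB: "?s x \<in> topspace (unit_ball (Suc m))" if "x \<in> U" for x
      using scale_ball[OF tr[OF that] hH] that by (auto simp: U_def)
    ultimately have "continuous_map (top_of_set U) (unit_ball (Suc m)) ?s"
      by (intro continuous_map_into_unit_ball) auto
    then have "continuous_map (top_of_set U) T (cw_map X h \<circ> ?s)"
      by (rule continuous_map_compose[OF _ hc[OF hH]])
    then have "continuous_map (top_of_set U) T (q h)" by (simp add: q_def comp_def)
    moreover have "q h x \<in> B" if "x \<in> U" for x
    proof -
      have "q h x \<in> closed_cell X h" using sB[OF that] dmh[OF hH] by (simp add: q_def closed_cell_def)
      then show ?thesis using hB[OF hH] by blast
    qed
    ultimately show ?thesis by (auto simp: continuous_map_in_subtopology)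
  qed
  have q0: "q h x = cw_map X g (truncate m x)" if "x \<in> U" "x m = 0" "h \<in> ?H" for x h
    using cb[OF tr[OF that(1)] that(3)] that(2) by (simp add: q_def)
  have q1: "q h x \<in> open_cell X h" if "x \<in> U" "x m \<noteq> 0" "h \<in> ?H" for x h
    unfolding q_def by (rule scale_open[OF tr[OF that(1)] that(3)]) (use that in \<open>auto simp: U_def\<close>)
  have qinj: "truncate m x = truncate m y \<and> \<bar>x m\<bar> = \<bar>y m\<bar>" if xy: "x \<in> U" "y \<in> U" "q h x = q h y" and hH: "h \<in> ?H" for x y h
  proof -
    let ?s = "\<lambda>x i. (1 - \<bar>x m\<bar>) * b h (truncate m x) i"
    have pos: "0 < 1 - \<bar>x m\<bar>" "0 < 1 - \<bar>y m\<bar>" using xy by (auto simp: U_def)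
    have in_ball: "?s z \<in> topspace (unit_ball (dm h))" if "z \<in> U" for z
      using scale_ball[OF tr[OF that] hH] that dmh[OF hH] by (auto simp: U_def)
    have s: "?s x = ?s y"
      by (rule inj_onD[OF cell_map_inj[OF hJ[OF hH]] _ in_ball[OF xy(1)] in_ball[OF xy(2)]])
         (use xy(3) in \<open>simp add: q_def\<close>)
    have si: "(1 - \<bar>x m\<bar>) * b h (truncate m x) i = (1 - \<bar>y m\<bar>) * b h (truncate m y) i" for i
      by (rule fun_cong[OF s])
    have "(\<Sum>i<Suc m. ((1 - \<bar>x m\<bar>) * b h (truncate m x) i)\<^sup>2) = (\<Sum>i<Suc m. ((1 - \<bar>y m\<bar>) * b h (truncate m y) i)\<^sup>2)"
      by (rule sum.cong[OF refl]) (rule arg_cong[OF si])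
    then have "(1 - \<bar>x m\<bar>)\<^sup>2 = (1 - \<bar>y m\<bar>)\<^sup>2"
      unfolding scale(1)[OF tr[OF xy(1)] hH] scale(1)[OF tr[OF xy(2)] hH] .
    then have m: "\<bar>x m\<bar> = \<bar>y m\<bar>" using pos by (auto simp: power2_eq_iff)
    have "b h (truncate m x) = b h (truncate m y)"
    proof
      fix i
      show "b h (truncate m x) i = b h (truncate m y) i" using si[of i] m pos by simp
    qed
    then have "cw_map X g (truncate m x) = cw_map X g (truncate m y)"
      using cb[OF tr[OF xy(1)] hH] cb[OF tr[OF xy(2)] hH] by simp
    moreover have "inj_on (cw_map X g) (topspace (unit_ball m))" using cell_map_inj[OF gJ] g(2) by simp
    ultimately have "truncate m x = truncate m y"
      using tr[OF xy(1)] tr[OF xy(2)] by (auto simp: inj_on_def topspace_unit_ball_split)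
    then show ?thesis using m by simp
  qed
  \<comment> \<open>The sign of \<open>x m\<close> selects the page; on the spine the two formulas
    agree.\<close>
  define \<Psi> where "\<Psi> = (\<lambda>x. if 0 \<le> x m then q h1 x else q h2 x)"
  have \<Psi>c: "continuous_map (subtopology ?E U) (subtopology T B) \<Psi>"
    unfolding Ueu \<Psi>_def
  proof (rule continuous_map_cases_le)
    show "continuous_map (top_of_set U) euclideanreal (\<lambda>x. 0)" by simp
    show "continuous_map (top_of_set U) euclideanreal (\<lambda>x. x m)" by (simp add: continuous_on_coordinate)
    show "q h1 x = q h2 x" if "x \<in> topspace (top_of_set U)" "0 = x m" for x
      using q0[of x h1] q0[of x h2] that by simp
  qed (simp_all add: continuous_map_from_subtopology qc)
  have \<Psi>_cell: "\<Psi> x \<in> open_cell X (if x m = 0 then g else if 0 < x m then h1 else h2)" if "x \<in> U" for x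
    using q0[OF that, of h1] q1[OF that, of h1] q1[OF that, of h2] og[OF tr[OF that]] by (auto simp: \<Psi>_def)
  have \<Psi>i: "inj_on \<Psi> U"
  proof (rule inj_onI)
    fix x y assume xy: "x \<in> U" "y \<in> U" "\<Psi> x = \<Psi> y"
    let ?c = "\<lambda>x::nat \<Rightarrow> real. if x m = 0 then g else if 0 < x m then h1 else h2"
    have cJ: "?c x \<in> J" "?c y \<in> J" using gJ hJ by simp_all
    have c: "?c x = ?c y"
      by (rule open_cell_unique[OF cJ \<Psi>_cell[OF xy(1)] \<Psi>_cell[OF xy(2), folded xy(3)]])
    have "g \<noteq> h1" "g \<noteq> h2" "h1 \<noteq> h2" using gh h(4) by auto
    then have sg: "(x m = 0 \<longleftrightarrow> y m = 0) \<and> (0 < x m \<longleftrightarrow> 0 < y m)" using c by (auto split: if_splits)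
    then have "truncate m x = truncate m y \<and> \<bar>x m\<bar> = \<bar>y m\<bar>"
      using qinj[OF xy(1,2), of h1] qinj[OF xy(1,2), of h2] xy(3) by (auto simp: \<Psi>_def split: if_splits)
    moreover then have "x m = y m" using sg by (auto simp: abs_if split: if_splits)
    ultimately show "x = y" using truncate_eqD UE xy by blast
  qed
  have \<Psi>o: "openin (subtopology T B) (\<Psi> ` U)"
    using Y[unfolded open_into_def, rule_format, OF U \<Psi>c \<Psi>i] .
  \<comment> \<open>A radial path in the third page that reaches the spine at \<open>t = 1\<close>.
    By openness its values just before that would lie in the image of the two glued pages, but they
    lie in the open cell of \<open>h3\<close>.\<close>
  define c where "c = (\<lambda>t. cw_map X h3 (\<lambda>i. t * b h3 (\<lambda>_. 0) i))"
  have z: "(\<lambda>_. 0) \<in> topspace (open_unit_ball m)" by (rule zero_open_unit_ball)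
  have cc: "continuous_map (top_of_set {0..1}) (subtopology T B) c"
  proof -
    have "continuous_map (top_of_set {0..1}) (unit_ball (Suc m)) (\<lambda>t i. t * b h3 (\<lambda>_. 0) i)"
      by (rule continuous_map_into_unit_ball[OF continuous_on_ray]) (auto intro!: scale_ball[OF z])
    then have "continuous_map (top_of_set {0..1}) T (cw_map X h3 \<circ> (\<lambda>t i. t * b h3 (\<lambda>_. 0) i))"
      by (rule continuous_map_compose) (simp add: hc)
    then have "continuous_map (top_of_set {0..1}) T c" by (simp add: c_def comp_def)
    moreover have "c t \<in> B" if "t \<in> {0..1}" for t
    proof -
      have "c t \<in> closed_cell X h3"
        using scale_ball[OF z, of h3 t] that dmh[of h3] by (auto simp: c_def closed_cell_def)
      then show ?thesis using hB[of h3] by blast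
    qed
    ultimately show ?thesis by (auto simp: continuous_map_in_subtopology)
  qed
  have o: "openin (top_of_set {0..1}) {t \<in> {0..1}. c t \<in> \<Psi> ` U}"
    using openin_continuous_map_preimage[OF cc \<Psi>o] by simp
  have "c 1 = \<Psi> (\<lambda>_. 0)"
  proof -
    have 0: "(\<lambda>_. 0) \<in> U" by (simp add: U_def topspace_Euclidean_space)
    have "truncate m (\<lambda>_. 0) = (\<lambda>_. 0)" by (simp add: truncate_def fun_eq_iff)
    then show ?thesis using cb[OF z, of h3] q0[OF 0, of h1] by (simp add: c_def \<Psi>_def)
  qed
  moreover have "(\<lambda>_. 0) \<in> U" by (simp add: U_def topspace_Euclidean_space)
  ultimately have "1 \<in> {t \<in> {0..1}. c t \<in> \<Psi> ` U}" by auto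
  then obtain e where e: "e > 0" "ball 1 e \<inter> {0..1} \<subseteq> {t \<in> {0..1}. c t \<in> \<Psi> ` U}"
    using o unfolding openin_contains_ball by blast
  define t where "t = max 0 (1 - e / 2)"
  have t: "0 \<le> t" "t < 1" "t \<in> ball 1 e" using e(1) by (auto simp: t_def dist_real_def)
  then have "t \<in> ball 1 e \<inter> {0..1}" by simp
  then have "c t \<in> \<Psi> ` U" using e(2) by blast
  then obtain x where x: "x \<in> U" "c t = \<Psi> x" by blast
  have "c t \<in> open_cell X h3" unfolding c_def by (rule scale_open[OF z]) (use t in auto)
  then have "h3 = (if x m = 0 then g else if 0 < x m then h1 else h2)"
    using open_cell_unique[OF hJ _ _ \<Psi>_cell[OF x(1)]] x(2) gJ hJ by auto
  then show False using h(4) gh by (auto split: if_splits)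
qed

end

section \<open>Boundary spheres of cells and the axioms of the face lattice\<close>

context strong_cw
begin

definition proper_cells :: "'i \<Rightarrow> 'i set" where
  "proper_cells i = {j \<in> J. j \<noteq> i \<and> closed_cell X j \<subseteq> closed_cell X i}"

lemma dim_proper_cells: "i \<in> J \<Longrightarrow> j \<in> proper_cells i \<Longrightarrow> dm j < dm i"
  using closed_cell_subset_dim[of j i] by (auto simp: proper_cells_def)

text \<open>By \<open>closed_cell_subcomplex\<close>, a boundary point lies in the open cell of a
  proper face, and a face that reaches into the open cell of \<open>i\<close> contains the whole
  closed cell of \<open>i\<close>.\<close>

lemma cell_cover_boundary:
  assumes "i \<in> J"
  shows "cell_cover (proper_cells i) (bd_cell i)"
  unfolding cell_cover_def
proof (intro conjI ballI)
  show "proper_cells i \<subseteq> J" by (auto simp: proper_cells_def)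
  have closed: "x \<in> bd_cell i" if j: "j \<in> proper_cells i" and x: "x \<in> closed_cell X j" for j x
  proof -
    have ji: "j \<in> J" "j \<noteq> i" "closed_cell X j \<subseteq> closed_cell X i" using j by (auto simp: proper_cells_def)
    have "x \<notin> open_cell X i"
    proof
      assume "x \<in> open_cell X i"
      then have "closed_cell X i \<subseteq> closed_cell X j" by (rule closed_cell_subcomplex[OF ji(1) assms _ x])
      then show False using closed_cell_inj[OF ji(1) assms] ji by blast
    qed
    then show ?thesis using x ji(3) closed_cell_split by blast
  qed
  then show "\<And>j. j \<in> proper_cells i \<Longrightarrow> closed_cell X j \<subseteq> bd_cell i" by blast
  show "bd_cell i = (\<Union>j\<in>proper_cells i. open_cell X j)"
  proof (intro equalityI subsetI)
    fix x assume x: "x \<in> bd_cell i"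
    then obtain j where j: "j \<in> J" "dm j < dm i" "x \<in> open_cell X j"
      using cell_map(3)[OF assms] skeleton_belowE by blast
    have "x \<in> closed_cell X i" using x closed_cell_split by blast
    then have "closed_cell X j \<subseteq> closed_cell X i" by (rule closed_cell_subcomplex[OF assms j(1) j(3)])
    then have "j \<in> proper_cells i" using j by (auto simp: proper_cells_def)
    then show "x \<in> (\<Union>j\<in>proper_cells i. open_cell X j)" using j(3) by blast
  next
    fix x assume "x \<in> (\<Union>j\<in>proper_cells i. open_cell X j)"
    then show "x \<in> bd_cell i" using closed open_subset_closed_cell by blast
  qed
qed

lemma boundary_homeomorphic_sphere:
  assumes "i \<in> J" "dm i = Suc n"
  shows "subtopology T (bd_cell i) homeomorphic_space nsphere n"
  using embedding_map_imp_homeomorphic_space[OF cell_map(4)[OF assms(1)]] homeomorphic_space_sym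
  unfolding assms(2) ball_boundary_Suc by blast

text \<open>A cell of largest dimension above \<open>g\<close> is maximal, so
  \<open>maximal_cell_dim\<close> applies to it.\<close>

lemma top_cell_above:
  assumes K: "cell_cover K B" and Y: "open_from n (subtopology T B)" and dim: "\<And>i. i \<in> K \<Longrightarrow> dm i \<le> n"
    and g: "g \<in> K"
  obtains h where "h \<in> K" "dm h = n" "closed_cell X g \<subseteq> closed_cell X h"
proof -
  have KJ: "K \<subseteq> J" using K by (simp add: cell_cover_def)
  define P where "P = (\<lambda>h. h \<in> K \<and> closed_cell X g \<subseteq> closed_cell X h)"
  have "P g" using g by (simp add: P_def)
  moreover have "\<forall>h. P h \<longrightarrow> dm h < Suc n" using dim by (auto simp: P_def le_imp_less_Suc)
  ultimately obtain h where h: "P h" "\<forall>h'. P h' \<longrightarrow> dm h' \<le> dm h"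
    using ex_has_greatest_nat[of P g dm "Suc n"] by blast
  have hK: "h \<in> K" "closed_cell X g \<subseteq> closed_cell X h" using h(1) by (auto simp: P_def)
  have "dm h = n"
  proof (rule maximal_cell_dim[OF K Y dim[OF hK(1)] hK(1)])
    fix j assume j: "j \<in> K" "closed_cell X h \<subseteq> closed_cell X j"
    then have "P j" using hK by (auto simp: P_def)
    then have "dm j \<le> dm h" using h(2) by blast
    then show "j = h" using closed_cell_subset_dim[of h j] j hK KJ by auto
  qed
  then show ?thesis using that hK by blast
qed

lemma card_pages_le:
  assumes K: "cell_cover K B" and Y: "open_into (Suc m) (subtopology T B)" and g: "g \<in> K" "dm g = m"
  shows "card {h \<in> K. dm h = Suc m \<and> closed_cell X g \<subseteq> closed_cell X h} \<le> 2" (is "card ?S \<le> 2")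
proof (rule ccontr)
  assume "\<not> card ?S \<le> 2"
  then have "3 \<le> card ?S" by simp
  then obtain S where S: "S \<subseteq> ?S" "card S = 3" by (meson obtain_subset_with_card_n)
  then obtain h1 h2 h3 where h: "S = {h1, h2, h3}" "h1 \<noteq> h2" "h2 \<noteq> h3" "h1 \<noteq> h3" by (auto simp: card_3_iff)
  show False
    by (rule no_three_pages[OF K Y g, of h1 h2 h3]) (use S h in auto)
qed

lemma card_pages:
  assumes K: "cell_cover K B" and Y: "open_into (Suc m) (subtopology T B)" "open_from (Suc m) (subtopology T B)"
    and dim: "\<And>i. i \<in> K \<Longrightarrow> dm i \<le> Suc m" and g: "g \<in> K" "dm g = m"
  shows "card {h \<in> K. dm h = Suc m \<and> closed_cell X g \<subseteq> closed_cell X h} = 2" (is "card ?S = 2")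
proof -
  obtain h where h: "h \<in> K" "dm h = Suc m" "closed_cell X g \<subseteq> closed_cell X h"
    using top_cell_above[OF K Y(2) dim g(1)] .
  obtain h' where h': "h' \<in> K" "h' \<noteq> h" "dm h' = Suc m" "closed_cell X g \<subseteq> closed_cell X h'"
    using another_page[OF K Y(2) dim g h] .
  have "K \<subseteq> J" using K by (simp add: cell_cover_def)
  then have "finite K" using finite_cells by (rule finite_subset)
  then have "card {h, h'} \<le> card ?S" by (intro card_mono) (use h h' in auto)
  then show ?thesis using card_pages_le[OF K Y(1) g] h'(2) by simp
qed

lemma ball_boundary_1: "topspace (ball_boundary 1) = {\<lambda>i. if i = 0 then 1 else 0, \<lambda>i. if i = 0 then -1 else 0}"
proof -
  have "x = (\<lambda>i. if i = 0 then 1 else 0) \<or> x = (\<lambda>i. if i = 0 then -1 else 0)"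
    if "\<forall>i\<ge>1. x i = 0" "(x 0)\<^sup>2 = 1" for x :: "nat \<Rightarrow> real"
    using that by (auto simp: fun_eq_iff power2_eq_1_iff)
  then show ?thesis by (auto simp: topspace_ball_boundary)
qed

lemma card_ball_boundary_1: "card (topspace (ball_boundary 1)) = 2"
proof -
  have "(\<lambda>i::nat. if i = 0 then 1 else 0 :: real) \<noteq> (\<lambda>i. if i = 0 then -1 else 0)"
  proof
    assume "(\<lambda>i::nat. if i = 0 then 1 else 0 :: real) = (\<lambda>i. if i = 0 then -1 else 0)"
    from fun_cong[OF this, of 0] show False by simp
  qed
  then show ?thesis unfolding ball_boundary_1 by simp
qed

lemma open_cell_dim_0: "dm j = 0 \<Longrightarrow> open_cell X j = {cw_map X j (\<lambda>_. 0)}"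
proof -
  assume "dm j = 0"
  moreover have "topspace (open_unit_ball 0) = {\<lambda>_. 0}" by (auto simp: topspace_open_unit_ball)
  ultimately show ?thesis by (simp add: open_cell_def)
qed

text \<open>The diamond at the empty face. No cell represents the empty face, so the argument with
  pages does not apply; instead the two boundary points of the 1-ball are counted.\<close>

lemma card_edge_vertices:
  assumes "i \<in> J" "dm i = 1"
  shows "card (proper_cells i) = 2"
proof -
  have zero: "dm j = 0" if "j \<in> proper_cells i" for j using dim_proper_cells[OF assms(1) that] assms(2) by simp
  have PJ: "proper_cells i \<subseteq> J" by (auto simp: proper_cells_def)
  have "bd_cell i = (\<Union>j\<in>proper_cells i. open_cell X j)"
    using cell_cover_boundary[OF assms(1)] by (simp add: cell_cover_def)
  also have "\<dots> = (\<lambda>j. cw_map X j (\<lambda>_. 0)) ` proper_cells i" using open_cell_dim_0 zero by auto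
  finally have eq: "bd_cell i = (\<lambda>j. cw_map X j (\<lambda>_. 0)) ` proper_cells i" .
  have "inj_on (\<lambda>j. cw_map X j (\<lambda>_. 0)) (proper_cells i)"
  proof (rule inj_onI)
    fix j l assume jl: "j \<in> proper_cells i" "l \<in> proper_cells i" "cw_map X j (\<lambda>_. 0) = cw_map X l (\<lambda>_. 0)"
    then show "j = l" using open_cell_unique[of j l "cw_map X j (\<lambda>_. 0)"] open_cell_dim_0 zero PJ by auto
  qed
  then have "card (proper_cells i) = card (bd_cell i)" unfolding eq by (rule card_image[symmetric])
  also have "\<dots> = card (topspace (ball_boundary (dm i)))"
    by (rule card_image, rule inj_on_subset[OF cell_map_inj[OF assms(1)]]) (simp add: topspace_unit_ball_split)
  finally show ?thesis using card_ball_boundary_1 assms(2) by simp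
qed

lemma card_closed_cells: "K \<subseteq> J \<Longrightarrow> card (closed_cell X ` K) = card K"
  by (rule card_image) (auto intro!: inj_onI closed_cell_inj)

lemma faces_between:
  assumes "i \<in> J"
  shows "{M \<in> faces X. G \<subseteq> M \<and> M \<subseteq> closed_cell X i \<and> face_dim X M = int n}
    = closed_cell X ` {h \<in> insert i (proper_cells i). dm h = n \<and> G \<subseteq> closed_cell X h}"
proof (intro equalityI subsetI)
  fix M assume "M \<in> {M \<in> faces X. G \<subseteq> M \<and> M \<subseteq> closed_cell X i \<and> face_dim X M = int n}"
  then have M: "M \<in> faces X" "G \<subseteq> M" "M \<subseteq> closed_cell X i" "face_dim X M = int n" by auto
  show "M \<in> closed_cell X ` {h \<in> insert i (proper_cells i). dm h = n \<and> G \<subseteq> closed_cell X h}"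
  proof (cases rule: faces_cases[OF M(1)])
    case 1
    then show ?thesis using M(4) face_dim_empty by simp
  next
    case (2 h)
    then show ?thesis using M face_dim_closed_cell[OF 2(1)] by (auto simp: proper_cells_def)
  qed
next
  fix M assume "M \<in> closed_cell X ` {h \<in> insert i (proper_cells i). dm h = n \<and> G \<subseteq> closed_cell X h}"
  then obtain h where h: "M = closed_cell X h" "h \<in> insert i (proper_cells i)" "dm h = n" "G \<subseteq> closed_cell X h" by blast
  then have "h \<in> J" "closed_cell X h \<subseteq> closed_cell X i" using assms by (auto simp: proper_cells_def)
  then show "M \<in> {M \<in> faces X. G \<subseteq> M \<and> M \<subseteq> closed_cell X i \<and> face_dim X M = int n}"
    using h face_dim_closed_cell[of h] closed_cell_face[of h] by simp
qed

text \<open>\<open>grading\<close> and \<open>diamond\<close> are read off from the boundary sphere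
  of the cell \<open>H\<close>, which its proper faces tile: maximal cells of this sphere have full
  dimension, and its cells of codimension 1 lie in exactly two top cells.\<close>

lemma face_lattice: "face_lattice X"
proof
  show "finite (faces X)" using finite_cells by (simp add: faces_def)
  show "G \<inter> H \<in> faces X" if "G \<in> faces X" "H \<in> faces X" for G H
    using strongly_regular that by (simp add: strongly_regular_cw_def)
  show "face_dim X G < face_dim X H" if GH: "G \<in> faces X" "H \<in> faces X" "G \<subset> H" for G H
  proof (cases rule: faces_cases[OF GH(2)])
    case (2 j)
    show ?thesis
    proof (cases rule: faces_cases[OF GH(1)])
      case 1
      then show ?thesis using 2 face_dim_empty face_dim_closed_cell by simp
    next
      case i: (2 i)
      then show ?thesis using 2 GH(3) closed_cell_subset_dim[of i j] face_dim_closed_cell by auto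
    qed
  qed (use GH in simp)
  show "\<exists>M\<in>faces X. G \<subseteq> M \<and> M \<subset> H \<and> face_dim X M = face_dim X H - 1"
    if GH: "G \<in> faces X" "H \<in> faces X" "G \<subset> H" for G H
  proof (cases rule: faces_cases[OF GH(2)])
    case (2 i)
    show ?thesis
    proof (cases "dm i")
      case 0
      have "G = {}"
      proof (cases rule: faces_cases[OF GH(1)])
        case j: (2 j)
        then show ?thesis using closed_cell_subset_dim[of j i] 2 0 GH(3) by auto
      qed
      then show ?thesis using GH 2 0 face_dim_empty face_dim_closed_cell by auto
    next
      case (Suc n)
      have cover: "cell_cover (proper_cells i) (bd_cell i)" by (rule cell_cover_boundary[OF 2(1)])
      have "\<exists>g\<in>proper_cells i. G \<subseteq> closed_cell X g"
      proof (cases rule: faces_cases[OF GH(1)])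
        case 1
        \<comment> \<open>For \<open>G = {}\<close> any cell of the nonempty boundary sphere will
          do.\<close>
        have "topspace (ball_boundary (dm i)) \<noteq> {}" using Suc in_topspace_nsphere ball_boundary_Suc by (metis empty_iff)
        then obtain x where "x \<in> bd_cell i" by blast
        then have "x \<in> (\<Union>g\<in>proper_cells i. open_cell X g)" using cover by (simp add: cell_cover_def)
        then show ?thesis using 1 by blast
      next
        case j: (2 j)
        then have "j \<in> proper_cells i" using 2 GH(3) by (auto simp: proper_cells_def)
        then show ?thesis using j by auto
      qed
      then obtain g where g: "g \<in> proper_cells i" "G \<subseteq> closed_cell X g" by blast
      have Y: "open_from n (subtopology T (bd_cell i))"
        using open_from_homeomorphic boundary_homeomorphic_sphere[OF 2(1) Suc] open_from_nsphere by blast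
      have dim: "dm j \<le> n" if "j \<in> proper_cells i" for j using dim_proper_cells[OF 2(1) that] Suc by simp
      obtain h where h: "h \<in> proper_cells i" "dm h = n" "closed_cell X g \<subseteq> closed_cell X h"
        using top_cell_above[OF cover Y dim g(1)] .
      have hJ: "h \<in> J" "h \<noteq> i" "closed_cell X h \<subseteq> closed_cell X i" using h by (auto simp: proper_cells_def)
      have "closed_cell X h \<subset> H" using hJ 2 closed_cell_inj[of h i] by auto
      moreover have "face_dim X (closed_cell X h) = face_dim X H - 1"
        using face_dim_closed_cell hJ 2 h(2) Suc by simp
      ultimately show ?thesis using g h(3) closed_cell_face[OF hJ(1)] by blast
    qed
  qed (use GH in simp)
  show "card {M \<in> faces X. G \<subseteq> M \<and> M \<subseteq> H \<and> face_dim X M = face_dim X G + 1} = 2"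
    if GH: "G \<in> faces X" "H \<in> faces X" "G \<subseteq> H" "face_dim X H = face_dim X G + 2" for G H
  proof (cases rule: faces_cases[OF GH(2)])
    case 1
    then show ?thesis using GH by simp
  next
    case (2 i)
    show ?thesis
    proof (cases rule: faces_cases[OF GH(1)])
      case 1
      then have i1: "dm i = 1" using GH(4) 2 face_dim_empty face_dim_closed_cell by simp
      have "{h \<in> insert i (proper_cells i). dm h = 0 \<and> G \<subseteq> closed_cell X h} = proper_cells i"
        using i1 1 dim_proper_cells[OF 2(1)] by (auto simp: proper_cells_def)
      moreover have "proper_cells i \<subseteq> J" by (auto simp: proper_cells_def)
      ultimately show ?thesis
        using faces_between[OF 2(1), of G 0] card_edge_vertices[OF 2(1) i1] card_closed_cells 1 2 face_dim_empty by simp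
    next
      case g: (2 g)
      let ?m = "dm g"
      have dmi: "dm i = Suc (Suc ?m)" using GH(4) 2 g face_dim_closed_cell by simp
      have gP: "g \<in> proper_cells i" using g 2 GH(3) dmi by (auto simp: proper_cells_def)
      have cover: "cell_cover (proper_cells i) (bd_cell i)" by (rule cell_cover_boundary[OF 2(1)])
      note sphere = boundary_homeomorphic_sphere[OF 2(1) dmi]
      have "card {h \<in> proper_cells i. dm h = Suc ?m \<and> closed_cell X g \<subseteq> closed_cell X h} = 2"
      proof (rule card_pages[OF cover _ _ _ gP refl])
        show "open_into (Suc ?m) (subtopology T (bd_cell i))" by (rule open_into_homeomorphic[OF sphere open_into_nsphere])
        show "open_from (Suc ?m) (subtopology T (bd_cell i))" by (rule open_from_homeomorphic[OF sphere open_from_nsphere])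
        show "dm j \<le> Suc ?m" if "j \<in> proper_cells i" for j using dim_proper_cells[OF 2(1) that] dmi by simp
      qed
      moreover have "{h \<in> insert i (proper_cells i). dm h = Suc ?m \<and> G \<subseteq> closed_cell X h}
          = {h \<in> proper_cells i. dm h = Suc ?m \<and> closed_cell X g \<subseteq> closed_cell X h}" using dmi g by auto
      moreover have "{h \<in> proper_cells i. dm h = Suc ?m \<and> closed_cell X g \<subseteq> closed_cell X h} \<subseteq> J"
        by (auto simp: proper_cells_def)
      ultimately have "card {M \<in> faces X. G \<subseteq> M \<and> M \<subseteq> closed_cell X i \<and> face_dim X M = int (Suc ?m)} = 2"
        unfolding faces_between[OF 2(1)] by (simp add: card_closed_cells)
      moreover have "face_dim X G + 1 = int (Suc ?m)" using g face_dim_closed_cell by simp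
      ultimately show ?thesis by (simp only: 2(2))
    qed
  qed
qed

text \<open>For \<open>d \<ge> 1\<close> a ridge has dimension at least 0, so it is a genuine cell
  and the spine of at most two pages in the whole space. Only \<open>open_into\<close> is assumed,
  because balls are to be included.\<close>

lemma thin_manifold:
  assumes "open_into d T" "1 \<le> d"
  shows "face_lattice.thin X d (faces_of_dim X (faces X) (int d))"
  unfolding face_lattice.thin_def[OF face_lattice]
proof (intro ballI impI)
  fix R assume R: "R \<in> faces X" "face_dim X R = int d - 1"
  obtain m where d: "d = Suc m" using assms(2) by (cases d) auto
  show "card {F \<in> faces_of_dim X (faces X) (int d). R \<subseteq> F} \<le> 2"
  proof (cases rule: faces_cases[OF R(1)])
    case 1
    then show ?thesis using R face_dim_empty d by simp
  next
    case (2 g)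
    have cover: "cell_cover J (topspace T)" using cells_cover closed_cell_subset by (simp add: cell_cover_def)
    have Y: "open_into (Suc m) (subtopology T (topspace T))" using assms(1) d by simp
    have dmg: "dm g = m" using R(2) 2 d face_dim_closed_cell by simp
    have "{F \<in> faces_of_dim X (faces X) (int d). R \<subseteq> F}
        = closed_cell X ` {h \<in> J. dm h = Suc m \<and> closed_cell X g \<subseteq> closed_cell X h}"
      using 2 d face_dim_closed_cell face_dim_empty by (auto simp: faces_of_dim_def faces_def)
    then show ?thesis
      using card_pages_le[OF cover Y 2(1) dmg] card_closed_cells[of "{h \<in> J. dm h = Suc m \<and> closed_cell X g \<subseteq> closed_cell X h}"]
      by (simp add: subset_iff)
  qed
qed

end

theorem theorem3p4:
  fixes X :: "('i, 'a) cw" and d :: nat and k :: int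
  assumes "d \<ge> 1"
    and "cw_sphere d X \<or> cw_ball d X"
    and "shellable d X"
    and "\<lfloor>(real d - 1) / 2\<rfloor> \<le> k" and "k \<le> int d"
  shows
    "real (f_num X k (faces X)) \<ge>
       1/2 * (real (nat \<lceil>(real d + 1) / 2\<rceil> choose nat (int d - k)) +
              real (nat \<lfloor>(real d + 1) / 2\<rfloor> choose nat (int d - k))) * real (f_num X (int d) (faces X))
       + 1/2 * real (f_num X k (boundary_complex X (faces X)))
     \<and>
     (real (f_num X k (faces X)) =
       1/2 * (real (nat \<lceil>(real d + 1) / 2\<rceil> choose nat (int d - k)) +
              real (nat \<lfloor>(real d + 1) / 2\<rfloor> choose nat (int d - k))) * real (f_num X (int d) (faces X))
       + 1/2 * real (f_num X k (boundary_complex X (faces X)))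
      \<longleftrightarrow> k = int d \<or> (k = int d - 1 \<and> simplicial X))"
proof -
  interpret strong_cw X
    by unfold_locales (use assms(2) in \<open>auto simp: cw_sphere_def cw_ball_def\<close>)
  have "open_into d (cw_space X)"
    using assms(2) open_into_homeomorphic open_into_nsphere open_into_unit_ball
    unfolding cw_sphere_def cw_ball_def by blast
  then show ?thesis
    by (intro face_lattice.shellable_face_numbers[OF face_lattice assms(1,3) thin_manifold assms(4,5)] assms(1))
qed

end
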